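(* Let $\Gamma$ be a Jordan curve in $\mathbb{R}^2$. If $\Gamma$ has the $(1/2, r_0)$-chordal property for some $r_0>0$, then $\Gamma$ has the level Jordan curve property.
   Context: For a Jordan curve $\Gamma\subset\mathbb{R}^2$ let $\Omega$ be the bounded component of $\mathbb{R}^2\setminus\Gamma$. The signed distance function is $\mathrm{dist}^*(x,\Gamma)=\mathrm{dist}(x,\Gamma)$ for $x\in\Omega$ and $\mathrm{dist}^*(x,\Gamma)=-\mathrm{dist}(x,\Gamma)$ for $x\in\mathbb{R}^2\setminus\Omega$. For $\epsilon\in\mathbb{R}$ the $\epsilon$-level set is $\gamma_\epsilon=\{x\in\mathbb{R}^2:\mathrm{dist}^*(x,\Gamma)=\epsilon\}$. $\Gamma$ has the level Jordan curve property if there exists $\epsilon_0>0$ such that $\gamma_\epsilon$ is a Jordan curve for every $0<|\epsilon|\le\epsilon_0$. For $x,y$ on a Jordan curve $\Gamma$, $\Gamma(x,y)$ denotes the subarc of $\Gamma$ connecting $x$ and $y$ that has the smaller diameter (either subarc when both have the same diameter). For distinct $x,y\in\Gamma$, with $l_{x,y}$ the infinite line through $x$ and $y$, set $\zeta_\Gamma(x,y)=\frac{1}{|x-y|}\sup_{z\in\Gamma(x,y)}\mathrm{dist}(z,l_{x,y})$. For $\zeta>0$ and $r_0>0$, $\Gamma$ has the $(\zeta,r_0)$-chordal property if $\sup\{\zeta_\Gamma(x,y): x,y\in\Gamma,\ 0<|x-y|\le r_0\}\le\zeta$. *)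

theory Defs
  imports "HOL-Analysis.Analysis"
begin

text \<open>
  The definitions are polymorphic so that they can be moved between \<^typ>\<open>real^2\<close> and
  \<^typ>\<open>complex\<close>, where the library states the Jordan curve theorem.  They have their
  intended meaning only in dimension two.
\<close>

definition jordan_curve :: "'a::euclidean_space set \<Rightarrow> bool" where
  "jordan_curve \<Gamma> \<longleftrightarrow>
     (\<exists>g. simple_path g \<and> pathfinish g = pathstart g \<and> path_image g = \<Gamma>)"

definition jordan_domain :: "'a::euclidean_space set \<Rightarrow> 'a set" where
  "jordan_domain \<Gamma> = (THE \<Omega>. \<Omega> \<in> components (- \<Gamma>) \<and> bounded \<Omega>)"

definition signed_dist :: "'a::euclidean_space \<Rightarrow> 'a set \<Rightarrow> real" where
  "signed_dist x \<Gamma> = (if x \<in> jordan_domain \<Gamma> then infdist x \<Gamma> else - infdist x \<Gamma>)"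

definition level_set :: "'a::euclidean_space set \<Rightarrow> real \<Rightarrow> 'a set" where
  "level_set \<Gamma> \<epsilon> = {x. signed_dist x \<Gamma> = \<epsilon>}"

definition level_jordan_curve_property :: "'a::euclidean_space set \<Rightarrow> bool" where
  "level_jordan_curve_property \<Gamma> \<longleftrightarrow>
     (\<exists>\<epsilon>\<^sub>0>0. \<forall>\<epsilon>. 0 < \<bar>\<epsilon>\<bar> \<and> \<bar>\<epsilon>\<bar> \<le> \<epsilon>\<^sub>0 \<longrightarrow> jordan_curve (level_set \<Gamma> \<epsilon>))"

definition subarcs :: "'a::euclidean_space set \<Rightarrow> 'a \<Rightarrow> 'a \<Rightarrow> 'a set set" where
  "subarcs \<Gamma> x y =
     {path_image g | g. arc g \<and> pathstart g = x \<and> pathfinish g = y \<and> path_image g \<subseteq> \<Gamma>}"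

text \<open>
  The arc \<open>\<Gamma>(x,y)\<close> is not unique when both subarcs have the same diameter, so it is
  described by a choice function \<open>S\<close>.
\<close>

definition smaller_subarc_choice ::
    "'a::euclidean_space set \<Rightarrow> ('a \<Rightarrow> 'a \<Rightarrow> 'a set) \<Rightarrow> bool" where
  "smaller_subarc_choice \<Gamma> S \<longleftrightarrow>
     (\<forall>x\<in>\<Gamma>. \<forall>y\<in>\<Gamma>. x \<noteq> y \<longrightarrow>
        S x y \<in> subarcs \<Gamma> x y \<and> (\<forall>A\<in>subarcs \<Gamma> x y. diameter (S x y) \<le> diameter A))"

definition chordal_ratio ::
    "('a::euclidean_space \<Rightarrow> 'a \<Rightarrow> 'a set) \<Rightarrow> 'a \<Rightarrow> 'a \<Rightarrow> real" where
  "chordal_ratio S x y = 1 / dist x y * (SUP z\<in>S x y. infdist z (affine hull {x, y}))"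

text \<open>
  The supremum over pairs of points may be infinite and is therefore taken in
  \<^typ>\<open>ereal\<close>; the one over a subarc is a maximum of a continuous function on a compact set.
  Requiring only that some choice of the arcs satisfies the bound gives the weakest
  condition, so a theorem assuming it holds for every choice.
\<close>

definition chordal_property :: "real \<Rightarrow> real \<Rightarrow> 'a::euclidean_space set \<Rightarrow> bool" where
  "chordal_property \<zeta> r\<^sub>0 \<Gamma> \<longleftrightarrow>
     (\<exists>S. smaller_subarc_choice \<Gamma> S \<and>
        (SUP (x, y)\<in>{(x, y). x \<in> \<Gamma> \<and> y \<in> \<Gamma> \<and> 0 < dist x y \<and> dist x y \<le> r\<^sub>0}.
           ereal (chordal_ratio S x y)) \<le> ereal \<zeta>)"

end

theory Submission
  imports Defs "HOL-Complex_Analysis.Complex_Analysis"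
begin

text \<open>
  Fix a side \<open>S\<close> of \<open>\<Gamma>\<close> and a small \<open>\<epsilon> > 0\<close>, and let \<open>K\<close> be the set of points of \<open>S\<close> at distance
  \<open>\<epsilon>\<close> from \<open>\<Gamma>\<close>.  The chordal condition with constant \<open>1/2\<close> enters through one observation: if a
  point \<open>z\<close> keeps the distance \<open>|a - b|/2\<close> from the small arc between \<open>a\<close> and \<open>b\<close>, then the ray from
  \<open>z\<close> perpendicular to the chord and away from it misses the arc, hence the arc and the chord do
  not enclose \<open>z\<close>.

  First, \<open>{x \<in> S. dist x \<Gamma> > s}\<close> is connected for small \<open>s\<close>: for two of its points \<open>y\<^sub>1, y\<^sub>2\<close> a
  continuous branch of \<open>arg ((x - y\<^sub>1) / (x - y\<^sub>2))\<close> on \<open>\<Gamma>\<close> extends to the closed \<open>s\<close>-neighbourhood of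
  \<open>\<Gamma>\<close> along the segments to points of \<open>\<Gamma>\<close>, and by the observation the extension does not depend on
  the chosen point; by Borsuk's criterion the neighbourhood does not separate \<open>y\<^sub>1\<close> from \<open>y\<^sub>2\<close>.

  Second, \<open>K\<close> locally embeds into the line.  A winding number argument shows that no other point of
  \<open>K\<close> has a nearest point inside the arc spanned by the points nearest to \<open>x \<in> K\<close>.  If the two ends
  of this arc lie in an open half plane bounded by a line through \<open>x\<close>, then a linear projection is
  injective on \<open>K\<close> near \<open>x\<close>.  Otherwise they are antipodal, \<open>K\<close> has at most two branches at \<open>x\<close>,
  both on the same side of the diameter, and the height over the diameter, with a sign telling the
  branches apart, is injective.

  Finally, the frontier \<open>M\<close> of \<open>{x \<in> S. dist x \<Gamma> > \<epsilon>}\<close> is a minimal separator of the plane, so by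
  Janiszewski's theorem no decomposition of \<open>M\<close> into two proper closed subsets has a connected
  intersection.  Together with the local embeddings this makes \<open>M\<close> a Jordan curve that is open in
  \<open>K\<close>, and the connectedness of the sets above for \<open>s < \<epsilon>\<close> leaves no room for \<open>K - M\<close>.
\<close>

subsection \<open>Irreducible separators of the plane\<close>

definition irreducible_separator :: "complex set \<Rightarrow> bool" where
  "irreducible_separator M \<longleftrightarrow> compact M \<and> \<not> connected (- M) \<and> (\<forall>A. closed A \<longrightarrow> A \<subset> M \<longrightarrow> connected (- A))"

text \<open>A continuous injection is enough: on a compact \<open>K \<inter> cball x \<rho>\<close>
  it is automatically an embedding into the line. That its image contains an interval is derived
  below, for irreducible separators.\<close>

definition line_chart_at :: "complex set \<Rightarrow> complex \<Rightarrow> bool" where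
  "line_chart_at K x \<longleftrightarrow>
     (\<exists>\<rho>>0. \<exists>h::complex \<Rightarrow> real. continuous_on (K \<inter> cball x \<rho>) h \<and> inj_on h (K \<inter> cball x \<rho>))"

text \<open>By minimality neither \<open>A\<close> nor \<open>B\<close> separates the plane. If
  \<open>A \<inter> B\<close> were connected, Janiszewski's theorem would carry this over to the
  union \<open>M\<close>.\<close>

lemma irreducible_separator_cover:
  fixes M :: "complex set"
  assumes M: "irreducible_separator M" and "closed A" "closed B" "M = A \<union> B" "A \<noteq> M" "B \<noteq> M"
  shows "\<not> connected (A \<inter> B)"
proof
  assume con: "connected (A \<inter> B)"
  have "compact M" and sep: "\<not> connected (- M)" and cA: "connected (- A)" and cB: "connected (- B)"
    using assms by (auto simp: irreducible_separator_def)
  have "compact A"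
    using compact_Int_closed[OF \<open>compact M\<close> \<open>closed A\<close>] \<open>M = A \<union> B\<close> by (simp add: Int_absorb1)
  have "connected_component (- M) a b" if "a \<in> - M" "b \<in> - M" for a b
  proof -
    have "connected_component (- A) a b" "connected_component (- B) a b"
      using that cA cB \<open>M = A \<union> B\<close> by (auto simp: connected_iff_connected_component)
    then show ?thesis
      using Janiszewski[OF \<open>compact A\<close> \<open>closed B\<close> con] \<open>M = A \<union> B\<close> by auto
  qed
  then show False
    using sep by (auto simp: connected_iff_connected_component)
qed

text \<open>A separation of \<open>M - {x}\<close>, with \<open>x\<close> added to both parts,
  covers \<open>M\<close> by two proper closed subsets that meet in at most
  \<open>x\<close>.\<close>

lemma irreducible_separator_connected_punctured:
  fixes M :: "complex set"
  assumes M: "irreducible_separator M"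
  shows "connected (M - {x})"
proof (rule ccontr)
  assume "\<not> connected (M - {x})"
  then obtain A B where AB: "open A" "open B" "M - {x} \<subseteq> A \<union> B" "A \<inter> B \<inter> (M - {x}) = {}"
      "A \<inter> (M - {x}) \<noteq> {}" "B \<inter> (M - {x}) \<noteq> {}"
    unfolding connected_def by blast
  have "closed M" using M by (simp add: irreducible_separator_def compact_imp_closed)
  define C D where "C = (M \<inter> {x}) \<union> (M - A)" and "D = (M \<inter> {x}) \<union> (M - B)"
  have "closed C" "closed D"
    using AB \<open>closed M\<close> unfolding C_def D_def by (intro closed_Un closed_Int closed_Diff closed_singleton; simp)+
  moreover have "M = C \<union> D" "C \<noteq> M" "D \<noteq> M" using AB by (auto simp: C_def D_def)
  moreover have "C \<inter> D \<subseteq> {x}" using AB by (auto simp: C_def D_def)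
  then have "connected (C \<inter> D)" by (metis connected_empty connected_sing subset_singletonD)
  ultimately show False using irreducible_separator_cover[OF M] by blast
qed

section \<open>Charts of an irreducible separator and its parametrization as a simple closed
  curve\<close>

lemma irreducible_separator_interval_chart:
  fixes M :: "complex set" and h :: "complex \<Rightarrow> real"
  assumes M: "irreducible_separator M" and x: "x \<in> M" and "0 < r"
    and cont: "continuous_on (M \<inter> cball x r) h" and inj: "inj_on h (M \<inter> cball x r)"
  obtains \<delta> where "0 < \<delta>" "{h x - \<delta>..h x + \<delta>} \<subseteq> h ` (M \<inter> ball x r)"
    "\<And>y. y \<in> M \<inter> cball x r \<Longrightarrow> \<bar>h y - h x\<bar> \<le> \<delta> \<Longrightarrow> y \<in> ball x r"
proof -
  note cov = irreducible_separator_cover[OF M]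
  have "compact M" and sep: "\<not> connected (- M)" using M by (simp_all add: irreducible_separator_def)
  then have "closed M" by (simp add: compact_imp_closed)
  define E where "E = M \<inter> cball x r"
  have "closed E" "compact E" "x \<in> E"
    using x \<open>0 < r\<close> \<open>compact M\<close> by (auto simp: E_def compact_Int_closed closed_Int \<open>closed M\<close>)
  \<comment> \<open>A single point does not separate the plane. The second point will witness that
    the set \<open>A\<close> below is a proper subset of \<open>M\<close>.\<close>
  obtain y0 where y0: "y0 \<in> M" "y0 \<noteq> x"
  proof -
    have "M \<noteq> {x}"
      using sep connected_punctured_universe[of x] by (auto simp: Compl_eq_Diff_UNIV)
    then show ?thesis using x that by auto
  qed
  \<comment> \<open>Values to be avoided: those on the sphere, so that \<open>A\<close> below stays
    inside the ball, and that of \<open>y0\<close>, so that \<open>A\<close> misses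
    \<open>y0\<close>.\<close>
  define Z where "Z = h ` (M \<inter> sphere x r \<union> (E \<inter> {y0}))"
  have "compact (M \<inter> sphere x r \<union> (E \<inter> {y0}))"
    using \<open>compact M\<close> by (auto simp: compact_Un compact_Int_closed \<open>compact E\<close>)
  moreover have sub: "M \<inter> sphere x r \<union> (E \<inter> {y0}) \<subseteq> E" by (auto simp: E_def)
  ultimately have "compact Z"
    unfolding Z_def using cont continuous_on_subset E_def compact_continuous_image by metis
  have "h x \<notin> Z"
  proof
    assume "h x \<in> Z"
    then obtain y where "y \<in> M \<inter> sphere x r \<union> (E \<inter> {y0})" "h x = h y"
      unfolding Z_def by blast
    then show False
      using inj sub \<open>x \<in> E\<close> y0 \<open>0 < r\<close> unfolding E_def[symmetric] inj_on_def
      by (metis Int_iff Un_iff dist_self less_irrefl mem_sphere singletonD subsetD)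
  qed
  then obtain d where "d > 0" and d: "ball (h x) d \<subseteq> - Z"
    using \<open>compact Z\<close> by (metis ComplI compact_imp_closed open_Compl open_contains_ball)
  have key: "\<sigma> \<in> h ` E \<and> \<tau> \<in> h ` E" if st: "h x - d < \<sigma>" "\<sigma> < h x" "h x < \<tau>" "\<tau> < h x + d" for \<sigma> \<tau>
  proof -
    define A where "A = E \<inter> h -` {\<sigma>..\<tau>}"
    define B where "B = (M - ball x r) \<union> (E \<inter> h -` ({..\<sigma>} \<union> {\<tau>..}))"
    have "closed A" "closed (E \<inter> h -` ({..\<sigma>} \<union> {\<tau>..}))"
      unfolding A_def using cont \<open>closed E\<close>
      by (intro continuous_closed_preimage closed_Un closed_atMost closed_atLeast
          closed_atLeastAtMost; simp add: E_def)+
    then have "closed A" "closed B"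
      unfolding B_def using \<open>closed M\<close> by (auto intro!: closed_Un closed_Diff)
    moreover have "M = A \<union> B" unfolding A_def B_def E_def by auto
    moreover have "x \<notin> B" using \<open>0 < r\<close> st by (auto simp: B_def)
    then have "B \<noteq> M" using x by auto
    moreover have "y0 \<notin> A"
      using d st unfolding A_def Z_def
      by (force simp: dist_real_def)
    then have "A \<noteq> M" using y0 by auto
    ultimately have nc: "\<not> connected (A \<inter> B)"
      using cov by blast
    have AB: "\<exists>\<upsilon>\<in>{\<sigma>,\<tau>}. h y = \<upsilon>" if "y \<in> A \<inter> B" for y
    proof (cases "y \<in> ball x r")
      case True then show ?thesis using that by (auto simp: A_def B_def)
    next
      case False
      then have "y \<in> M \<inter> sphere x r" using that by (auto simp: A_def E_def)
      then have "h y \<in> Z" by (auto simp: Z_def)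
      moreover have "h y \<in> {\<sigma>..\<tau>}" using that by (auto simp: A_def)
      ultimately show ?thesis using d st by (auto simp: dist_real_def subset_iff)
    qed
    \<comment> \<open>Points of \<open>A \<inter> B\<close> take only the values \<sigma> and
      \<tau>. If one of these is omitted, injectivity leaves at most one point, against the covering
      lemma.\<close>
    have *: "connected (A \<inter> B)" if "\<upsilon> \<in> {\<sigma>,\<tau>}" "\<upsilon> \<notin> h ` E" for \<upsilon>
    proof -
      have "y = z" if "y \<in> A \<inter> B" "z \<in> A \<inter> B" for y z
      proof -
        have "y \<in> E" "z \<in> E" using that by (auto simp: A_def)
        moreover have "h y = h z"
          using AB[OF \<open>y \<in> A \<inter> B\<close>] AB[OF \<open>z \<in> A \<inter> B\<close>] \<open>\<upsilon> \<in> {\<sigma>,\<tau>}\<close> \<open>\<upsilon> \<notin> h ` E\<close> \<open>y \<in> E\<close> \<open>z \<in> E\<close> by auto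
        ultimately show ?thesis using inj by (auto simp: E_def inj_on_def)
      qed
      then have "A \<inter> B = {} \<or> (\<exists>y. A \<inter> B = {y})" by blast
      then show ?thesis by (metis connected_empty connected_sing)
    qed
    show ?thesis using * nc by blast
  qed
  show thesis
  proof
    show "0 < d / 2" using \<open>d > 0\<close> by simp
    show ball: "y \<in> ball x r" if "y \<in> M \<inter> cball x r" "\<bar>h y - h x\<bar> \<le> d / 2" for y
    proof (rule ccontr)
      assume "y \<notin> ball x r"
      then have "h y \<in> Z" using that by (auto simp: Z_def)
      moreover have "h y \<in> ball (h x) d"
        using that \<open>d > 0\<close> by (simp add: dist_real_def abs_minus_commute)
      ultimately show False using d by blast
    qed
    show "{h x - d / 2..h x + d / 2} \<subseteq> h ` (M \<inter> ball x r)"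
    proof
      fix \<tau> assume t: "\<tau> \<in> {h x - d / 2..h x + d / 2}"
      have "\<tau> \<in> h ` E"
      proof (cases "\<tau> = h x")
        case True then show ?thesis using \<open>x \<in> E\<close> by auto
      next
        case False
        then consider "\<tau> < h x" | "\<tau> > h x" by linarith
        then show ?thesis
        proof cases
          case 1 then show ?thesis using key[of \<tau> "h x + d/2"] t \<open>d > 0\<close> by auto
        next
          case 2 then show ?thesis using key[of "h x - d/2" \<tau>] t \<open>d > 0\<close> by auto
        qed
      qed
      then obtain y where "y \<in> E" "h y = \<tau>" by auto
      moreover have "\<bar>h y - h x\<bar> \<le> d / 2"
        using t \<open>h y = \<tau>\<close> unfolding atLeastAtMost_iff by linarith
      ultimately show "\<tau> \<in> h ` (M \<inter> ball x r)"
        using ball[of y] unfolding E_def by blast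
    qed
  qed
qed

lemma irreducible_separator_local_chart:
  fixes M :: "complex set" and h :: "complex \<Rightarrow> real"
  assumes M: "irreducible_separator M" and x: "x \<in> M" and "0 < r"
    and cont: "continuous_on (M \<inter> cball x r) h" and inj: "inj_on h (M \<inter> cball x r)"
  obtains \<delta> k where "0 < \<delta>" "continuous_on {h x - \<delta>..h x + \<delta>} k"
    "\<And>t. t \<in> {h x - \<delta>..h x + \<delta>} \<Longrightarrow> k t \<in> M \<inter> ball x r \<and> h (k t) = t"
    "\<And>y. y \<in> M \<inter> cball x r \<Longrightarrow> h y \<in> {h x - \<delta>..h x + \<delta>} \<Longrightarrow> k (h y) = y"
proof -
  obtain \<delta> where \<delta>: "0 < \<delta>" "{h x - \<delta>..h x + \<delta>} \<subseteq> h ` (M \<inter> ball x r)"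
    "\<And>y. y \<in> M \<inter> cball x r \<Longrightarrow> \<bar>h y - h x\<bar> \<le> \<delta> \<Longrightarrow> y \<in> ball x r"
    using irreducible_separator_interval_chart[OF assms] by blast
  define E where "E = M \<inter> cball x r"
  define k where "k = inv_into E h"
  have "compact E" using M by (simp add: E_def irreducible_separator_def compact_Int_closed)
  have kh: "k (h y) = y" if "y \<in> E" for y
    using inj that unfolding k_def E_def by simp
  have hE: "{h x - \<delta>..h x + \<delta>} \<subseteq> h ` E" using \<delta>(2) by (auto simp: E_def)
  have "continuous_on (h ` E) k"
    using cont \<open>compact E\<close> kh by (intro continuous_on_inv) (auto simp: E_def)
  then have "continuous_on {h x - \<delta>..h x + \<delta>} k" using hE continuous_on_subset by blast
  moreover have "k t \<in> M \<inter> ball x r \<and> h (k t) = t" if t: "t \<in> {h x - \<delta>..h x + \<delta>}" for t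
  proof -
    obtain y where y: "y \<in> E" "h y = t" using t hE by auto
    then show ?thesis using kh[OF y(1)] \<delta>(3)[of y] t by (auto simp: E_def abs_le_iff)
  qed
  ultimately show thesis using that \<delta>(1) kh by (auto simp: E_def)
qed

lemma irreducible_separator_locally_path_connected:
  fixes M :: "complex set"
  assumes M: "irreducible_separator M" and chart: "\<And>x. x \<in> M \<Longrightarrow> line_chart_at M x"
  shows "locally path_connected M"
proof (rule locallyI)
  fix w x assume w: "openin (top_of_set M) w" "x \<in> w"
  then have "x \<in> M" by (meson in_mono openin_imp_subset)
  obtain r0 and h :: "complex \<Rightarrow> real" where r0: "r0 > 0"
     "continuous_on (M \<inter> cball x r0) h" "inj_on h (M \<inter> cball x r0)"
    using chart[OF \<open>x \<in> M\<close>] unfolding line_chart_at_def by blast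
  obtain e where e: "e > 0" "M \<inter> ball x e \<subseteq> w"
    using w by (metis Int_commute openin_contains_ball)
  define r where "r = min r0 e"
  have r: "r > 0" "cball x r \<subseteq> cball x r0" using r0 e by (auto simp: r_def)
  have cont: "continuous_on (M \<inter> cball x r) h" and inj: "inj_on h (M \<inter> cball x r)"
    using r r0(2,3) by (meson Int_mono continuous_on_subset inj_on_subset order_refl)+
  obtain \<delta> k where k: "0 < \<delta>" "continuous_on {h x - \<delta>..h x + \<delta>} k"
    "\<And>t. t \<in> {h x - \<delta>..h x + \<delta>} \<Longrightarrow> k t \<in> M \<inter> ball x r \<and> h (k t) = t"
    "\<And>y. y \<in> M \<inter> cball x r \<Longrightarrow> h y \<in> {h x - \<delta>..h x + \<delta>} \<Longrightarrow> k (h y) = y"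
    using irreducible_separator_local_chart[OF M \<open>x \<in> M\<close> r(1) cont inj] by metis
  define u where "u = k ` {h x - \<delta><..<h x + \<delta>}"
  have u_eq: "u = (M \<inter> ball x r) \<inter> h -` {h x - \<delta><..<h x + \<delta>}"
  proof
    show "u \<subseteq> (M \<inter> ball x r) \<inter> h -` {h x - \<delta><..<h x + \<delta>}"
      unfolding u_def using k(3) by fastforce
    show "(M \<inter> ball x r) \<inter> h -` {h x - \<delta><..<h x + \<delta>} \<subseteq> u"
    proof
      fix y assume y: "y \<in> (M \<inter> ball x r) \<inter> h -` {h x - \<delta><..<h x + \<delta>}"
      then have "k (h y) = y" using k(4) by auto
      then show "y \<in> u" unfolding u_def using y by (metis IntD2 imageI vimage_eq)
    qed
  qed
  have "openin (top_of_set (M \<inter> ball x r)) u"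
    unfolding u_eq using cont
    by (intro continuous_openin_preimage_gen) (auto intro: continuous_on_subset)
  then have "openin (top_of_set M) u"
    by (meson open_ball openin_open_Int openin_trans)
  moreover have "path_connected u"
    unfolding u_def using k(2)
    by (intro path_connected_continuous_image convex_imp_path_connected) (auto intro: continuous_on_subset)
  moreover have "x \<in> u" using \<open>x \<in> M\<close> r k(1) by (auto simp: u_eq)
  moreover have "u \<subseteq> w" using e by (auto simp: u_eq r_def)
  ultimately show "\<exists>u v. openin (top_of_set M) u \<and> path_connected v \<and> x \<in> u \<and> u \<subseteq> v \<and> v \<subseteq> w"
    by blast
qed

text \<open>A chart gives an arc \<open>p\<close> of \<open>M\<close> through \<open>x\<close>. The
  rest \<open>B\<close> of \<open>M\<close> is still path connected, because \<open>M - {x}\<close>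
  retracts onto it, so the ends of \<open>p\<close> are also joined by an arc in \<open>B\<close>.
  The resulting simple closed curve separates the plane and exhausts \<open>M\<close> by
  minimality.\<close>

theorem irreducible_separator_simple_closed_curve:
  fixes M :: "complex set"
  assumes M: "irreducible_separator M" and chart: "\<And>x. x \<in> M \<Longrightarrow> line_chart_at M x"
  obtains g where "simple_path g" "pathfinish g = pathstart g" "path_image g = M"
proof -
  have "closed M" using M by (simp add: irreducible_separator_def compact_imp_closed)
  have "M \<noteq> {}" using M by (auto simp: irreducible_separator_def)
  then obtain x where x: "x \<in> M" by blast
  obtain r and h :: "complex \<Rightarrow> real" where r: "r > 0"
     and cont: "continuous_on (M \<inter> cball x r) h" and inj: "inj_on h (M \<inter> cball x r)"
    using chart[OF x] unfolding line_chart_at_def by blast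
  obtain \<delta> k where k: "0 < \<delta>" "continuous_on {h x - \<delta>..h x + \<delta>} k"
    and kM: "\<And>t. t \<in> {h x - \<delta>..h x + \<delta>} \<Longrightarrow> k t \<in> M \<inter> ball x r \<and> h (k t) = t"
    and kh: "\<And>y. y \<in> M \<inter> cball x r \<Longrightarrow> h y \<in> {h x - \<delta>..h x + \<delta>} \<Longrightarrow> k (h y) = y"
    using irreducible_separator_local_chart[OF M x r(1) cont inj] by metis
  define u v where "u = k (h x - \<delta>)" and "v = k (h x + \<delta>)"
  have kx: "k (h x) = x" using kh x r k(1) by auto
  have uv: "u \<in> M \<inter> ball x r" "v \<in> M \<inter> ball x r" "h u = h x - \<delta>" "h v = h x + \<delta>"
    using kM[of "h x - \<delta>"] kM[of "h x + \<delta>"] k(1) by (auto simp: u_def v_def)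
  define O' where "O' = (M \<inter> ball x r) \<inter> h -` {h x - \<delta><..<h x + \<delta>}"
  define L R where "L = k ` {h x - \<delta>..<h x}" and "R = k ` {h x<..h x + \<delta>}"
  define B where "B = M - O'"
  have conn: "connected (M - {x})"
    by (rule irreducible_separator_connected_punctured[OF M])
  have "openin (top_of_set M) (M - {x})"
    using openin_open_Int[of "- {x}" M] by (simp add: Diff_eq open_Compl)
  then have "locally path_connected (M - {x})"
    using irreducible_separator_locally_path_connected[OF assms] locally_open_subset by blast
  then have pc: "path_connected (M - {x})"
    using conn path_component_eq_connected_component
    by (metis connected_iff_connected_component path_connected_component)
  \<comment> \<open>Each half of the punctured arc is collapsed to its end away from
    \<open>x\<close>.\<close>
  define \<rho> where "\<rho> y = (if y \<in> L then u else if y \<in> R then v else y)" for y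
  have memLR: "y \<in> L \<longleftrightarrow> y \<in> M \<inter> ball x r \<and> h y \<in> {h x - \<delta>..<h x}"
     "y \<in> R \<longleftrightarrow> y \<in> M \<inter> ball x r \<and> h y \<in> {h x<..h x + \<delta>}" for y
  proof -
    have "y \<in> L" if "y \<in> M \<inter> ball x r" "h y \<in> {h x - \<delta>..<h x}"
      using kh[of y] that k(1) unfolding L_def by (intro image_eqI[of _ _ "h y"]) auto
    moreover have "y \<in> R" if "y \<in> M \<inter> ball x r" "h y \<in> {h x<..h x + \<delta>}"
      using kh[of y] that k(1) unfolding R_def by (intro image_eqI[of _ _ "h y"]) auto
    ultimately show "y \<in> L \<longleftrightarrow> y \<in> M \<inter> ball x r \<and> h y \<in> {h x - \<delta>..<h x}"
     "y \<in> R \<longleftrightarrow> y \<in> M \<inter> ball x r \<and> h y \<in> {h x<..h x + \<delta>}"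
      unfolding L_def R_def using kM k(1) by auto
  qed
  have "openin (top_of_set (M \<inter> ball x r)) O'"
    unfolding O'_def using cont
    by (intro continuous_openin_preimage_gen) (auto intro: continuous_on_subset)
  then have "openin (top_of_set M) O'"
    by (meson open_ball openin_open_Int openin_trans)
  then have "closed B"
    unfolding B_def using \<open>closed M\<close> closedin_closed_trans closedin_diff closedin_self by blast
  have closedLR: "closed (L \<union> {x})" "closed (R \<union> {x})"
  proof -
    have "{h x - \<delta>..h x} = insert (h x) {h x - \<delta>..<h x}"
      "{h x..h x + \<delta>} = insert (h x) {h x<..h x + \<delta>}" using k(1) by auto
    then have "L \<union> {x} = k ` {h x - \<delta>..h x}" "R \<union> {x} = k ` {h x..h x + \<delta>}"
      unfolding L_def R_def using kx by simp_all
    moreover have "compact (k ` {h x - \<delta>..h x})" "compact (k ` {h x..h x + \<delta>})"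
      using k(1,2) by (auto intro!: compact_continuous_image intro: continuous_on_subset)
    ultimately show "closed (L \<union> {x})" "closed (R \<union> {x})" by (auto intro: compact_imp_closed)
  qed
  have Mx: "M - {x} = L \<union> (R \<union> B)"
  proof -
    have "y \<in> L \<or> y \<in> R \<or> y \<in> B" if "y \<in> M" "y \<noteq> x" for y
    proof (rule ccontr)
      assume "\<not> ?thesis"
      then have "h y = h x" "y \<in> M \<inter> cball x r" using that by (auto simp: memLR B_def O'_def)
      then show False using kh[of y] kx k(1) that by auto
    qed
    moreover have "x \<in> O'" using x r k(1) by (auto simp: O'_def)
    ultimately have "M - {x} \<subseteq> L \<union> (R \<union> B)" "x \<notin> B" "B \<subseteq> M" by (auto simp: B_def)
    moreover have "L \<subseteq> M - {x}" "R \<subseteq> M - {x}" by (auto simp: memLR)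
    ultimately show ?thesis by blast
  qed
  \<comment> \<open>Adding \<open>x\<close> closes both half arcs, so they are closed relative to
    the sets without \<open>x\<close>, as pasting requires.\<close>
  have cl: "closedin (top_of_set (L \<union> (R \<union> B))) L" "closedin (top_of_set (L \<union> (R \<union> B))) (R \<union> B)"
      "closedin (top_of_set (R \<union> B)) R" "closedin (top_of_set (R \<union> B)) B"
  proof -
    have xn: "x \<notin> L \<union> (R \<union> B)" using Mx by blast
    have "L = (L \<union> {x}) \<inter> (L \<union> (R \<union> B))" "R \<union> B = ((R \<union> {x}) \<union> B) \<inter> (L \<union> (R \<union> B))"
       "R = (R \<union> {x}) \<inter> (R \<union> B)" "B = B \<inter> (R \<union> B)" using xn Mx memLR by auto
    then show "closedin (top_of_set (L \<union> (R \<union> B))) L" "closedin (top_of_set (L \<union> (R \<union> B))) (R \<union> B)"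
      "closedin (top_of_set (R \<union> B)) R" "closedin (top_of_set (R \<union> B)) B"
      using closedLR \<open>closed B\<close> closedin_closed closed_Un by (metis Int_commute)+
  qed
  have LB: "y = u" if "y \<in> L" "y \<in> B" for y
  proof -
    have "h y = h x - \<delta>" "y \<in> M \<inter> cball x r"
      using that by (auto simp: memLR B_def O'_def)
    then show ?thesis using kh[of y] k(1) by (simp add: u_def)
  qed
  have RB: "y = v" if "y \<in> R" "y \<in> B" for y
  proof -
    have "h y = h x + \<delta>" "y \<in> M \<inter> cball x r"
      using that by (auto simp: memLR B_def O'_def)
    then show ?thesis using kh[of y] k(1) by (simp add: v_def)
  qed
  have "continuous_on (R \<union> B) (\<lambda>y. if y \<in> R then v else y)"
    using RB by (intro continuous_on_cases_local cl continuous_intros) auto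
  moreover have "u = (if y \<in> R then v else y)" if "y \<in> L \<and> y \<notin> L \<or> y \<in> R \<union> B \<and> y \<in> L" for y
  proof -
    have "y \<in> L" "y \<in> B" "y \<notin> R" using that memLR[of y] by auto
    then show ?thesis using LB by auto
  qed
  ultimately have "continuous_on (L \<union> (R \<union> B)) \<rho>"
    unfolding \<rho>_def by (rule continuous_on_cases_local[OF cl(1) cl(2) continuous_on_const])
  then have "path_connected (\<rho> ` (M - {x}))"
    using pc Mx path_connected_continuous_image by metis
  moreover have uvB: "u \<in> B" "v \<in> B" using uv by (auto simp: B_def O'_def)
  have "\<rho> ` (M - {x}) = B"
  proof
    show "\<rho> ` (M - {x}) \<subseteq> B" using uvB Mx by (auto simp: \<rho>_def)
    have "\<rho> y = y" if "y \<in> B" for y using that LB RB by (auto simp: \<rho>_def)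
    then show "B \<subseteq> \<rho> ` (M - {x})" using Mx by (metis UnCI image_eqI subsetI)
  qed
  ultimately have "path_connected B" by simp
  moreover have "u \<noteq> v" using uv k(1) by auto
  ultimately obtain q where q: "arc q" "path_image q \<subseteq> B" "pathstart q = u" "pathfinish q = v"
    using uvB path_connected_arcwise by metis
  define p where "p = k \<circ> linepath (h x + \<delta>) (h x - \<delta>)"
  have img: "path_image (linepath (h x + \<delta>) (h x - \<delta>)) = {h x - \<delta>..h x + \<delta>}"
    using k(1) by (simp add: closed_segment_eq_real_ivl)
  have "inj_on k {h x - \<delta>..h x + \<delta>}" using kM by (metis inj_onI)
  then have "inj_on p {0..1}"
    unfolding p_def using arc_linepath[of "h x + \<delta>" "h x - \<delta>"] img k(1)
    by (intro comp_inj_on) (auto simp: arc_def path_image_def)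
  moreover have "path p"
    unfolding p_def using k(2) img by (intro path_continuous_image) auto
  ultimately have "arc p" by (simp add: arc_def)
  have pim: "path_image p = k ` {h x - \<delta>..h x + \<delta>}"
    using img by (simp add: p_def path_image_compose)
  have ends: "pathstart p = v" "pathfinish p = u"
    by (simp_all add: p_def u_def v_def pathstart_compose pathfinish_compose)
  have pq: "path_image p \<inter> path_image q \<subseteq> {pathstart p, pathstart q}"
  proof
    fix y assume y: "y \<in> path_image p \<inter> path_image q"
    then have "y \<in> B" using q by auto
    obtain t where t: "t \<in> {h x - \<delta>..h x + \<delta>}" "y = k t" using y pim by auto
    then have "h y = t" "y \<in> M \<inter> ball x r" using kM by auto
    then have "t = h x - \<delta> \<or> t = h x + \<delta>" using \<open>y \<in> B\<close> t by (auto simp: B_def O'_def)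
    then show "y \<in> {pathstart p, pathstart q}" using t ends q by (auto simp: u_def v_def)
  qed
  have sp: "simple_path (p +++ q)"
    using simple_path_join_loop[OF \<open>arc p\<close> q(1) _ _ pq] ends q by simp
  have loop: "pathfinish (p +++ q) = pathstart (p +++ q)" using ends q by simp
  have sub: "path_image (p +++ q) \<subseteq> M"
    using pim kM q(2) by (auto simp: path_image_join ends q B_def)
  have "path_image (p +++ q) = M"
  proof (rule ccontr)
    assume "path_image (p +++ q) \<noteq> M"
    then have "connected (- path_image (p +++ q))"
      using M sub sp by (simp add: irreducible_separator_def closed_simple_path_image psubset_eq)
    moreover have "inside (path_image (p +++ q)) \<union> outside (path_image (p +++ q)) = - path_image (p +++ q)"
      "open (inside (path_image (p +++ q)))" "open (outside (path_image (p +++ q)))"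
      "inside (path_image (p +++ q)) \<noteq> {}" "outside (path_image (p +++ q)) \<noteq> {}"
      "inside (path_image (p +++ q)) \<inter> outside (path_image (p +++ q)) = {}"
      using Jordan_inside_outside[OF sp loop] by auto
    ultimately show False
      by (metis connectedD inf.idem inf_bot_left inf_commute inf_sup_absorb le_iff_inf sup_commute)
  qed
  then show thesis using that sp loop by blast
qed

text \<open>The values of the chart on \<open>M\<close> already fill an interval around
  \<open>h x\<close>, so injectivity on \<open>K\<close> leaves no value for a nearby point of
  \<open>K - M\<close>.\<close>

lemma irreducible_separator_openin:
  fixes M :: "complex set" and h :: "complex \<Rightarrow> real"
  assumes M: "irreducible_separator M" and "M \<subseteq> K" and chart: "\<And>x. x \<in> M \<Longrightarrow> line_chart_at K x"
  shows "openin (top_of_set K) M"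
  unfolding openin_contains_ball
proof (intro conjI ballI assms)
  fix x assume x: "x \<in> M"
  obtain r and h :: "complex \<Rightarrow> real" where r: "r > 0"
     and cont: "continuous_on (K \<inter> cball x r) h" and inj: "inj_on h (K \<inter> cball x r)"
    using chart[OF x] unfolding line_chart_at_def by blast
  have contM: "continuous_on (M \<inter> cball x r) h" "inj_on h (M \<inter> cball x r)"
    using cont inj \<open>M \<subseteq> K\<close> by (meson Int_mono continuous_on_subset inj_on_subset order_refl)+
  obtain \<delta> where \<delta>: "0 < \<delta>" "{h x - \<delta>..h x + \<delta>} \<subseteq> h ` (M \<inter> ball x r)"
    using irreducible_separator_interval_chart[OF M x r contM] by metis
  have "x \<in> K \<inter> cball x r" using x r \<open>M \<subseteq> K\<close> by auto
  then obtain e where e: "e > 0" "\<And>y. y \<in> K \<inter> cball x r \<Longrightarrow> dist y x < e \<Longrightarrow> dist (h y) (h x) < \<delta>"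
    using cont \<delta>(1) unfolding continuous_on_iff by metis
  have "y \<in> M" if "y \<in> ball x (min e r) \<inter> K" for y
  proof -
    have "dist (h y) (h x) < \<delta>" using e(2)[of y] that by (auto simp: dist_commute)
    then have "h y \<in> h ` (M \<inter> ball x r)" using \<delta>(2) by (auto simp: dist_real_def abs_less_iff subset_iff)
    then obtain z where z: "z \<in> M \<inter> ball x r" "h y = h z" by auto
    then have "y = z" using inj that \<open>M \<subseteq> K\<close> by (auto simp: inj_on_def)
    then show ?thesis using z by simp
  qed
  then show "\<exists>e>0. ball x e \<inter> K \<subseteq> M"
    using e(1) r by (intro exI[of _ "min e r"]) auto
qed

subsection \<open>Connectedness of the complement of a neighbourhood\<close>

text \<open>The difference of two lifts takes values in the discrete set of multiples of 2 pi, hence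
  is constant on a connected set.\<close>

lemma cis_lift_unique:
  fixes f g :: "'a::topological_space \<Rightarrow> real"
  assumes "connected C" "continuous_on C f" "continuous_on C g"
    and "\<And>x. x \<in> C \<Longrightarrow> cis (f x) = cis (g x)" "p \<in> C" "f p = g p" "x \<in> C"
  shows "f x = g x"
proof -
  define h where "h x = f x - g x" for x
  have int: "\<exists>n::int. h x = of_int n * 2 * pi" if "x \<in> C" for x
  proof -
    have "cis (h x) = cis (f x) / cis (g x)" by (simp add: h_def cis_divide)
    then have "cis (h x) = 1" using assms(4)[OF that] by simp
    then have "cos (h x) = 1" by (metis cis.sel(1) one_complex.sel(1))
    then show ?thesis by (simp add: cos_one_2pi_int)
  qed
  have "h constant_on C"
  proof (rule continuous_discrete_range_constant[OF assms(1)])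
    show "continuous_on C h" unfolding h_def using assms by (intro continuous_intros)
    fix x assume "x \<in> C"
    then obtain n :: int where n: "h x = of_int n * 2 * pi" using int by blast
    have "2 * pi \<le> norm (h y - h x)" if y: "y \<in> C" "h y \<noteq> h x" for y
    proof -
      obtain m :: int where m: "h y = of_int m * 2 * pi" using int y by blast
      have "m \<noteq> n" using y m n by auto
      have "h y - h x = of_int (m - n) * (2 * pi)"
        unfolding m n by (simp add: algebra_simps)
      then have "norm (h y - h x) = \<bar>of_int (m - n)\<bar> * (2 * pi)"
        by (simp add: abs_mult)
      moreover have "1 \<le> \<bar>real_of_int (m - n)\<bar>" using \<open>m \<noteq> n\<close> by linarith
      ultimately show ?thesis by simp
    qed
    then show "\<exists>e>0. \<forall>y. y \<in> C \<and> h y \<noteq> h x \<longrightarrow> e \<le> norm (h y - h x)"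
      by (intro exI[of _ "2 * pi"]) auto
  qed
  then have "h x = h p" using assms unfolding constant_on_def by metis
  then show ?thesis using assms by (simp add: h_def)
qed

text \<open>Borsuk's criterion: \<open>a\<close> and \<open>b\<close> lie in the same component iff
  the directions seen from them are homotopic as circle maps, that is, iff their quotient has a
  continuous logarithm.\<close>

lemma connected_component_Compl_iff_cis_lift:
  fixes S :: "complex set"
  assumes "compact S" "a \<notin> S" "b \<notin> S"
  shows "connected_component (- S) a b \<longleftrightarrow>
     (\<exists>g. continuous_on S g \<and> (\<forall>x\<in>S. cis (g x) = sgn (x - a) / sgn (x - b)))"
proof -
  have sgn: "(x - c) /\<^sub>R cmod (x - c) = sgn (x - c)" for x c :: complex
    by (simp add: sgn_div_norm)
  have "continuous_on S (\<lambda>x. sgn (x - c))" "(\<lambda>x. sgn (x - c)) \<in> S \<rightarrow> sphere 0 1"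
    if "c \<notin> S" for c
    using that by (auto intro!: continuous_intros simp: norm_sgn)
  then have cont: "continuous_on S (\<lambda>x. sgn (x - a))" "(\<lambda>x. sgn (x - a)) \<in> S \<rightarrow> sphere 0 1"
    "continuous_on S (\<lambda>x. sgn (x - b))" "(\<lambda>x. sgn (x - b)) \<in> S \<rightarrow> sphere 0 1"
    using assms by blast+
  have "2 \<le> DIM(complex)" by simp
  then have B: "connected_component (- S) a b \<longleftrightarrow>
    homotopic_with_canon (\<lambda>x. True) S (sphere 0 1) (\<lambda>x. sgn (x - a)) (\<lambda>x. sgn (x - b))"
    using Borsuk_maps_homotopic_in_connected_component_eq[OF assms] unfolding sgn by blast
  have "connected_component (- S) a b \<longleftrightarrow>
     (\<exists>g. continuous_on S g \<and> (\<forall>x\<in>S. sgn (x - a) / sgn (x - b) = cis (g x)))"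
    unfolding B homotopic_circlemaps_divide[of S "\<lambda>x. sgn (x - a)" "\<lambda>x. sgn (x - b)"]
      inessential_eq_continuous_logarithm_circle cis_conv_exp
    using cont by blast
  then show ?thesis by (simp only: eq_commute[of "cis _"])
qed

text \<open>The change of \<open>arg ((x - a) / (x - b))\<close> along the segment from
  \<open>c\<close> to \<open>x\<close>. The principal logarithm computes it when \<open>x\<close> is
  nearer to \<open>c\<close> than \<open>a\<close> and \<open>b\<close> are, since both quotients
  then stay in the right half plane.\<close>

definition angle_shift :: "complex \<Rightarrow> complex \<Rightarrow> complex \<Rightarrow> complex \<Rightarrow> real" where
  "angle_shift a b c x = Im (Ln ((x - a) / (c - a))) - Im (Ln ((x - b) / (c - b)))"

lemma quotient_notin_nonpos_Reals:
  fixes x c a :: complex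
  assumes "dist x c < dist c a"
  shows "(x - a) / (c - a) \<notin> \<real>\<^sub>\<le>\<^sub>0"
proof -
  have ne: "c \<noteq> a" using assms zero_le_dist[of x c] by auto
  have "(x - a) / (c - a) = 1 + (x - c) / (c - a)"
    using ne by (simp add: field_simps)
  moreover have "norm ((x - c) / (c - a)) < 1"
    using assms ne by (simp add: norm_divide dist_norm)
  then have "\<bar>Re ((x - c) / (c - a))\<bar> < 1"
    using abs_Re_le_cmod[of "(x - c) / (c - a)"] by linarith
  ultimately have "0 < Re ((x - a) / (c - a))"
    by (simp add: abs_less_iff)
  then show ?thesis by (auto simp: complex_nonpos_Reals_iff)
qed

lemma continuous_on_angle_shift:
  assumes "continuous_on X f" "continuous_on X g"
    and "\<And>u. u \<in> X \<Longrightarrow> dist (g u) (f u) < dist (f u) a \<and> dist (g u) (f u) < dist (f u) b"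
  shows "continuous_on X (\<lambda>u. angle_shift a b (f u) (g u))"
proof -
  have "f u \<noteq> a" "f u \<noteq> b" if "u \<in> X" for u
    using assms(3)[OF that] zero_le_dist[of "g u" "f u"] by auto
  then show ?thesis
    unfolding angle_shift_def using assms quotient_notin_nonpos_Reals
    by (intro continuous_intros) auto
qed

lemma cis_angle_shift:
  assumes "dist x c < dist c a" "dist x c < dist c b"
    and "cis t = sgn (c - a) / sgn (c - b)"
  shows "cis (t + angle_shift a b c x) = sgn (x - a) / sgn (x - b)"
proof -
  have ne: "c \<noteq> a" "c \<noteq> b" "x \<noteq> a" "x \<noteq> b"
    using assms zero_le_dist[of x c] by (auto simp: dist_commute)
  have *: "cis (Im (Ln w)) = sgn w" if "w \<noteq> 0" for w
    using that by (metis Arg_eq_Im_Ln cis_Arg)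
  have "cis (t + angle_shift a b c x) =
      cis t * (sgn ((x - a) / (c - a)) / sgn ((x - b) / (c - b)))"
    unfolding angle_shift_def cis_mult[symmetric] cis_divide[symmetric] using ne by (simp add: *)
  also have "\<dots> = sgn (x - a) / sgn (x - b)"
    unfolding assms(3) using ne by (simp add: sgn_divide sgn_zero_iff field_simps)
  finally show ?thesis .
qed

theorem connected_component_offset:
  fixes \<Gamma> :: "complex set"
  assumes "compact \<Gamma>" "0 \<le> s" and conn: "connected_component (- \<Gamma>) a b"
    and far: "\<And>c. c \<in> \<Gamma> \<Longrightarrow> s < dist c a \<and> s < dist c b"
    and chord: "\<And>c c'. c \<in> \<Gamma> \<Longrightarrow> c' \<in> \<Gamma> \<Longrightarrow> c \<noteq> c' \<Longrightarrow> dist c c' \<le> 2 * s \<Longrightarrow>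
       \<exists>B. compact B \<and> connected B \<and> B \<subseteq> \<Gamma> \<and> c \<in> B \<and> c' \<in> B \<and>
         connected_component (- (B \<union> closed_segment c c')) a b"
  shows "connected_component (- {x. \<exists>c\<in>\<Gamma>. dist x c \<le> s}) a b"
proof -
  have "a \<notin> \<Gamma>" "b \<notin> \<Gamma>" using conn connected_component_in by fastforce+
  then obtain \<theta> where \<theta>: "continuous_on \<Gamma> \<theta>" "\<And>c. c \<in> \<Gamma> \<Longrightarrow> cis (\<theta> c) = sgn (c - a) / sgn (c - b)"
    using connected_component_Compl_iff_cis_lift[OF \<open>compact \<Gamma>\<close>] conn by metis
  define F where "F = (\<lambda>(x, c). \<theta> c + angle_shift a b c x)"
  have cisF: "cis (F (x, c)) = sgn (x - a) / sgn (x - b)" if "c \<in> \<Gamma>" "dist x c \<le> s" for x c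
    unfolding F_def prod.case using far[OF that(1)] that(2) \<theta>(2)[OF that(1)] by (intro cis_angle_shift) linarith+
  have Fc: "F (c, c) = \<theta> c" if "c \<in> \<Gamma>" for c
    using that \<open>a \<notin> \<Gamma>\<close> \<open>b \<notin> \<Gamma>\<close> by (auto simp: F_def angle_shift_def)
  have contF: "continuous_on (cball c s) (\<lambda>x. F (x, c))" if "c \<in> \<Gamma>" for c
    unfolding F_def prod.case using far[OF that]
    by (intro continuous_intros continuous_on_angle_shift) (auto simp: dist_commute[of _ c])
  \<comment> \<open>Both values continue the angle along paths that close up through
    \<open>B\<close> and the chord. A lift on \<open>B \<union> closed_segment c c'\<close> shows
    that nothing is gained on the way round.\<close>
  have well: "F (x, c) = F (x, c')" if c: "c \<in> \<Gamma>" "c' \<in> \<Gamma>" "dist x c \<le> s" "dist x c' \<le> s" for x c c'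
  proof (cases "c = c'")
    case False
    have "dist c c' \<le> 2 * s" using c dist_triangle[of c c' x] by (simp add: dist_commute)
    then obtain B where B: "compact B" "connected B" "B \<subseteq> \<Gamma>" "c \<in> B" "c' \<in> B"
       "connected_component (- (B \<union> closed_segment c c')) a b"
      using chord c False by metis
    have "a \<notin> B \<union> closed_segment c c'" "b \<notin> B \<union> closed_segment c c'"
      using B(6) connected_component_in by fastforce+
    then obtain \<phi> where \<phi>: "continuous_on (B \<union> closed_segment c c') \<phi>"
        "\<And>x. x \<in> B \<union> closed_segment c c' \<Longrightarrow> cis (\<phi> x) = sgn (x - a) / sgn (x - b)"
      using connected_component_Compl_iff_cis_lift[of "B \<union> closed_segment c c'" a b] B by (auto simp: compact_Un)
    \<comment> \<open>The added constant is a multiple of 2 pi, so \<open>\<psi>\<close> is again a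
      lift. It agrees with \<open>\<theta>\<close> at \<open>c\<close>, hence on all of
      \<open>B\<close>.\<close>
    define \<psi> where "\<psi> x = \<phi> x + (\<theta> c - \<phi> c)" for x
    have \<psi>: "continuous_on (B \<union> closed_segment c c') \<psi>" "\<psi> c = \<theta> c"
      unfolding \<psi>_def using \<phi> by (auto intro!: continuous_intros)
    have cis\<psi>: "cis (\<psi> x) = sgn (x - a) / sgn (x - b)" if "x \<in> B \<union> closed_segment c c'" for x
    proof -
      have "cis (\<theta> c - \<phi> c) = 1"
        unfolding cis_divide[symmetric] using \<phi>(2)[of c] \<theta>(2)[of c] B c \<open>a \<notin> \<Gamma>\<close> \<open>b \<notin> \<Gamma>\<close> by (auto simp: sgn_zero_iff)
      then show ?thesis unfolding \<psi>_def cis_mult[symmetric] using \<phi>(2)[OF that] by simp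
    qed
    have "\<psi> c' = \<theta> c'"
      using \<psi> cis\<psi> \<theta> B
      by (intro cis_lift_unique[of B \<psi> \<theta> c c']) (auto intro: continuous_on_subset)
    \<comment> \<open>The midpoint belongs to both discs of radius \<open>s\<close>. Continuation
      along the two half chords identifies \<open>F (m, c)\<close> and \<open>F (m, c')\<close> with
      \<open>\<psi> m\<close>; the segment from \<open>m\<close> to \<open>x\<close> stays in both
      discs and transfers the equality to \<open>x\<close>.\<close>
    define m where "m = midpoint c c'"
    have m: "dist m c \<le> s" "dist m c' \<le> s" "m \<in> closed_segment c c'"
      using \<open>dist c c' \<le> 2 * s\<close> by (auto simp: m_def dist_midpoint midpoint_in_closed_segment)
    have step: "\<psi> m = F (m, d)" if "d \<in> {c, c'}" "\<psi> d = \<theta> d" for d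
    proof (rule cis_lift_unique[of "closed_segment d m" \<psi> "\<lambda>x. F (x, d)" d m])
      have d: "d \<in> \<Gamma>" "dist m d \<le> s" "closed_segment d m \<subseteq> closed_segment c c'"
        using that c m by (auto simp: subset_closed_segment closed_segment_commute)
      have "closed_segment d m \<subseteq> cball d s"
        using d \<open>0 \<le> s\<close> by (intro closed_segment_subset) (auto simp: dist_commute)
      then show "continuous_on (closed_segment d m) (\<lambda>x. F (x, d))"
        "\<And>x. x \<in> closed_segment d m \<Longrightarrow> cis (\<psi> x) = cis (F (x, d))"
        using contF[OF d(1)] cis\<psi> cisF[OF d(1)] d(3)
        by (auto intro: continuous_on_subset simp: dist_commute subset_iff)
      show "continuous_on (closed_segment d m) \<psi>"
        using \<psi>(1) d(3) continuous_on_subset by blast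
      show "\<psi> d = F (d, d)" using that Fc d by simp
    qed auto
    have eqm: "F (m, c) = F (m, c')"
      using step[of c] step[of c'] \<psi> \<open>\<psi> c' = \<theta> c'\<close> by simp
    have sub: "closed_segment m x \<subseteq> cball c s" "closed_segment m x \<subseteq> cball c' s"
      using c m by (intro closed_segment_subset convex_cball; simp add: dist_commute)+
    show ?thesis
    proof (rule cis_lift_unique[of "closed_segment m x" "\<lambda>x. F (x, c)" "\<lambda>x. F (x, c')" m x])
      show "continuous_on (closed_segment m x) (\<lambda>x. F (x, c))" "continuous_on (closed_segment m x) (\<lambda>x. F (x, c'))"
        using contF c sub continuous_on_subset by blast+
      show "cis (F (u, c)) = cis (F (u, c'))" if "u \<in> closed_segment m x" for u
      proof -
        have "dist u c \<le> s" "dist u c' \<le> s"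
          using sub that by (auto simp: dist_commute[of u] subset_iff)
        then show ?thesis using cisF c by simp
      qed
    qed (use eqm in auto)
  qed simp
  define T where "T = {x. \<exists>c\<in>\<Gamma>. dist x c \<le> s}"
  \<comment> \<open>The admissible pairs \<open>(x, c)\<close> form a compact set with projection
    \<open>T\<close>. By \<open>well\<close>, \<open>F\<close> depends only on the projection, and
    compactness makes the induced function continuous: preimages of closed sets are projections of
    compact sets.\<close>
  define N where "N = (\<lambda>(c, v). (c + v, c)) ` (\<Gamma> \<times> cball 0 s)"
  have N_iff: "(x, c) \<in> N \<longleftrightarrow> c \<in> \<Gamma> \<and> dist x c \<le> s" for x c
    unfolding N_def by (auto simp: dist_norm norm_minus_commute image_iff intro!: bexI[of _ "x - c"])
  have "compact N" unfolding N_def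
    using \<open>compact \<Gamma>\<close> by (auto intro!: compact_continuous_image compact_Times continuous_intros simp: case_prod_unfold)
  have T: "T = fst ` N"
  proof (intro equalityI subsetI)
    fix x assume "x \<in> T"
    then obtain c where "(x, c) \<in> N" by (auto simp: T_def N_iff)
    then show "x \<in> fst ` N" by (metis fst_conv imageI)
  qed (auto simp: T_def N_iff)
  then have "compact T" using \<open>compact N\<close> by (auto intro!: compact_continuous_image continuous_intros)
  have contFN: "continuous_on N F"
  proof -
    have "continuous_on N (\<lambda>p. \<theta> (snd p))"
      by (rule continuous_on_compose2[OF \<theta>(1)]) (auto intro!: continuous_intros simp: N_iff)
    moreover have "continuous_on N (\<lambda>p. angle_shift a b (snd p) (fst p))"
      using far by (intro continuous_on_angle_shift continuous_intros) (fastforce simp: N_iff)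
    ultimately show ?thesis
      unfolding F_def case_prod_unfold by (rule continuous_on_add)
  qed
  define \<Theta> where "\<Theta> x = F (x, SOME c. (x, c) \<in> N)" for x
  have \<Theta>: "\<Theta> x = F (x, c)" if "(x, c) \<in> N" for x c
  proof -
    have "(x, SOME c. (x, c) \<in> N) \<in> N" using that by (rule someI)
    then show ?thesis using well that unfolding \<Theta>_def N_iff by blast
  qed
  have "continuous_on T \<Theta>"
    unfolding continuous_on_closed_vimage[OF compact_imp_closed[OF \<open>compact T\<close>]]
  proof (intro allI impI)
    fix C :: "real set" assume "closed C"
    then have "compact (N \<inter> F -` C)"
      using contFN \<open>compact N\<close>
      by (metis compact_Int_closed compact_imp_closed continuous_closed_preimage inf.idem inf_assoc)
    then have "closed (fst ` (N \<inter> F -` C))"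
      by (auto intro!: compact_imp_closed compact_continuous_image continuous_intros)
    moreover have "\<Theta> -` C \<inter> T = fst ` (N \<inter> F -` C)"
      unfolding T using \<Theta> by (auto simp: image_iff) (metis, metis prod.collapse)?
    ultimately show "closed (\<Theta> -` C \<inter> T)" by simp
  qed
  moreover have "cis (\<Theta> x) = sgn (x - a) / sgn (x - b)" if "x \<in> T" for x
  proof -
    obtain c where "c \<in> \<Gamma>" "dist x c \<le> s" using \<open>x \<in> T\<close> by (auto simp: T_def)
    then show ?thesis using \<Theta>[of x c] cisF[of c x] by (simp add: N_iff)
  qed
  moreover have "a \<notin> T" "b \<notin> T" using far by (force simp: T_def dist_commute[of a] dist_commute[of b])+
  ultimately show ?thesis
    using connected_component_Compl_iff_cis_lift[OF \<open>compact T\<close>] unfolding T_def by blast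
qed

subsection \<open>Points near an arc over a chord\<close>

lemma dist_add_closed_segment:
  fixes x c w :: complex
  shows "w \<in> closed_segment x c \<Longrightarrow> dist x c = dist x w + dist w c"
  by (simp add: between between_mem_segment[symmetric])

lemma ray_imp_outside:
  fixes z n :: complex
  assumes "n \<noteq> 0" and "\<And>t. 0 \<le> t \<Longrightarrow> z + complex_of_real t * n \<notin> T"
  shows "z \<in> outside T"
proof -
  define R where "R = (\<lambda>t. z + complex_of_real t * n) ` {0..}"
  have "connected R" unfolding R_def
    by (intro connected_continuous_image continuous_intros convex_connected) auto
  moreover have "z \<in> R" unfolding R_def by (rule image_eqI[of _ _ 0]) auto
  moreover have "R \<subseteq> - T" using assms(2) by (auto simp: R_def)
  ultimately have "R \<subseteq> connected_component_set (- T) z"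
    by (simp add: connected_component_maximal)
  moreover have "\<not> bounded R"
  proof
    assume "bounded R"
    then obtain M where M: "\<And>p. p \<in> R \<Longrightarrow> norm p \<le> M" by (auto simp: bounded_iff)
    define t where "t = (\<bar>M\<bar> + norm z + 1) / norm n"
    have "t \<ge> 0" by (simp add: t_def)
    then have "norm (z + complex_of_real t * n) \<le> M" by (intro M) (auto simp: R_def)
    moreover have "norm (complex_of_real t * n) = \<bar>M\<bar> + norm z + 1"
    proof -
      have "norm (complex_of_real t * n) = t * norm n" using \<open>t \<ge> 0\<close> by (simp add: norm_mult)
      then show ?thesis using assms(1) by (simp add: t_def)
    qed
    ultimately show False using norm_triangle_ineq4[of "z + complex_of_real t * n" z] by (auto simp: abs_if split: if_splits)
  qed
  ultimately show ?thesis unfolding outside using bounded_subset by blast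
qed

text \<open>For a chord \<open>e\<close>, multiplication by \<open>cnj e\<close> gives coordinates
  along the chord (real part) and across it (imaginary part), scaled by the length of
  \<open>e\<close>. All chord estimates below use this frame.\<close>

lemma complex_eq_from_frame:
  fixes z w e :: complex
  assumes "e \<noteq> 0" "Re ((z - c) * cnj e) = Re ((w - c) * cnj e)" "Im ((z - a) * cnj e) = Im ((w - a) * cnj e)"
  shows "z = w"
proof -
  have "Re ((z - w) * cnj e) = 0" "Im ((z - w) * cnj e) = 0"
    using assms(2,3) by (simp_all add: algebra_simps)
  then have "(z - w) * cnj e = 0" by (simp add: complex_eq_iff)
  then show ?thesis using assms(1) by simp
qed

lemma real_multiple_if_Im_zero:
  fixes w e :: complex
  assumes "e \<noteq> 0" "Im (w * cnj e) = 0"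
  shows "w = complex_of_real (Re (w * cnj e) / (norm e)\<^sup>2) * e"
proof -
  define k N where "k = Re (w * cnj e)" and "N = (norm e)\<^sup>2"
  have "w * cnj e = complex_of_real k"
    unfolding k_def using assms(2) by (metis complex_is_Real_iff of_real_Re)
  moreover have "e * cnj e = complex_of_real N" "N \<noteq> 0"
    using complex_norm_square[of e] assms(1) by (simp_all add: N_def)
  ultimately have "w * cnj e = complex_of_real (k / N) * e * cnj e" by (simp add: mult.assoc)
  then have "w = complex_of_real (k / N) * e"
    using assms(1) by (metis complex_cnj_zero_iff mult_right_cancel)
  then show ?thesis unfolding k_def N_def .
qed

lemma equidistant_frame:
  fixes x a b :: complex
  assumes "dist x a = dist x b"
  shows "Re ((x - midpoint a b) * cnj (b - a)) = 0"
proof -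
  have "(dist x a)\<^sup>2 = (dist x b)\<^sup>2" using assms by simp
  then show ?thesis
    unfolding dist_norm cmod_power2 midpoint_def
    by (simp add: power2_eq_square algebra_simps)
qed

text \<open>The ray leaving \<open>z\<close> perpendicularly to the chord, away from it, misses the arc and the triangle.\<close>

lemma chord_strip_outside:
  fixes a b x z :: complex
  assumes "a \<noteq> b" and x: "dist x a = dist x b"
    and strip: "\<And>w. w \<in> B \<Longrightarrow> \<bar>Im ((w - a) * cnj (b - a))\<bar> \<le> (dist a b)\<^sup>2 / 2"
    and far: "\<And>w. w \<in> B \<Longrightarrow> dist a b / 2 \<le> dist z w"
    and strict: "Im ((z - a) * cnj (b - a)) \<noteq> 0 \<or> (\<forall>w\<in>B. dist a b / 2 < dist z w)"
    and z: "z \<notin> convex hull {x, a, b}"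
  shows "z \<in> outside (B \<union> convex hull {x, a, b})"
proof -
  define e where "e = b - a"
  define H where "H w = Im ((w - a) * cnj e)" for w
  define L where "L = (dist a b)\<^sup>2"
  have e: "e \<noteq> 0" "e * cnj e = of_real L" "cnj e * e = of_real L" "L > 0" "cmod e = sqrt L"
    using \<open>a \<noteq> b\<close> complex_norm_square[of e]
    by (auto simp: e_def L_def dist_norm norm_minus_commute mult.commute)
  \<comment> \<open>The side of the chord on which \<open>z\<close> lies, chosen arbitrarily on the
    line itself. The direction \<open>n\<close> has the length of the chord.\<close>
  define \<sigma> :: real where "\<sigma> = (if H z \<ge> 0 then 1 else - 1)"
  have \<sigma>: "\<sigma> * H z = \<bar>H z\<bar>" "\<bar>\<sigma>\<bar> = 1" "\<sigma> * \<sigma> = 1" by (auto simp: \<sigma>_def)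
  define n where "n = \<sigma> * \<i> * e"
  have "n \<noteq> 0" using e \<sigma> by (auto simp: n_def)
  have Hp: "H (z + complex_of_real t * n) = H z + t * \<sigma> * L" for t :: real
  proof -
    have "(z + complex_of_real t * n - a) * cnj e = (z - a) * cnj e + \<i> * of_real (t * \<sigma>) * (e * cnj e)"
      by (simp add: n_def algebra_simps)
    then show ?thesis unfolding H_def e(2) by simp
  qed
  have Rp: "Re ((z + complex_of_real t * n - c) * cnj e) = Re ((z - c) * cnj e)" for t :: real and c
  proof -
    have "(z + complex_of_real t * n - c) * cnj e = (z - c) * cnj e + \<i> * of_real (t * \<sigma>) * (e * cnj e)"
      by (simp add: n_def algebra_simps)
    then show ?thesis unfolding e(2) by simp
  qed
  have "z + complex_of_real t * n \<notin> B \<union> convex hull {x, a, b}" if t: "0 \<le> t" for t :: real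
  proof
    assume "z + complex_of_real t * n \<in> B \<union> convex hull {x, a, b}"
    then consider "z + complex_of_real t * n \<in> B" | "z + complex_of_real t * n \<in> convex hull {x, a, b}" by blast
    then show False
    proof cases
      \<comment> \<open>Points of \<open>B\<close> have height at most half the chord, so the ray
        has moved by at most \<open>dist a b / 2\<close> when it hits \<open>B\<close>, and by less
        if it started off the line. This contradicts \<open>strict\<close> or
        \<open>far\<close>.\<close>
      case 1
      have "\<bar>H z + t * \<sigma> * L\<bar> \<le> L / 2"
        using strip[OF 1] Hp[of t] unfolding H_def e_def L_def by simp
      moreover have "\<bar>H z + t * \<sigma> * L\<bar> = \<bar>\<sigma> * (H z + t * \<sigma> * L)\<bar>" using \<sigma> by (simp add: abs_mult)
      moreover have "\<sigma> * (H z + t * \<sigma> * L) = \<bar>H z\<bar> + t * L"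
        using \<sigma> by (simp add: distrib_left algebra_simps)
      ultimately have le: "\<bar>H z\<bar> + t * L \<le> L / 2" by linarith
      have dz: "dist z (z + complex_of_real t * n) = t * sqrt L"
        using t \<sigma> e(5) by (simp add: dist_norm n_def norm_mult)
      have ab: "dist a b = sqrt L" by (simp add: L_def)
      have tl: "(t - 1 / 2) * L \<le> - \<bar>H z\<bar>" using le by (simp add: algebra_simps)
      show False
      proof (cases "H z = 0")
        case True
        then have "t \<le> 1 / 2" using tl e(4) by (auto simp: mult_le_0_iff)
        then have "t * sqrt L \<le> sqrt L / 2" using mult_right_mono[of t "1/2" "sqrt L"] e(4) by simp
        then show False using strict 1 True dz ab unfolding H_def e_def by force
      next
        case False
        then have "(t - 1 / 2) * L < 0" using tl by linarith
        then have "t < 1 / 2" using e(4) by (auto simp: mult_less_0_iff)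
        then have "t * sqrt L < sqrt L / 2" using mult_strict_right_mono[of t "1/2" "sqrt L"] e(4) by simp
        then show False using far[OF 1] dz ab by simp
      qed
    next
      case 2
      then obtain u v s where uvs: "0 \<le> u" "0 \<le> v" "0 \<le> s" "u + v + s = 1"
          and p: "z + complex_of_real t * n = u *\<^sub>R x + v *\<^sub>R a + s *\<^sub>R b"
        unfolding convex_hull_3 by auto
      have Hx: "H (u *\<^sub>R x + v' *\<^sub>R a + s' *\<^sub>R b) = u * H x" if "u + v' + s' = 1" for u v' s'
      proof -
        have "u *\<^sub>R x + v' *\<^sub>R a + s' *\<^sub>R b - a = u *\<^sub>R (x - a) + s' *\<^sub>R e"
          using that unfolding e_def by (simp add: complex_eq_iff) algebra
        then have "(u *\<^sub>R x + v' *\<^sub>R a + s' *\<^sub>R b - a) * cnj e = u *\<^sub>R ((x - a) * cnj e) + s' *\<^sub>R (e * cnj e)"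
          by (simp add: distrib_right)
        then show ?thesis unfolding H_def e(2) by simp
      qed
      have Rx: "Re ((u *\<^sub>R x + v' *\<^sub>R a + s' *\<^sub>R b - midpoint a b) * cnj e) = (s' - v') * L / 2" if "u + v' + s' = 1" for u v' s'
      proof -
        have v': "v' = 1 - u - s'" using that by simp
        have "u *\<^sub>R x + v' *\<^sub>R a + s' *\<^sub>R b - midpoint a b = u *\<^sub>R (x - midpoint a b) + ((s' - v') / 2) *\<^sub>R e"
          unfolding v' e_def midpoint_def by (simp add: complex_eq_iff algebra_simps) (simp add: field_simps)
        then have "(u *\<^sub>R x + v' *\<^sub>R a + s' *\<^sub>R b - midpoint a b) * cnj e
           = u *\<^sub>R ((x - midpoint a b) * cnj e) + ((s' - v') / 2) *\<^sub>R (e * cnj e)"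
          by (simp add: distrib_right)
        then show ?thesis unfolding e(2) using equidistant_frame[OF x] by (simp add: e_def)
      qed
      have Hz: "H z + t * \<sigma> * L = u * H x" using Hp[of t] Hx[OF uvs(4)] p by simp
      \<comment> \<open>Going back from the hit point to \<open>z\<close> scales the height by a
        factor between 0 and 1.\<close>
      have "\<exists>\<theta>. 0 \<le> \<theta> \<and> \<theta> \<le> 1 \<and> H z = \<theta> * (u * H x)"
      proof (cases "H z = 0")
        case True then show ?thesis by (intro exI[of _ 0]) auto
      next
        case False
        have "\<sigma> * (u * H x) = \<bar>H z\<bar> + t * L"
          unfolding Hz[symmetric] using \<sigma> by (simp add: distrib_left algebra_simps)
        then have 1: "\<bar>H z\<bar> \<le> \<sigma> * (u * H x)" using t e(4) by simp
        then have pos: "\<sigma> * (u * H x) > 0" using False by linarith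
        define \<theta> where "\<theta> = \<bar>H z\<bar> / (\<sigma> * (u * H x))"
        have "0 \<le> \<theta>" "\<theta> \<le> 1" using 1 pos by (auto simp: \<theta>_def)
        moreover have "\<theta> * (u * H x) = \<bar>H z\<bar> / \<sigma>" using pos by (auto simp: \<theta>_def)
        moreover have "\<bar>H z\<bar> / \<sigma> = H z" by (simp add: \<sigma>_def)
        ultimately show ?thesis by metis
      qed
      then obtain \<theta> where \<theta>: "0 \<le> \<theta>" "\<theta> \<le> 1" "H z = \<theta> * (u * H x)" by blast
      \<comment> \<open>The weight taken from the apex is split equally between \<open>a\<close> and
        \<open>b\<close>. As the apex lies over the midpoint, the position along the chord is kept,
        so the new combination is \<open>z\<close> and lies in the triangle.\<close>
      define v' s' where "v' = v + (1 - \<theta>) * u / 2" and "s' = s + (1 - \<theta>) * u / 2"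
      have sum1: "\<theta> * u + v' + s' = 1" using uvs by (simp add: v'_def s'_def field_simps)
      have "z = (\<theta> * u) *\<^sub>R x + v' *\<^sub>R a + s' *\<^sub>R b"
      proof (rule complex_eq_from_frame[OF e(1), of _ "midpoint a b" _ a])
        show "Re ((z - midpoint a b) * cnj e) = Re (((\<theta> * u) *\<^sub>R x + v' *\<^sub>R a + s' *\<^sub>R b - midpoint a b) * cnj e)"
          unfolding Rx[OF sum1] using Rp[of t "midpoint a b"] Rx[OF uvs(4)] p by (simp add: v'_def s'_def)
        show "Im ((z - a) * cnj e) = Im (((\<theta> * u) *\<^sub>R x + v' *\<^sub>R a + s' *\<^sub>R b - a) * cnj e)"
          using Hx[OF sum1] \<theta>(3) by (simp add: H_def)
      qed
      moreover have "0 \<le> \<theta> * u" "0 \<le> v'" "0 \<le> s'" using \<theta> uvs by (auto simp: v'_def s'_def)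
      ultimately have "z \<in> convex hull {x, a, b}" unfolding convex_hull_3 using sum1 by blast
      then show False using z by simp
    qed
  qed
  then show ?thesis using ray_imp_outside \<open>n \<noteq> 0\<close> by blast
qed

text \<open>The parallelogram identity for \<open>x - a\<close> and \<open>x - b\<close> makes their
  sum vanish.\<close>

lemma equidistant_antipodal_midpoint:
  fixes x a b :: complex
  assumes "dist x a = \<epsilon>" "dist x b = \<epsilon>" "dist a b = 2 * \<epsilon>"
  shows "x = midpoint a b"
proof -
  have "(cmod (2 * x - a - b))\<^sup>2 = 2 * (dist x a)\<^sup>2 + 2 * (dist x b)\<^sup>2 - (dist a b)\<^sup>2"
    unfolding dist_norm cmod_power2 by (simp add: power2_eq_square algebra_simps)
  then have "2 * x - a - b = 0" using assms by (simp add: power2_eq_square)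
  then have "2 * x = a + b" by (simp add: algebra_simps)
  then show ?thesis by (simp add: midpoint_def complex_eq_iff)
qed

text \<open>If \<open>a\<close> carries more weight than \<open>b\<close>, the triangle inequality
  gives \<open>dist z a \<le> (u + 2 * s) * \<epsilon>\<close> with \<open>u + 2 * s < 1\<close>.
  For equal weights \<open>z\<close> lies between the apex and the midpoint of the base, and the
  midpoint is nearer to \<open>a\<close> than \<epsilon> unless it is the apex.\<close>

lemma isosceles_near_base:
  fixes x a b z :: complex
  assumes "dist x a = \<epsilon>" "dist x b = \<epsilon>" "z \<in> convex hull {x, a, b}" "z \<noteq> x"
  shows "dist z a < \<epsilon> \<or> dist z b < \<epsilon>"
proof -
  obtain u v s where uvs: "0 \<le> u" "0 \<le> v" "0 \<le> s" "u + v + s = 1"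
     and z: "z = u *\<^sub>R x + v *\<^sub>R a + s *\<^sub>R b"
    using assms(3) unfolding convex_hull_3 by auto
  have "\<epsilon> \<ge> 0" using assms(1) by auto
  have ab: "dist a b \<le> 2 * \<epsilon>" using dist_triangle[of a b x] assms by (simp add: dist_commute)
  have "\<epsilon> \<noteq> 0"
  proof
    assume "\<epsilon> = 0"
    then have "a = x" "b = x" using assms by auto
    then show False using assms(3,4) by simp
  qed
  then have "\<epsilon> > 0" using \<open>\<epsilon> \<ge> 0\<close> by simp
  have lt: "dist (u *\<^sub>R x + v *\<^sub>R a + s *\<^sub>R b) a < \<epsilon>"
    if "dist x a = \<epsilon>" "dist a b \<le> 2 * \<epsilon>" "s < v" "0 \<le> u" "0 \<le> s" "u + v + s = 1" for v s a b
  proof -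
    have v: "v = 1 - u - s" using that by simp
    have "u *\<^sub>R x + v *\<^sub>R a + s *\<^sub>R b - a = u *\<^sub>R (x - a) + s *\<^sub>R (b - a)"
      unfolding v by (simp add: algebra_simps)
    then have "dist (u *\<^sub>R x + v *\<^sub>R a + s *\<^sub>R b) a \<le> u * dist x a + s * dist a b"
      using norm_triangle_ineq[of "u *\<^sub>R (x - a)" "s *\<^sub>R (b - a)"] that by (simp add: dist_norm norm_minus_commute)
    also have "\<dots> \<le> u * \<epsilon> + s * (2 * \<epsilon>)" using that by (intro add_mono mult_left_mono) auto
    also have "\<dots> = (u + s + s) * \<epsilon>" by (simp add: algebra_simps)
    also have "\<dots> < 1 * \<epsilon>" using that \<open>\<epsilon> > 0\<close> by (intro mult_strict_right_mono) auto
    finally show ?thesis by simp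
  qed
  consider "s < v" | "v < s" | "v = s" by linarith
  then show ?thesis
  proof cases
    case 1 then show ?thesis using lt[of a b s v] assms ab uvs z by auto
  next
    case 2 then show ?thesis using lt[of b a v s] assms ab uvs z by (auto simp: dist_commute add_ac)
  next
    case 3
    define m where "m = midpoint a b"
    have u: "u = 1 - 2 * s" using uvs 3 by simp
    have "u < 1"
    proof (rule ccontr)
      assume "\<not> u < 1"
      then have "s = 0" "v = 0" "u = 1" using uvs by linarith+
      then show False using z assms(4) by simp
    qed
    have zm: "z = u *\<^sub>R x + (1 - u) *\<^sub>R m"
      unfolding z m_def midpoint_def u 3 by (simp add: algebra_simps)
    then have "z - a = u *\<^sub>R (x - a) + (1 - u) *\<^sub>R (m - a)" by (simp add: algebra_simps)
    then have le: "dist z a \<le> u * dist x a + (1 - u) * dist m a"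
      using norm_triangle_ineq[of "u *\<^sub>R (x - a)" "(1 - u) *\<^sub>R (m - a)"] uvs \<open>u < 1\<close> by (simp add: dist_norm)
    have ma: "dist m a = dist a b / 2" by (simp add: m_def dist_midpoint)
    show ?thesis
    proof (cases "dist a b = 2 * \<epsilon>")
      case True
      then have "m = x" using assms
        unfolding m_def by (intro equidistant_antipodal_midpoint[symmetric])
      then show ?thesis using zm assms(4) by (simp add: algebra_simps)
    next
      case False
      then have "(1 - u) * dist m a < (1 - u) * \<epsilon>" using ab ma \<open>u < 1\<close> by simp
      then have "dist z a < u * \<epsilon> + (1 - u) * \<epsilon>" using le assms(1) by simp
      then show ?thesis by (simp add: algebra_simps)
    qed
  qed
qed



text \<open>In the borderline case of an arc through the apex of the half disc over its chord, a point of
  the arc on the line of the chord violates the chord condition on one of the two halves of the arc.\<close>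

lemma apex_chord_violation:
  fixes e m p l :: complex
  assumes "e \<noteq> 0" and "p = m + e * (\<i> * s / 2)" "s = 1 \<or> s = - 1"
    and l: "l = m + complex_of_real r * e" "1 < \<bar>r\<bar>"
  shows "(cmod (p - (m - e / 2)))\<^sup>2 / 2 < \<bar>Im ((l - (m - e / 2)) * cnj (p - (m - e / 2)))\<bar>"
    and "(cmod (m + e / 2 - p))\<^sup>2 / 2 < \<bar>Im ((l - p) * cnj (m + e / 2 - p))\<bar>"
    and "cmod (p - (m - e / 2)) \<le> cmod e" "cmod (m + e / 2 - p) \<le> cmod e"
proof -
  define L where "L = (cmod e)\<^sup>2"
  have ee: "e * cnj e = of_real L" "L > 0" using complex_norm_square[of e] assms(1) by (auto simp: L_def)
  have s2: "(cmod (1 / 2 + \<i> * s / 2))\<^sup>2 = 1 / 2" "(cmod (1 / 2 - \<i> * s / 2))\<^sup>2 = 1 / 2"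
    unfolding cmod_power2 using assms(3) by (auto simp: power2_eq_square)
  have pa: "p - (m - e / 2) = e * (1 / 2 + \<i> * s / 2)" and pb: "m + e / 2 - p = e * (1 / 2 - \<i> * s / 2)"
    unfolding assms(2) by (simp_all add: field_simps)
  have n: "(cmod (p - (m - e / 2)))\<^sup>2 = L / 2" "(cmod (m + e / 2 - p))\<^sup>2 = L / 2"
    unfolding pa pb norm_mult power_mult_distrib s2 by (simp_all add: L_def)
  have "(l - (m - e / 2)) * cnj (p - (m - e / 2)) = (r + 1 / 2) * (1 / 2 - \<i> * cnj s / 2) * (e * cnj e)"
    unfolding pa l by (simp add: field_simps)
  moreover have "\<bar>Im ((r + 1 / 2) * (1 / 2 - \<i> * cnj s / 2))\<bar> = \<bar>r + 1 / 2\<bar> / 2"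
    using assms(3) by auto
  ultimately have 1: "\<bar>Im ((l - (m - e / 2)) * cnj (p - (m - e / 2)))\<bar> = \<bar>r + 1 / 2\<bar> * L / 2"
    unfolding ee using ee(2) by (simp add: abs_mult)
  have "(l - p) * cnj (m + e / 2 - p) = (r - \<i> * s / 2) * (1 / 2 + \<i> * cnj s / 2) * (e * cnj e)"
    unfolding pb l assms(2) by (simp add: field_simps)
  moreover have "\<bar>Im ((r - \<i> * s / 2) * (1 / 2 + \<i> * cnj s / 2))\<bar> = \<bar>r - 1 / 2\<bar> / 2"
    using assms(3) by (auto simp: abs_if field_simps)
  ultimately have 2: "\<bar>Im ((l - p) * cnj (m + e / 2 - p))\<bar> = \<bar>r - 1 / 2\<bar> * L / 2"
    unfolding ee using ee(2) by (simp add: abs_mult)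
  \<comment> \<open>In units of the chord both violations say that \<open>r\<close> is more than 1/2
    away from the end of the chord involved, at -1/2 or 1/2.\<close>
  have "1 / 2 < \<bar>r + 1 / 2\<bar>" "1 / 2 < \<bar>r - 1 / 2\<bar>" using l(2) by linarith+
  then have "1 / 2 * L < \<bar>r + 1 / 2\<bar> * L" "1 / 2 * L < \<bar>r - 1 / 2\<bar> * L"
    using ee(2) mult_strict_right_mono by blast+
  then show "(cmod (p - (m - e / 2)))\<^sup>2 / 2 < \<bar>Im ((l - (m - e / 2)) * cnj (p - (m - e / 2)))\<bar>"
    and "(cmod (m + e / 2 - p))\<^sup>2 / 2 < \<bar>Im ((l - p) * cnj (m + e / 2 - p))\<bar>"
    unfolding n 1 2 by simp_all
  have "(cmod (p - (m - e / 2)))\<^sup>2 \<le> (cmod e)\<^sup>2" "(cmod (m + e / 2 - p))\<^sup>2 \<le> (cmod e)\<^sup>2"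
    unfolding n using ee(2) by (simp_all add: L_def)
  then show "cmod (p - (m - e / 2)) \<le> cmod e" "cmod (m + e / 2 - p) \<le> cmod e"
    by (meson norm_ge_zero power2_le_imp_le)+
qed

text \<open>The ray perpendicular to the chord works unless \<open>z\<close> lies on the line of the
  chord and \<open>x\<close> is the midpoint of the chord; then a ray along the line is used. In
  \<open>halves\<close>, \<open>p\<close> cuts the arc in two and \<open>l\<close> belongs to one of
  the parts, whence the disjunction.\<close>

lemma closer_to_equidistant_imp_outside:
  fixes a b x z :: complex
  assumes "a \<noteq> b" and x: "dist x a = \<epsilon>" "dist x b = \<epsilon>"
    and "connected B" "a \<in> B" "b \<in> B"
    and strip: "\<And>w. w \<in> B \<Longrightarrow> \<bar>Im ((w - a) * cnj (b - a))\<bar> \<le> (dist a b)\<^sup>2 / 2"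
    and farz: "\<And>w. w \<in> B \<Longrightarrow> \<epsilon> \<le> dist z w"
    and farx: "\<And>w. w \<in> B \<Longrightarrow> \<epsilon> \<le> dist x w"
    and halves: "\<And>p l. p \<in> B \<Longrightarrow> p \<noteq> a \<Longrightarrow> p \<noteq> b \<Longrightarrow> dist a p \<le> dist a b \<Longrightarrow> dist p b \<le> dist a b \<Longrightarrow> l \<in> B \<Longrightarrow>
        \<bar>Im ((l - a) * cnj (p - a))\<bar> \<le> (dist a p)\<^sup>2 / 2 \<or> \<bar>Im ((l - p) * cnj (b - p))\<bar> \<le> (dist p b)\<^sup>2 / 2"
    and "z \<noteq> x"
  shows "z \<in> outside (B \<union> convex hull {x, a, b})"
proof -
  have zh: "z \<notin> convex hull {x, a, b}"
    using isosceles_near_base[OF x _ \<open>z \<noteq> x\<close>] farz \<open>a \<in> B\<close> \<open>b \<in> B\<close> by force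
  have ab: "dist a b \<le> 2 * \<epsilon>" using dist_triangle[of a b x] x by (simp add: dist_commute)
  show ?thesis
  proof (cases "Im ((z - a) * cnj (b - a)) \<noteq> 0 \<or> dist a b < 2 * \<epsilon>")
    case True
    then have st: "Im ((z - a) * cnj (b - a)) \<noteq> 0 \<or> (\<forall>w\<in>B. dist a b / 2 < dist z w)"
      using farz by force
    have "dist a b / 2 \<le> dist z w" if "w \<in> B" for w using farz[OF that] ab by simp
    then show ?thesis
      using chord_strip_outside[OF \<open>a \<noteq> b\<close> _ strip _ st zh] x by simp
  next
    case False
    then have hz: "Im ((z - a) * cnj (b - a)) = 0" and eq: "dist a b = 2 * \<epsilon>" using ab by auto
    define e m where "e = b - a" and "m = midpoint a b"
    have xm: "x = m" unfolding m_def by (rule equidistant_antipodal_midpoint[OF x eq])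
    have am: "a = m - e / 2" and bm: "b = m + e / 2"
      unfolding m_def e_def midpoint_def by (simp_all add: complex_eq_iff field_simps)
    have "0 < dist a b" using \<open>a \<noteq> b\<close> by simp
    then have "e \<noteq> 0" "\<epsilon> > 0" "cmod e = 2 * \<epsilon>"
      using eq \<open>a \<noteq> b\<close> unfolding e_def by simp_all (simp add: dist_norm norm_minus_commute)
    define L where "L = (cmod e)\<^sup>2"
    have ee: "e * cnj e = of_real L" "L > 0" using complex_norm_square[of e] \<open>e \<noteq> 0\<close> by (auto simp: L_def)
    define u where "u = Re ((z - a) * cnj e) / (norm e)\<^sup>2 - 1 / 2"
    then have "u + 1 / 2 = Re ((z - a) * cnj e) / (norm e)\<^sup>2" by (simp only: diff_add_cancel)
    then have "z - a = complex_of_real (u + 1 / 2) * e"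
      using real_multiple_if_Im_zero[OF \<open>e \<noteq> 0\<close>, of "z - a"] hz unfolding e_def[symmetric] by (simp only:)
    then have zu: "z = m + complex_of_real u * e" unfolding am by (simp add: algebra_simps)
    have hull: "convex hull {x, a, b} = closed_segment a b"
    proof -
      have "x \<in> convex hull {a, b}" unfolding xm m_def by (metis midpoint_in_closed_segment segment_convex_hull)
      then show ?thesis by (metis hull_redundant segment_convex_hull)
    qed
    have seg: "m + complex_of_real t * e \<in> closed_segment a b \<longleftrightarrow> \<bar>t\<bar> \<le> 1 / 2" for t
    proof -
      have "m + complex_of_real t * e = (1 - s) *\<^sub>R a + s *\<^sub>R b \<longleftrightarrow> s = t + 1 / 2" for s
      proof -
        have "(1 - s) *\<^sub>R a + s *\<^sub>R b = m + complex_of_real (s - 1 / 2) * e"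
          unfolding am bm by (simp add: scaleR_conv_of_real field_simps)
        then have "m + complex_of_real t * e = (1 - s) *\<^sub>R a + s *\<^sub>R b \<longleftrightarrow>
            complex_of_real t = complex_of_real (s - 1 / 2)"
          using \<open>e \<noteq> 0\<close> by (simp del: of_real_diff)
        then show ?thesis unfolding of_real_eq_iff by auto
      qed
      then show ?thesis unfolding in_segment by (auto simp: abs_le_iff)
    qed
    have "\<bar>u\<bar> > 1 / 2" using zh seg[of u] zu hull by auto
    have Rab: "Re ((a - m) * cnj e) = - L / 2" "Re ((b - m) * cnj e) = L / 2"
      unfolding am bm by (simp_all add: ee)
    \<comment> \<open>By connectedness \<open>B\<close> crosses the perpendicular bisector. The
      strip bounds the height of the crossing from above by half the chord, and \<open>farx\<close>
      bounds it from below by the same amount, so \<open>p\<close> is the apex of a half disc over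
      the chord.\<close>
    obtain p where p: "p \<in> B" "Re ((p - m) * cnj e) = 0"
    proof -
      have "connected ((\<lambda>w. Re ((w - m) * cnj e)) ` B)"
        using \<open>connected B\<close> by (intro connected_continuous_image continuous_intros)
      moreover have "- L / 2 \<in> (\<lambda>w. Re ((w - m) * cnj e)) ` B" "L / 2 \<in> (\<lambda>w. Re ((w - m) * cnj e)) ` B"
        by (rule image_eqI[of _ _ a], simp only: Rab, fact, rule image_eqI[of _ _ b], simp only: Rab, fact)
      ultimately have "0 \<in> (\<lambda>w. Re ((w - m) * cnj e)) ` B"
        by (rule connectedD_interval) (use ee(2) in linarith)+
      then obtain p where "p \<in> B" "0 = Re ((p - m) * cnj e)" by blast
      then show ?thesis using that[of p] by metis
    qed
    define v where "v = Re (- \<i> * (p - m) * cnj e) / (norm e)\<^sup>2"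
    have "Im (- \<i> * (p - m) * cnj e) = 0" using p(2) by (simp add: mult.assoc)
    then have "- \<i> * (p - m) = complex_of_real v * e"
      unfolding v_def by (rule real_multiple_if_Im_zero[OF \<open>e \<noteq> 0\<close>])
    then have "\<i> * (- \<i> * (p - m)) = \<i> * (complex_of_real v * e)" by simp
    then have pv: "p = m + e * (\<i> * of_real v)" by (simp add: algebra_simps)
    have "(p - a) * cnj e = (\<i> * of_real v + 1 / 2) * of_real L"
      unfolding pv am by (simp add: algebra_simps flip: ee(1))
    then have vL: "Im ((p - a) * cnj e) = v * L" by simp
    have "\<bar>v\<bar> \<le> 1 / 2"
    proof -
      have "\<bar>v\<bar> * L \<le> 1 / 2 * L"
        using strip[OF p(1)] ee(2) norm_minus_commute[of a b] vL
        by (simp add: e_def[symmetric] L_def dist_norm abs_mult)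
      then show ?thesis using ee(2) mult_le_cancel_right_pos by blast
    qed
    moreover have "\<bar>v\<bar> \<ge> 1 / 2"
      using farx[OF p(1)] \<open>cmod e = 2 * \<epsilon>\<close> \<open>\<epsilon> > 0\<close> unfolding pv xm by (simp add: dist_norm norm_mult)
    ultimately have "\<bar>v\<bar> = 1 / 2" by simp
    obtain s :: real where s: "s = 1 \<or> s = - 1" "p = m + e * (\<i> * complex_of_real s / 2)"
    proof (rule that[of "2 * v"])
      show "2 * v = 1 \<or> 2 * v = - 1" using \<open>\<bar>v\<bar> = 1 / 2\<close> by linarith
      show "p = m + e * (\<i> * complex_of_real (2 * v) / 2)" using pv by simp
    qed
    have s': "complex_of_real s = 1 \<or> complex_of_real s = - 1" using s by auto
    \<comment> \<open>Farther out on the line, a point of \<open>B\<close> would violate the chord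
      condition on both halves at \<open>p\<close>.\<close>
    have viol: "r \<in> {-1..1}" if "m + complex_of_real r * e \<in> B" for r
    proof (rule ccontr)
      assume "r \<notin> {-1..1}"
      then have r: "1 < \<bar>r\<bar>" by auto
      note V = apex_chord_violation[OF \<open>e \<noteq> 0\<close> s(2) s' refl r]
      have "p \<noteq> a" "p \<noteq> b" using p(2) Rab ee(2) by auto
      moreover have "(dist p a)\<^sup>2 / 2 < \<bar>Im ((m + complex_of_real r * e - a) * cnj (p - a))\<bar>"
        "dist p a \<le> cmod e"
        using V(1,3) unfolding am[symmetric] dist_norm by blast+
      moreover have "(dist b p)\<^sup>2 / 2 < \<bar>Im ((m + complex_of_real r * e - p) * cnj (b - p))\<bar>"
        "dist b p \<le> cmod e"
        using V(2,4) unfolding bm[symmetric] dist_norm by blast+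
      moreover have "cmod e = dist a b" by (simp add: e_def dist_norm norm_minus_commute)
      ultimately show False
        using halves[OF p(1) _ _ _ _ that] unfolding dist_commute[of p a] dist_commute[of b p] by linarith
    qed
    \<comment> \<open>The chord has length \<open>2 * \<epsilon>\<close>, so distance at least
      \<epsilon> from both ends excludes positions with absolute value strictly between 1/2 and
      1.\<close>
    have "\<bar>u\<bar> \<ge> 1"
    proof -
      have "dist z (m + complex_of_real t * e) = \<bar>u - t\<bar> * (2 * \<epsilon>)" for t
      proof -
        have "z - (m + complex_of_real t * e) = of_real (u - t) * e" unfolding zu by (simp add: algebra_simps)
        then show ?thesis using \<open>cmod e = 2 * \<epsilon>\<close> by (simp add: dist_norm norm_mult del: of_real_diff)
      qed
      from this[of "- (1 / 2)"] this[of "1 / 2"]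
      have "dist z a = \<bar>u + 1 / 2\<bar> * (2 * \<epsilon>)" "dist z b = \<bar>u - 1 / 2\<bar> * (2 * \<epsilon>)"
        unfolding am bm by simp_all
      then have 1: "\<bar>u + 1 / 2\<bar> \<ge> 1 / 2" and 2: "\<bar>u - 1 / 2\<bar> \<ge> 1 / 2"
        using farz[OF \<open>a \<in> B\<close>] farz[OF \<open>b \<in> B\<close>] \<open>\<epsilon> > 0\<close> by simp_all
      show ?thesis using 1 2 \<open>\<bar>u\<bar> > 1 / 2\<close> by linarith
    qed
    \<comment> \<open>The ray runs along the line away from the chord. It leaves the range allowed
      by \<open>viol\<close> at once, and its starting point \<open>z\<close> is not in
      \<open>B\<close> by \<open>farz\<close>.\<close>
    define \<sigma> :: real where "\<sigma> = (if u > 0 then 1 else - 1)"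
    show ?thesis
    proof (rule ray_imp_outside[of "of_real \<sigma> * e"])
      show "of_real \<sigma> * e \<noteq> 0" using \<open>e \<noteq> 0\<close> by (simp add: \<sigma>_def)
      fix t :: real assume t: "0 \<le> t"
      have zt: "z + of_real t * (of_real \<sigma> * e) = m + complex_of_real (u + t * \<sigma>) * e"
        unfolding zu by (simp add: algebra_simps)
      have ut: "\<bar>u + t * \<sigma>\<bar> = \<bar>u\<bar> + t" using t \<open>\<bar>u\<bar> \<ge> 1\<close> by (auto simp: \<sigma>_def)
      have "z + of_real t * (of_real \<sigma> * e) \<notin> closed_segment a b"
        unfolding zt seg ut using t \<open>\<bar>u\<bar> \<ge> 1\<close> by simp
      moreover have "z + of_real t * (of_real \<sigma> * e) \<notin> B"
      proof
        assume inB: "z + of_real t * (of_real \<sigma> * e) \<in> B"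
        have "\<bar>u + t * \<sigma>\<bar> \<le> 1" using viol inB unfolding zt by fastforce
        then have "t = 0" using ut t \<open>\<bar>u\<bar> \<ge> 1\<close> by simp
        then have "z \<in> B" using inB by simp
        then show False using farz[of z] \<open>\<epsilon> > 0\<close> by simp
      qed
      ultimately show "z + of_real t * (of_real \<sigma> * e) \<notin> B \<union> convex hull {x, a, b}"
        using hull by blast
    qed
  qed
qed

subsection \<open>The boundary of a parallel set\<close>

lemma jordan_curve_based_parametrization:
  fixes \<Gamma> :: "'a::euclidean_space set"
  assumes "jordan_curve \<Gamma>" "f \<in> \<Gamma>"
  obtains g where "simple_path g" "pathfinish g = pathstart g" "path_image g = \<Gamma>" "g 0 = f"
proof -
  obtain g0 where g0: "simple_path g0" "pathfinish g0 = pathstart g0" "path_image g0 = \<Gamma>"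
    using assms(1) unfolding jordan_curve_def by blast
  obtain u where u: "u \<in> {0..1}" "g0 u = f" using assms(2) g0(3) by (auto simp: path_image_def)
  show thesis
  proof
    show "simple_path (shiftpath u g0)" using g0 u simple_path_shiftpath by force
    show "pathfinish (shiftpath u g0) = pathstart (shiftpath u g0)"
      using closed_shiftpath[OF g0(2) u(1)] .
    show "path_image (shiftpath u g0) = \<Gamma>" using path_image_shiftpath[OF u(1) g0(2)] g0(3) by simp
    show "shiftpath u g0 0 = f" using u by (simp add: shiftpath_def)
  qed
qed

lemma Im_chord_commute:
  fixes z a b :: complex
  shows "\<bar>Im ((z - a) * cnj (b - a))\<bar> = \<bar>Im ((z - b) * cnj (a - b))\<bar>"
proof -
  have "Im ((z - a) * cnj (b - a)) = - Im ((z - b) * cnj (a - b))"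
    by (simp add: algebra_simps)
  then show ?thesis by simp
qed

text \<open>The base point of the parametrization lies far from the two points of the curve, so that the
  parameter interval \<open>{\<alpha>..\<beta>}\<close> describes the small one of the two arcs joining them.\<close>

locale chordal_curve =
  fixes \<Gamma> :: "complex set" and r \<eta> :: real
  assumes curve: "jordan_curve \<Gamma>"
    and r_pos: "0 < r" and r_le: "r \<le> \<eta>"
    and wide: "\<And>c. \<exists>f\<in>\<Gamma>. 3 * \<eta> < dist f c"
    and small_arc: "\<And>g \<alpha> \<beta>. simple_path g \<Longrightarrow> pathfinish g = pathstart g \<Longrightarrow> path_image g = \<Gamma> \<Longrightarrow>
      0 < \<alpha> \<Longrightarrow> \<alpha> < \<beta> \<Longrightarrow> \<beta> < 1 \<Longrightarrow> dist (g \<alpha>) (g \<beta>) \<le> r \<Longrightarrow> \<eta> < dist (g 0) (g \<alpha>) \<Longrightarrow>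
      g ` {\<alpha>..\<beta>} \<subseteq> cball (g \<alpha>) \<eta> \<and>
      (\<forall>z\<in>g ` {\<alpha>..\<beta>}. \<bar>Im ((z - g \<alpha>) * cnj (g \<beta> - g \<alpha>))\<bar> \<le> (dist (g \<alpha>) (g \<beta>))\<^sup>2 / 2)"
begin

lemma eta_pos: "0 < \<eta>" using r_pos r_le by simp

lemma compact_curve: "compact \<Gamma>" "\<Gamma> \<noteq> {}"
  using curve compact_simple_path_image unfolding jordan_curve_def by force+

lemma closed_curve: "closed \<Gamma>" using compact_curve compact_imp_closed by blast

text \<open>The base point is taken more than \<open>3 * \<eta>\<close> away from \<open>a\<close>,
  hence more than \<open>2 * \<eta>\<close> away from \<open>b\<close>. So \<open>small_arc\<close>
  applies in whichever order the parametrization meets the two points.\<close>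

lemma chord_arc:
  assumes "a \<in> \<Gamma>" "b \<in> \<Gamma>" "a \<noteq> b" "dist a b \<le> r"
  obtains B where "compact B" "connected B" "B \<subseteq> \<Gamma>" "a \<in> B" "b \<in> B"
    "\<And>z. z \<in> B \<Longrightarrow> \<bar>Im ((z - a) * cnj (b - a))\<bar> \<le> (dist a b)\<^sup>2 / 2"
proof -
  obtain f where f: "f \<in> \<Gamma>" "3 * \<eta> < dist f a" using wide by blast
  then obtain g where g: "simple_path g" "pathfinish g = pathstart g" "path_image g = \<Gamma>" "g 0 = f"
    using jordan_curve_based_parametrization[OF curve] by metis
  have fb: "2 * \<eta> < dist f b"
    using f(2) assms(4) r_le dist_triangle[of f a b] by (simp add: dist_commute)
  have g1: "g 1 = f" using g by (simp add: pathfinish_def pathstart_def)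
  obtain u v where uv: "u \<in> {0..1}" "g u = a" "v \<in> {0..1}" "g v = b"
    using assms(1,2) g(3) unfolding path_image_def by blast
  have "g 0 \<noteq> a" "g 1 \<noteq> a" "g 0 \<noteq> b" "g 1 \<noteq> b" using f fb eta_pos g(4) g1 by auto
  then have "u \<noteq> 0" "u \<noteq> 1" "v \<noteq> 0" "v \<noteq> 1" using uv by auto
  then have uv': "0 < u" "u < 1" "0 < v" "v < 1" using uv by auto
  have cont: "continuous_on {0..1} g" using g(1) by (simp add: simple_path_def path_def)
  have *: "compact (g ` {s..t})" "connected (g ` {s..t})" "g ` {s..t} \<subseteq> \<Gamma>" if "0 < s" "t < 1" for s t
  proof -
    have "{s..t} \<subseteq> {0..1}" using that by auto
    moreover have c: "continuous_on {s..t} g" using cont by (rule continuous_on_subset) (use that in auto)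
    ultimately show "g ` {s..t} \<subseteq> \<Gamma>" using g(3) by (auto simp: path_image_def)
    show "compact (g ` {s..t})" "connected (g ` {s..t})"
      using c by (auto intro!: compact_continuous_image connected_continuous_image)
  qed
  have "u \<noteq> v" using uv assms(3) by auto
  then consider "u < v" | "v < u" by linarith
  then show thesis
  proof cases
    case 1
    then have "\<forall>z\<in>g ` {u..v}. \<bar>Im ((z - a) * cnj (b - a))\<bar> \<le> (dist a b)\<^sup>2 / 2"
      using small_arc[OF g(1-3), of u v] uv uv' f g(4) assms(4) eta_pos by simp
    moreover have "a \<in> g ` {u..v}" "b \<in> g ` {u..v}" using uv(2,4) 1 by auto
    ultimately show ?thesis using that[OF *[OF uv'(1,4)]] by blast
  next
    case 2
    then have b: "\<forall>z\<in>g ` {v..u}. \<bar>Im ((z - b) * cnj (a - b))\<bar> \<le> (dist a b)\<^sup>2 / 2"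
      using small_arc[OF g(1-3), of v u] uv uv' fb g(4) assms(4) eta_pos by (simp add: dist_commute)
    have "\<bar>Im ((z - a) * cnj (b - a))\<bar> \<le> (dist a b)\<^sup>2 / 2" if "z \<in> g ` {v..u}" for z
      unfolding Im_chord_commute[of z a b] using b that by blast
    moreover have "a \<in> g ` {v..u}" "b \<in> g ` {v..u}" using uv(2,4) 2 by auto
    ultimately show ?thesis using that[OF *[OF uv'(3,2)]] by blast
  qed
qed

end

text \<open>Leaving open which side is \<open>S\<close> treats positive and negative levels at
  once.\<close>

locale chordal_curve_side = chordal_curve +
  fixes S S' :: "complex set"
  assumes sides: "S = inside \<Gamma> \<and> S' = outside \<Gamma> \<or> S = outside \<Gamma> \<and> S' = inside \<Gamma>"
begin

lemma side_props:
  "open S" "connected S" "open S'" "connected S'" "S \<inter> S' = {}" "S \<union> S' = - \<Gamma>"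
  "frontier S = \<Gamma>" "frontier S' = \<Gamma>" "S' \<noteq> {}"
proof -
  obtain g where g: "simple_path g" "pathfinish g = pathstart g" "path_image g = \<Gamma>"
    using curve unfolding jordan_curve_def by blast
  note J = Jordan_inside_outside[OF g(1,2), unfolded g(3)]
  have "open S \<and> connected S \<and> open S' \<and> connected S' \<and> S \<inter> S' = {} \<and> S \<union> S' = - \<Gamma> \<and>
    frontier S = \<Gamma> \<and> frontier S' = \<Gamma> \<and> S' \<noteq> {}"
    using sides by (rule disjE) (use J in \<open>simp add: Int_commute Un_commute\<close>)+
  then show "open S" "connected S" "open S'" "connected S'" "S \<inter> S' = {}" "S \<union> S' = - \<Gamma>"
    "frontier S = \<Gamma>" "frontier S' = \<Gamma>" "S' \<noteq> {}" by blast+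
qed

lemma closure_side: "closure S = S \<union> \<Gamma>" "closure S' = S' \<union> \<Gamma>"
  using closure_Un_frontier[of S] closure_Un_frontier[of S'] side_props by auto

lemma connected_meets_side:
  assumes "connected C" "C \<inter> \<Gamma> = {}" "C \<inter> S \<noteq> {}"
  shows "C \<subseteq> S"
proof -
  have "C \<subseteq> S \<union> S'" using assms side_props by blast
  then show ?thesis
    using connectedD[OF assms(1) side_props(1,3)] assms(3) side_props(5) by blast
qed

text \<open>By \<open>connected_component_offset\<close> it suffices that no arc together with its
  chord separates two points deep in \<open>S\<close>. Both points lie in the outside of this set,
  which is connected.\<close>

lemma offset_connected:
  assumes "0 < s" "2 * s \<le> r"
  shows "connected {x \<in> S. s < infdist x \<Gamma>}"
  unfolding connected_iff_connected_component
proof (intro ballI)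
  fix y1 y2 assume y: "y1 \<in> {x \<in> S. s < infdist x \<Gamma>}" "y2 \<in> {x \<in> S. s < infdist x \<Gamma>}"
  have far: "s < dist c y" if "c \<in> \<Gamma>" "y \<in> {y1, y2}" for c y
    using y infdist_le[OF that(1), of y] that(2) by (auto simp: dist_commute)
  have "connected_component (- {x. \<exists>c\<in>\<Gamma>. dist x c \<le> s}) y1 y2"
  proof (rule connected_component_offset[OF compact_curve(1)])
    show "connected_component (- \<Gamma>) y1 y2"
      using y side_props unfolding connected_component_def by blast
    show "s < dist c y1 \<and> s < dist c y2" if "c \<in> \<Gamma>" for c using far that by auto
    fix c c' assume c: "c \<in> \<Gamma>" "c' \<in> \<Gamma>" "c \<noteq> c'" "dist c c' \<le> 2 * s"
    obtain B where B: "compact B" "connected B" "B \<subseteq> \<Gamma>" "c \<in> B" "c' \<in> B"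
      "\<And>z. z \<in> B \<Longrightarrow> \<bar>Im ((z - c) * cnj (c' - c))\<bar> \<le> (dist c c')\<^sup>2 / 2"
      using chord_arc[OF c(1-3)] c(4) assms by (metis order.trans)
    \<comment> \<open>The chord is the degenerate triangle with its apex at the midpoint, so
      \<open>chord_strip_outside\<close> applies.\<close>
    have hull: "convex hull {midpoint c c', c, c'} = closed_segment c c'"
      by (metis hull_redundant midpoint_in_closed_segment segment_convex_hull)
    have "y \<in> outside (B \<union> closed_segment c c')" if "y \<in> {y1, y2}" for y
    proof -
      have d: "dist c c' / 2 < dist y w" if "w \<in> B" for w
        using far[of w y] that \<open>y \<in> _\<close> B(3) c(4) by (force simp: dist_commute)
      have "y \<notin> closed_segment c c'"
      proof
        assume "y \<in> closed_segment c c'"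
        then have "dist c c' = dist c y + dist y c'" by (rule dist_add_closed_segment)
        then show False using d[OF B(4)] d[OF B(5)] by (simp add: dist_commute)
      qed
      then have "y \<in> outside (B \<union> convex hull {midpoint c c', c, c'})"
        using d hull c(3) B(6)
        by (intro chord_strip_outside) (auto simp: dist_midpoint less_imp_le)
      then show ?thesis by (simp add: hull)
    qed
    moreover have "connected (outside (B \<union> closed_segment c c'))"
      using B(1) by (intro connected_outside) (auto simp: compact_imp_bounded)
    moreover have "outside (B \<union> closed_segment c c') \<subseteq> - (B \<union> closed_segment c c')"
      using outside_no_overlap by blast
    ultimately have "connected_component (- (B \<union> closed_segment c c')) y1 y2"
      unfolding connected_component_def by blast
    then show "\<exists>B. compact B \<and> connected B \<and> B \<subseteq> \<Gamma> \<and> c \<in> B \<and> c' \<in> B \<and>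
         connected_component (- (B \<union> closed_segment c c')) y1 y2"
      using B by blast
  qed (use assms in auto)
  then obtain C where C: "connected C" "C \<subseteq> - {x. \<exists>c\<in>\<Gamma>. dist x c \<le> s}" "y1 \<in> C" "y2 \<in> C"
    unfolding connected_component_def by blast
  have "C \<inter> \<Gamma> = {}" using C(2) assms(1) by (force simp: subset_iff)
  then have "C \<subseteq> S" using connected_meets_side[OF C(1)] C(3) y by blast
  moreover have "s < infdist x \<Gamma>" if "x \<in> C" for x
  proof -
    obtain c where "c \<in> \<Gamma>" "infdist x \<Gamma> = dist x c"
      using infdist_attains_inf[OF closed_curve compact_curve(2)] by metis
    then show ?thesis using C(2) that by force
  qed
  ultimately show "connected_component {x \<in> S. s < infdist x \<Gamma>} y1 y2"
    unfolding connected_component_def using C by blast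
qed

end

section \<open>The frontier of a superlevel set of the distance as a minimal separator\<close>

locale offset_level = chordal_curve_side +
  fixes \<epsilon> :: real
  assumes eps: "0 < \<epsilon>" "2 * \<epsilon> \<le> r" and deep: "\<exists>q\<in>S. \<epsilon> < infdist q \<Gamma>"
begin

definition level :: "complex set" where "level = {x \<in> S. infdist x \<Gamma> = \<epsilon>}"
definition core :: "complex set" where "core = {x \<in> S. \<epsilon> < infdist x \<Gamma>}"

lemma eps_le: "\<epsilon> \<le> \<eta>" using eps r_le by simp

lemma foot:
  obtains c where "c \<in> \<Gamma>" "dist x c = infdist x \<Gamma>"
  using infdist_attains_inf[OF closed_curve compact_curve(2)] by metis

lemma infdist_segment_foot:
  assumes "c \<in> \<Gamma>" "dist x c \<le> \<epsilon>" "w \<in> closed_segment x c" "w \<noteq> x"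
  shows "infdist w \<Gamma> < \<epsilon>"
proof -
  have "dist x c = dist x w + dist w c" using assms(3) by (simp add: dist_add_closed_segment)
  moreover have "0 < dist x w" using assms(4) by simp
  ultimately show ?thesis using infdist_le[OF assms(1), of w] assms(2) by linarith
qed

lemma open_core: "open core"
proof -
  have "core = S \<inter> (\<lambda>x. infdist x \<Gamma>) -` {\<epsilon><..}" by (auto simp: core_def)
  then show ?thesis using side_props(1)
    by (simp add: continuous_on_infdist continuous_on_id open_Int open_vimage)
qed

lemma connected_core: "connected core"
  unfolding core_def using eps by (rule offset_connected)

lemma core_nonempty: "core \<noteq> {}" using deep by (auto simp: core_def)

lemma closed_upper: "closed {x \<in> S. \<epsilon> \<le> infdist x \<Gamma>}"
proof -
  have "{x \<in> S. \<epsilon> \<le> infdist x \<Gamma>} = closure S \<inter> (\<lambda>x. infdist x \<Gamma>) -` {\<epsilon>..}"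
    using eps by (auto simp: closure_side)
  then show ?thesis
    by (simp add: closed_Int closed_vimage continuous_on_infdist continuous_on_id)
qed

lemma closure_core_subset: "closure core \<subseteq> {x \<in> S. \<epsilon> \<le> infdist x \<Gamma>}"
  by (rule closure_minimal) (auto simp: core_def closed_upper)

lemma compact_level: "compact level"
proof -
  have "level = {x \<in> S. \<epsilon> \<le> infdist x \<Gamma>} \<inter> (\<lambda>x. infdist x \<Gamma>) -` {..\<epsilon>}"
    by (auto simp: level_def)
  moreover have "compact {x. infdist x \<Gamma> \<le> \<epsilon>}"
    using compact_infdist_le[OF compact_curve(2,1) eps(1)] .
  moreover have "(\<lambda>x. infdist x \<Gamma>) -` {..\<epsilon>} = {x. infdist x \<Gamma> \<le> \<epsilon>}" by auto
  ultimately show ?thesis using closed_upper by (simp add: closed_Int_compact)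
qed

lemma frontier_core_level: "frontier core \<subseteq> level"
proof
  fix x assume "x \<in> frontier core"
  then have "x \<in> closure core" "x \<notin> core" using open_core by (simp_all add: frontier_def interior_open)
  then have "x \<in> {x \<in> S. \<epsilon> \<le> infdist x \<Gamma>}" "x \<notin> core" using closure_core_subset by blast+
  then have "x \<in> S" "infdist x \<Gamma> = \<epsilon>" unfolding core_def by auto
  then show "x \<in> level" unfolding level_def by blast
qed

lemma level_foot_segment:
  assumes "x \<in> S" "infdist x \<Gamma> \<le> \<epsilon>" "c \<in> \<Gamma>" "dist x c = infdist x \<Gamma>"
  shows "closed_segment x c - {x} \<subseteq> - closure core"
proof
  fix w assume "w \<in> closed_segment x c - {x}"
  then have "infdist w \<Gamma> < \<epsilon>" using infdist_segment_foot[of c x w] assms by simp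
  then show "w \<in> - closure core" using closure_core_subset by auto
qed

text \<open>A point of \<open>S\<close> outside \<open>closure core\<close> is at distance at most
  \<epsilon> from \<Gamma>, and the segment to its foot avoids \<open>closure core\<close>. All
  these segments are attached to the connected set \<open>S' \<union> \<Gamma>\<close>.\<close>

lemma connected_outer: "connected (- closure core)"
proof -
  define A where "A = S' \<union> \<Gamma>"
  have "connected A"
    unfolding A_def using closure_side(2) side_props(4) connected_intermediate_closure[of S' "S' \<union> \<Gamma>"] by blast
  have A: "A \<subseteq> - closure core" "A \<noteq> {}"
    using closure_core_subset side_props(5,6) compact_curve(2) unfolding A_def by blast+
  have "\<exists>T. connected T \<and> T \<subseteq> - closure core \<and> x \<in> T \<and> T \<inter> A \<noteq> {}" if x: "x \<in> - closure core" for x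
  proof (cases "x \<in> A")
    case True then show ?thesis using \<open>connected A\<close> A by blast
  next
    case False
    then have "x \<in> S" using side_props(6) by (auto simp: A_def)
    have le: "infdist x \<Gamma> \<le> \<epsilon>"
      using x \<open>x \<in> S\<close> closure_subset[of core] by (auto simp: core_def not_less)
    obtain c where c: "c \<in> \<Gamma>" "dist x c = infdist x \<Gamma>" by (rule foot)
    have "closed_segment x c \<subseteq> - closure core"
      using level_foot_segment[OF \<open>x \<in> S\<close> le c] x by blast
    then show ?thesis using c(1) by (intro exI[of _ "closed_segment x c"]) (auto simp: A_def)
  qed
  then obtain T where T: "\<And>x. x \<in> - closure core \<Longrightarrow> connected (T x) \<and> T x \<subseteq> - closure core \<and> x \<in> T x \<and> T x \<inter> A \<noteq> {}"
    by metis
  have "- closure core = A \<union> (\<Union>x\<in>- closure core. T x \<union> A)"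
    using T A by blast
  also have "\<dots> = \<Union>(insert A ((\<lambda>x. T x \<union> A) ` (- closure core)))" by blast
  also have "connected \<dots>"
  proof (rule connected_Union)
    show "connected X" if "X \<in> insert A ((\<lambda>x. T x \<union> A) ` (- closure core))" for X
      using that T \<open>connected A\<close> connected_Un by blast
    show "\<Inter> (insert A ((\<lambda>x. T x \<union> A) ` (- closure core))) \<noteq> {}" using A(2) by blast
  qed
  finally show ?thesis .
qed

text \<open>Moving from a frontier point towards a foot makes the distance smaller than \<epsilon>
  at once.\<close>

lemma frontier_core_closure_outer: "frontier core \<subseteq> closure (- closure core)"
proof
  fix x assume "x \<in> frontier core"
  then have x: "x \<in> S" "infdist x \<Gamma> = \<epsilon>" using frontier_core_level by (auto simp: level_def)
  obtain c where c: "c \<in> \<Gamma>" "dist x c = infdist x \<Gamma>" by (rule foot)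
  have "x \<noteq> c" using c x eps by auto
  have "x \<in> closure (open_segment x c)" using \<open>x \<noteq> c\<close> by (simp add: closure_open_segment)
  moreover have "open_segment x c \<subseteq> - closure core"
    using level_foot_segment[OF x(1) _ c] x(2) by (auto simp: open_segment_def)
  ultimately show "x \<in> closure (- closure core)" using closure_mono by blast
qed

text \<open>Every frontier point adheres to both complementary regions, which are connected, so one
  frontier point missing from \<open>A\<close> joins them.\<close>

lemma frontier_core_irreducible:
  assumes "closed A" "A \<subset> frontier core"
  shows "connected (- A)"
proof -
  obtain m where m: "m \<in> frontier core" "m \<notin> A" using assms(2) by blast
  define D where "D = frontier core - A"
  have "frontier core \<subseteq> closure core" by (simp add: frontier_def)
  then have "core \<union> D \<subseteq> closure core" "- closure core \<union> D \<subseteq> closure (- closure core)"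
    using frontier_core_closure_outer closure_subset[of core] closure_subset[of "- closure core"]
    unfolding D_def by blast+
  then have "connected (core \<union> D)" "connected (- closure core \<union> D)"
    using connected_intermediate_closure[OF connected_core] connected_intermediate_closure[OF connected_outer]
    by blast+
  moreover have "(core \<union> D) \<inter> (- closure core \<union> D) \<noteq> {}" using m by (auto simp: D_def)
  ultimately have "connected ((core \<union> D) \<union> (- closure core \<union> D))" by (rule connected_Un)
  moreover have "(core \<union> D) \<union> (- closure core \<union> D) = - A"
    using assms(2) open_core by (auto simp: D_def frontier_def interior_open)
  ultimately show ?thesis by simp
qed

lemma frontier_core_separates: "\<not> connected (- frontier core)"
proof
  assume c: "connected (- frontier core)"
  have eq: "- frontier core = core \<union> - closure core"
    using open_core closure_subset[of core] by (auto simp: frontier_def interior_open)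
  have "\<Gamma> \<subseteq> - closure core" using closure_core_subset side_props(6) by blast
  then have "- closure core \<noteq> {}" using compact_curve by blast
  then show False
    using connectedD[OF c open_core, of "- closure core"] core_nonempty closure_subset[of core]
    unfolding eq by auto
qed

text \<open>\<open>M\<close> is a Jordan curve that is both open and closed in \<open>level\<close>.
  If \<open>level - M\<close> were nonempty, a connected set
  \<open>{x \<in> S. s < infdist x \<Gamma>}\<close> with \<open>s < \<epsilon>\<close> would
  contain it and \<open>core\<close>, but would miss a contour lying between them.\<close>

theorem level_jordan_curve_from_charts:
  assumes chart: "\<And>x. x \<in> level \<Longrightarrow> line_chart_at level x"
  shows "jordan_curve level"
proof -
  define M where "M = frontier core"
  have Mlev: "M \<subseteq> level" unfolding M_def by (rule frontier_core_level)
  have "M = level \<inter> frontier core" using Mlev unfolding M_def by blast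
  then have "compact M" using compact_Int_closed[OF compact_level frontier_closed] by metis
  then have irr: "irreducible_separator M"
    unfolding irreducible_separator_def M_def using frontier_core_separates frontier_core_irreducible by blast
  have chartM: "line_chart_at M x" if "x \<in> M" for x
  proof -
    have "M \<inter> cball x \<rho> \<subseteq> level \<inter> cball x \<rho>" for \<rho> using Mlev by blast
    then show ?thesis
      using chart[of x] that Mlev continuous_on_subset inj_on_subset unfolding line_chart_at_def by (meson subsetD)
  qed
  obtain g where g: "simple_path g" "pathfinish g = pathstart g" "path_image g = M"
    using irreducible_separator_simple_closed_curve[OF irr chartM] by metis
  have "openin (top_of_set level) M"
    using irreducible_separator_openin[OF irr Mlev] chart Mlev by (meson subsetD)
  then have "closedin (top_of_set level) (level - M)" by (simp add: closedin_diff)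
  then have cR: "compact (level - M)" using compact_level closedin_compact by blast
  have "level - M = {}"
  proof (rule ccontr)
    assume "level - M \<noteq> {}"
    then obtain k where k: "k \<in> level - M" by blast
    have cc: "closure core = core \<union> M"
      using open_core closure_subset[of core] by (auto simp: M_def frontier_def interior_open)
    have disj: "(level - M) \<inter> closure core = {}" unfolding cc by (auto simp: level_def core_def)
    obtain d where d: "d > 0" "\<And>x y. x \<in> level - M \<Longrightarrow> y \<in> closure core \<Longrightarrow> d \<le> dist x y"
      using separate_compact_closed[OF cR closed_closure disj] by blast
    have dc: "d \<le> infdist y (level - M)" if "y \<in> closure core" for y
      using infdist_attains_inf[OF compact_imp_closed[OF cR] \<open>level - M \<noteq> {}\<close>, of y] d(2)[OF _ that]
      by (metis dist_commute)
    \<comment> \<open>This contour avoids \<open>core\<close> and \<open>level\<close>, so its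
      points are nearer to \<Gamma> than \<epsilon>; compactness then yields a bound
      \<open>s\<close> below \<epsilon>.\<close>
    define F where "F = closure S \<inter> {y. infdist y (level - M) = d / 2}"
    have "compact F"
    proof -
      have "F = {y. infdist y (level - M) \<le> d / 2} \<inter> (closure S \<inter> {y. d / 2 \<le> infdist y (level - M)})"
        by (auto simp: F_def)
      moreover have "compact {y. infdist y (level - M) \<le> d / 2}"
        using compact_infdist_le[OF \<open>level - M \<noteq> {}\<close> cR, of "d / 2"] d(1) by simp
      moreover have "closed (closure S \<inter> {y. d / 2 \<le> infdist y (level - M)})"
        by (intro closed_Int closed_closure closed_Collect_le continuous_intros)
      ultimately show ?thesis using compact_Int_closed by metis
    qed
    have lt: "infdist y \<Gamma> < \<epsilon>" if "y \<in> F" for y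
    proof (rule ccontr)
      assume "\<not> infdist y \<Gamma> < \<epsilon>"
      then have ge: "\<epsilon> \<le> infdist y \<Gamma>" by simp
      then have "y \<in> S" using that eps by (auto simp: F_def closure_side)
      then have "y \<in> core \<union> level" using ge by (auto simp: core_def level_def)
      then have "y \<in> closure core \<or> y \<in> level - M" using cc by blast
      then show False using that dc[of y] d(1) by (auto simp: F_def)
    qed
    obtain s where s: "0 < s" "s < \<epsilon>" "\<And>y. y \<in> F \<Longrightarrow> infdist y \<Gamma> \<le> s"
    proof (cases "F = {}")
      case True then show ?thesis using that[of "\<epsilon> / 2"] eps by auto
    next
      case False
      have "continuous_on F (\<lambda>x. infdist x \<Gamma>)" by (intro continuous_on_infdist continuous_on_id)
      then obtain y0 where y0: "y0 \<in> F" "\<And>y. y \<in> F \<Longrightarrow> infdist y \<Gamma> \<le> infdist y0 \<Gamma>"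
        using continuous_attains_sup[OF \<open>compact F\<close> False] by blast
      show ?thesis using that[of "max (infdist y0 \<Gamma>) (\<epsilon> / 2)"] eps lt[OF y0(1)] y0(2) by fastforce
    qed
    define C where "C = {x \<in> S. s < infdist x \<Gamma>}"
    have "connected C" unfolding C_def using s eps by (intro offset_connected) auto
    then have I: "connected ((\<lambda>y. infdist y (level - M)) ` C)"
      by (intro connected_continuous_image continuous_on_infdist continuous_on_id)
    have "k \<in> C" using k s by (auto simp: C_def level_def)
    moreover have "infdist k (level - M) = 0" using k by simp
    ultimately have 0: "0 \<in> (\<lambda>y. infdist y (level - M)) ` C" by (metis imageI)
    obtain q where "q \<in> core" using core_nonempty by blast
    then have "q \<in> C" "d \<le> infdist q (level - M)"
      using s dc closure_subset[of core] by (auto simp: C_def core_def)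
    then have "infdist q (level - M) \<in> (\<lambda>y. infdist y (level - M)) ` C" "d / 2 \<le> infdist q (level - M)"
      using d(1) by auto
    then have "d / 2 \<in> (\<lambda>y. infdist y (level - M)) ` C"
      using connectedD_interval[OF I 0, of "infdist q (level - M)" "d / 2"] d(1) by simp
    then obtain y where "y \<in> C" "infdist y (level - M) = d / 2" by auto
    then show False using s(3)[of y] closure_subset[of S] by (auto simp: C_def F_def)
  qed
  then have "level = M" using Mlev by blast
  then show ?thesis using g unfolding jordan_curve_def by blast
qed

end

subsection \<open>Feet of level points\<close>

lemma closed_segment_same_length:
  fixes x a c w :: "'a::euclidean_space"
  assumes "w \<in> closed_segment x a" "w \<in> closed_segment x c" "dist x a = d" "dist x c = d" "w \<noteq> x"
  shows "a = c"
proof -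
  obtain u where u: "w = (1 - u) *\<^sub>R x + u *\<^sub>R a" "0 \<le> u" using assms(1) by (auto simp: in_segment)
  obtain v where v: "w = (1 - v) *\<^sub>R x + v *\<^sub>R c" "0 \<le> v" using assms(2) by (auto simp: in_segment)
  have ua: "w - x = u *\<^sub>R (a - x)" using u(1) by (simp add: algebra_simps)
  have vc: "w - x = v *\<^sub>R (c - x)" using v(1) by (simp add: algebra_simps)
  have "norm (w - x) = u * d"
    unfolding ua using u(2) assms(3) by (simp add: dist_norm norm_minus_commute)
  moreover have "norm (w - x) = v * d"
    unfolding vc using v(2) assms(4) by (simp add: dist_norm norm_minus_commute)
  moreover have "norm (w - x) \<noteq> 0" using assms(5) by simp
  ultimately have "u = v" "u \<noteq> 0" by auto
  then have "u *\<^sub>R (a - x) = u *\<^sub>R (c - x)" using ua vc by simp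
  then show ?thesis using \<open>u \<noteq> 0\<close> by simp
qed

text \<open>Two points with the same coordinate orthogonal to \<open>v\<close> differ by a multiple
  of \<open>v\<close>. Going back from the forward one along \<open>- v\<close> first approaches its
  foot, because of the positive inner product; the other point, being close, would be nearer to that
  foot than \<epsilon>.\<close>

lemma graph_injective:
  fixes v :: complex
  assumes foot: "\<And>z. z \<in> X \<Longrightarrow> \<exists>c. dist z c = \<epsilon> \<and> (\<forall>y\<in>X. \<epsilon> \<le> dist y c) \<and> \<kappa> \<le> inner v (z - c)"
    and small: "\<And>y z. y \<in> X \<Longrightarrow> z \<in> X \<Longrightarrow> dist y z * norm v < 2 * \<kappa>"
    and "z \<in> X" "z' \<in> X" "inner (\<i> * v) z = inner (\<i> * v) z'"
  shows "z = z'"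
proof (rule ccontr)
  assume "z \<noteq> z'"
  have "v \<noteq> 0"
  proof
    assume "v = 0"
    then show False using foot[OF \<open>z \<in> X\<close>] small[OF \<open>z \<in> X\<close> \<open>z \<in> X\<close>] by auto
  qed
  have main: False if z: "z \<in> X" "z' \<in> X" and s: "z' = z + complex_of_real s * v" "0 < s" for z z' s
  proof -
    obtain c where c: "dist z' c = \<epsilon>" "\<epsilon> \<le> dist z c" "\<kappa> \<le> inner v (z' - c)"
      using foot[OF z(2)] z(1) by blast
    define q where "q = z' - c"
    have zc: "z - c = q - s *\<^sub>R v" using s by (simp add: q_def scaleR_conv_of_real)
    have "(norm (z - c))\<^sup>2 = (norm (z' - c))\<^sup>2 - 2 * s * inner v (z' - c) + s\<^sup>2 * (norm v)\<^sup>2"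
      unfolding zc q_def[symmetric] power2_norm_eq_inner
      by (simp add: inner_diff_left inner_diff_right inner_commute power2_eq_square algebra_simps)
    moreover have "(norm (z' - c))\<^sup>2 \<le> (norm (z - c))\<^sup>2"
      using c by (intro power_mono) (auto simp: dist_norm)
    ultimately have "2 * s * inner v (z' - c) \<le> s\<^sup>2 * (norm v)\<^sup>2" by linarith
    moreover have "2 * s * \<kappa> \<le> 2 * s * inner v (z' - c)" using c(3) s(2) by simp
    ultimately have "s * (2 * \<kappa>) \<le> s * (s * (norm v)\<^sup>2)" by (simp add: power2_eq_square)
    then have "2 * \<kappa> \<le> s * (norm v)\<^sup>2" using s(2) by simp
    moreover have "dist z z' = s * norm v" using s by (simp add: dist_norm norm_mult)
    ultimately show False using small[OF z] by (simp add: power2_eq_square)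
  qed
  define s where "s = Re ((z' - z) * cnj v) / (norm v)\<^sup>2"
  have "Im ((z' - z) * cnj v) = 0" using assms(5) by (simp add: inner_complex_def algebra_simps)
  then have "z' - z = complex_of_real s * v"
    unfolding s_def by (rule real_multiple_if_Im_zero[OF \<open>v \<noteq> 0\<close>])
  then have s: "z' = z + complex_of_real s * v" "z = z' + complex_of_real (- s) * v"
    by (simp_all add: algebra_simps)
  have "s \<noteq> 0" using s(1) \<open>z \<noteq> z'\<close> by auto
  then show False
    using main[OF assms(3,4) s(1)] main[OF assms(4,3) s(2)] by linarith
qed

text \<open>The perturbations leave at least 1/2 - 1/16 - 1/8 = 5/16 of the squared norm.\<close>

lemma inner_foot_lower:
  fixes v x p z c :: complex
  assumes "inner v (x - p) = (norm v)\<^sup>2 / 2" "dist z x \<le> norm v / 16" "dist c p \<le> norm v / 8"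
  shows "(norm v)\<^sup>2 / 4 \<le> inner v (z - c)"
proof -
  have "inner v (z - c) = inner v (x - p) + inner v (z - x) - inner v (c - p)"
    by (simp add: inner_diff_right)
  moreover have "norm v * norm (z - x) \<le> norm v * (norm v / 16)" "norm v * norm (c - p) \<le> norm v * (norm v / 8)"
    using assms(2,3) by (intro mult_left_mono; simp add: dist_norm)+
  then have "\<bar>inner v (z - x)\<bar> \<le> (norm v)\<^sup>2 / 16" "\<bar>inner v (c - p)\<bar> \<le> (norm v)\<^sup>2 / 8"
    using Cauchy_Schwarz_ineq2[of v "z - x"] Cauchy_Schwarz_ineq2[of v "c - p"]
    by (simp_all add: power2_eq_square)
  ultimately show ?thesis using assms(1) zero_le_power2[of "norm v"] unfolding abs_le_iff by linarith
qed

lemma near_feet_injective: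
  fixes v x :: complex
  assumes "v \<noteq> 0" and near: "\<And>z. z \<in> X \<Longrightarrow> dist z x \<le> norm v / 16"
    and foot: "\<And>z. z \<in> X \<Longrightarrow> \<exists>c p. dist z c = \<epsilon> \<and> (\<forall>y\<in>X. \<epsilon> \<le> dist y c) \<and> dist c p \<le> norm v / 8 \<and>
       inner v (x - p) = (norm v)\<^sup>2 / 2"
  shows "inj_on (\<lambda>z. inner (\<i> * v) z) X"
proof (rule inj_onI, rule graph_injective[where X = X and \<epsilon> = \<epsilon> and v = v and \<kappa> = "(norm v)\<^sup>2 / 4"])
  show "\<exists>c. dist z c = \<epsilon> \<and> (\<forall>y\<in>X. \<epsilon> \<le> dist y c) \<and> (norm v)\<^sup>2 / 4 \<le> inner v (z - c)" if "z \<in> X" for z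
    using foot[OF that] inner_foot_lower[OF _ near[OF that]] by blast
  fix y z assume "y \<in> X" "z \<in> X"
  then have "dist y z \<le> norm v / 8"
    using dist_triangle[of y z x] near[of y] near[of z] by (simp add: dist_commute)
  then have "dist y z * norm v \<le> norm v / 8 * norm v" by (intro mult_right_mono) auto
  also have "\<dots> < 2 * ((norm v)\<^sup>2 / 4)" using \<open>v \<noteq> 0\<close> by (simp add: power2_eq_square)
  finally show "dist y z * norm v < 2 * ((norm v)\<^sup>2 / 4)" .
qed auto

section \<open>Cells: the arc between two feet closed up by the segments to the level point\<close>

context offset_level
begin

lemma level_foot:
  assumes "x \<in> level"
  obtains c where "c \<in> \<Gamma>" "dist x c = \<epsilon>"
proof -
  obtain c where "c \<in> \<Gamma>" "dist x c = infdist x \<Gamma>" by (rule foot)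
  then show thesis using that assms by (simp add: level_def)
qed

lemma level_le_dist: "x \<in> level \<Longrightarrow> c \<in> \<Gamma> \<Longrightarrow> \<epsilon> \<le> dist x c"
  using infdist_le[of c \<Gamma> x] by (simp add: level_def)

text \<open>At a crossing point \<open>w\<close>, exchanging the feet cannot shorten either distance
  below \<epsilon>, so the triangle inequalities are equalities. Then \<open>w\<close> also lies on
  the segment from \<open>x\<close> to \<open>c\<close>, and two segments of equal length from
  \<open>x\<close> through \<open>w\<close> have the same end.\<close>

lemma foot_segments_disjoint:
  assumes "x \<in> level" "y \<in> level" "x \<noteq> y" "a \<in> \<Gamma>" "c \<in> \<Gamma>" "dist x a = \<epsilon>" "dist y c = \<epsilon>" "a \<noteq> c"
  shows "closed_segment x a \<inter> closed_segment y c = {}"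
proof (rule ccontr)
  assume "\<not> ?thesis"
  then obtain w where w: "w \<in> closed_segment x a" "w \<in> closed_segment y c" by blast
  have d: "dist x a = dist x w + dist w a" "dist y c = dist y w + dist w c"
    using w by (simp_all add: dist_add_closed_segment)
  have le: "\<epsilon> \<le> dist x c" "\<epsilon> \<le> dist y a" using level_le_dist assms by auto
  have tr: "dist x c \<le> dist x w + dist w c" "dist y a \<le> dist y w + dist w a" by (rule dist_triangle)+
  have eq: "dist w a = dist w c" "dist x w = dist y w" "dist x c = dist x w + dist w c" "dist x c = \<epsilon>"
    using d le tr assms(6,7) by linarith+
  have "w \<noteq> x" using eq(2) assms(3) by auto
  have "w \<in> closed_segment x c" using eq(3) by (simp add: between between_mem_segment[symmetric])
  then show False
    using closed_segment_same_length[OF w(1) _ assms(6) eq(4) \<open>w \<noteq> x\<close>] assms(8) by blast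
qed

lemma segment_foot_side:
  assumes "y \<in> level" "c \<in> \<Gamma>" "dist y c = \<epsilon>"
  shows "closed_segment y c - {c} \<subseteq> S"
proof -
  have "w \<notin> \<Gamma>" if "w \<in> closed_segment y c" "w \<noteq> c" for w
  proof
    assume "w \<in> \<Gamma>"
    then have "\<epsilon> \<le> dist y w" using level_le_dist assms by blast
    moreover have "dist y c = dist y w + dist w c" using that by (simp add: dist_add_closed_segment)
    ultimately show False using that assms by simp
  qed
  then have disj: "(closed_segment y c - {c}) \<inter> \<Gamma> = {}" by blast
  have "y \<noteq> c" using assms eps by auto
  then have "closed_segment y c - {c} = (\<lambda>t. (1 - t) *\<^sub>R y + t *\<^sub>R c) ` {0..<1}"
    by (auto simp: closed_segment_image_interval image_iff algebra_simps)
  moreover have "connected ((\<lambda>t. (1 - t) *\<^sub>R y + t *\<^sub>R c) ` {0..<1})"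
    by (intro connected_continuous_image continuous_intros) auto
  ultimately have "connected (closed_segment y c - {c})" by simp
  moreover have "y \<noteq> c" using assms eps by auto
  ultimately show ?thesis
    using connected_meets_side[OF _ disj] assms(1) by (auto simp: level_def)
qed

text \<open>The distance of the base point from \<open>x\<close> guarantees that
  \<open>small_arc\<close> applies to the interval from \<open>\<alpha>\<close> to
  \<open>\<beta>\<close>, so the cell is closed off by the small arc of \<Gamma>.\<close>

definition cell :: "(real \<Rightarrow> complex) \<Rightarrow> real \<Rightarrow> real \<Rightarrow> complex \<Rightarrow> bool" where
  "cell g \<alpha> \<beta> x \<longleftrightarrow> simple_path g \<and> pathfinish g = pathstart g \<and> path_image g = \<Gamma> \<and>
     0 < \<alpha> \<and> \<alpha> < \<beta> \<and> \<beta> < 1 \<and> x \<in> level \<and> dist x (g \<alpha>) = \<epsilon> \<and> dist x (g \<beta>) = \<epsilon> \<and> 3 * \<eta> < dist (g 0) x"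

definition cell_curve :: "(real \<Rightarrow> complex) \<Rightarrow> real \<Rightarrow> real \<Rightarrow> complex \<Rightarrow> complex set" where
  "cell_curve g \<alpha> \<beta> x = g ` {\<alpha>..\<beta>} \<union> (closed_segment (g \<beta>) x \<union> closed_segment x (g \<alpha>))"

lemma cell_arc:
  assumes "cell g \<alpha> \<beta> x"
  shows "g \<alpha> \<noteq> g \<beta>" "g ` {\<alpha>..\<beta>} \<subseteq> \<Gamma>" "connected (g ` {\<alpha>..\<beta>})" "g ` {\<alpha>..\<beta>} \<subseteq> cball x (2 * \<eta>)"
    "\<And>z. z \<in> g ` {\<alpha>..\<beta>} \<Longrightarrow> \<bar>Im ((z - g \<alpha>) * cnj (g \<beta> - g \<alpha>))\<bar> \<le> (dist (g \<alpha>) (g \<beta>))\<^sup>2 / 2"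
    "dist (g \<alpha>) (g \<beta>) \<le> 2 * \<epsilon>" "2 * \<eta> < dist (g 0) (g \<alpha>)"
proof -
  note c = assms[unfolded cell_def]
  have g: "simple_path g" "pathfinish g = pathstart g" "path_image g = \<Gamma>" using c by blast+
  have p: "0 < \<alpha>" "\<alpha> < \<beta>" "\<beta> < 1" using c by blast+
  then have "\<alpha> \<in> {0<..<1}" "\<beta> \<in> {0<..<1}" "\<alpha> \<noteq> \<beta>" by auto
  then show "g \<alpha> \<noteq> g \<beta>" using simple_path_inj_on[OF g(1)] inj_onD by metis
  have sub: "{\<alpha>..\<beta>} \<subseteq> {0..1}" using p by auto
  then show "g ` {\<alpha>..\<beta>} \<subseteq> \<Gamma>" using g(3) unfolding path_image_def by blast
  have "continuous_on {\<alpha>..\<beta>} g"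
    by (rule continuous_on_subset[OF _ sub]) (use g(1) in \<open>simp add: simple_path_def path_def\<close>)
  then show "connected (g ` {\<alpha>..\<beta>})" by (intro connected_continuous_image) auto
  show d: "dist (g \<alpha>) (g \<beta>) \<le> 2 * \<epsilon>"
    using c dist_triangle[of "g \<alpha>" "g \<beta>" x] by (simp add: dist_commute[of _ x])
  have "dist x (g \<alpha>) = \<epsilon>" "3 * \<eta> < dist (g 0) x" using c by blast+
  then show far: "2 * \<eta> < dist (g 0) (g \<alpha>)"
    using dist_triangle[of "g 0" x "g \<alpha>"] eps_le unfolding dist_commute[of "g \<alpha>" x] by linarith
  have sa: "g ` {\<alpha>..\<beta>} \<subseteq> cball (g \<alpha>) \<eta> \<and>
      (\<forall>z\<in>g ` {\<alpha>..\<beta>}. \<bar>Im ((z - g \<alpha>) * cnj (g \<beta> - g \<alpha>))\<bar> \<le> (dist (g \<alpha>) (g \<beta>))\<^sup>2 / 2)"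
  proof (rule small_arc[OF g])
    show "dist (g \<alpha>) (g \<beta>) \<le> r" using d eps by linarith
    show "\<eta> < dist (g 0) (g \<alpha>)" using far eta_pos by linarith
  qed (use c in blast)+
  then show "\<And>z. z \<in> g ` {\<alpha>..\<beta>} \<Longrightarrow> \<bar>Im ((z - g \<alpha>) * cnj (g \<beta> - g \<alpha>))\<bar> \<le> (dist (g \<alpha>) (g \<beta>))\<^sup>2 / 2"
    by blast
  show "g ` {\<alpha>..\<beta>} \<subseteq> cball x (2 * \<eta>)"
  proof
    fix w assume "w \<in> g ` {\<alpha>..\<beta>}"
    then have "dist (g \<alpha>) w \<le> \<eta>" using sa by auto
    then show "w \<in> cball x (2 * \<eta>)"
      using dist_triangle[of x w "g \<alpha>"] \<open>dist x (g \<alpha>) = \<epsilon>\<close> eps_le by simp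
  qed
qed

text \<open>The triangle over the chord contains both foot segments, so
  \<open>closer_to_equidistant_imp_outside\<close> gives more than is claimed. Its hypothesis on the
  halves comes from \<open>small_arc\<close> for the two subintervals at the parameter of
  \<open>p\<close>.\<close>

lemma level_outside_cell:
  assumes cell: "cell g \<alpha> \<beta> x" and z: "z \<in> level" "z \<noteq> x"
  shows "z \<in> outside (cell_curve g \<alpha> \<beta> x)"
proof -
  note c = cell[unfolded cell_def]
  note ca = cell_arc[OF cell]
  define B where "B = g ` {\<alpha>..\<beta>}"
  have "z \<in> outside (B \<union> convex hull {x, g \<alpha>, g \<beta>})"
  proof (rule closer_to_equidistant_imp_outside[of "g \<alpha>" "g \<beta>" x \<epsilon> B])
    show "g \<alpha> \<in> B" "g \<beta> \<in> B" using c by (auto simp: B_def)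
    fix p l assume p: "p \<in> B" "p \<noteq> g \<alpha>" "p \<noteq> g \<beta>" "dist (g \<alpha>) p \<le> dist (g \<alpha>) (g \<beta>)"
       "dist p (g \<beta>) \<le> dist (g \<alpha>) (g \<beta>)" "l \<in> B"
    then obtain \<gamma> t where \<gamma>: "p = g \<gamma>" "\<gamma> \<in> {\<alpha>..\<beta>}" "l = g t" "t \<in> {\<alpha>..\<beta>}" by (auto simp: B_def)
    have "\<gamma> \<noteq> \<alpha>" "\<gamma> \<noteq> \<beta>" using p \<gamma>(1) by auto
    then have g2: "\<alpha> < \<gamma>" "\<gamma> < \<beta>" using \<gamma>(2) by auto
    have r: "dist (g \<alpha>) (g \<gamma>) \<le> r" "dist (g \<gamma>) (g \<beta>) \<le> r" using p ca(6) eps \<gamma>(1) by auto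
    have "dist x (g \<alpha>) = \<epsilon>" "3 * \<eta> < dist (g 0) x" using c by blast+
    then have "\<eta> < dist (g 0) (g \<gamma>)"
      using dist_triangle[of "g 0" x "g \<gamma>"] dist_triangle[of x "g \<gamma>" "g \<alpha>"] r(1) r_le eps_le eps eta_pos
        dist_commute[of "g \<gamma>" x]
      by linarith
    then have 1: "\<forall>z\<in>g ` {\<alpha>..\<gamma>}. \<bar>Im ((z - g \<alpha>) * cnj (g \<gamma> - g \<alpha>))\<bar> \<le> (dist (g \<alpha>) (g \<gamma>))\<^sup>2 / 2"
      and 2: "\<forall>z\<in>g ` {\<gamma>..\<beta>}. \<bar>Im ((z - g \<gamma>) * cnj (g \<beta> - g \<gamma>))\<bar> \<le> (dist (g \<gamma>) (g \<beta>))\<^sup>2 / 2"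
      using small_arc[of g \<alpha> \<gamma>] small_arc[of g \<gamma> \<beta>] c g2 r ca(7) eta_pos by simp_all
    have "t \<in> {\<alpha>..\<gamma>} \<or> t \<in> {\<gamma>..\<beta>}" using \<gamma>(4) by auto
    then show "\<bar>Im ((l - g \<alpha>) * cnj (p - g \<alpha>))\<bar> \<le> (dist (g \<alpha>) p)\<^sup>2 / 2 \<or>
       \<bar>Im ((l - p) * cnj (g \<beta> - p))\<bar> \<le> (dist p (g \<beta>))\<^sup>2 / 2"
      using 1 2 \<gamma>(1,3) by blast
  qed (use c ca z level_le_dist in \<open>auto simp: B_def\<close>)
  moreover have "closed_segment (g \<beta>) x \<subseteq> convex hull {x, g \<alpha>, g \<beta>}" "closed_segment x (g \<alpha>) \<subseteq> convex hull {x, g \<alpha>, g \<beta>}"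
    unfolding segment_convex_hull by (intro hull_mono; simp)+
  then have "cell_curve g \<alpha> \<beta> x \<subseteq> B \<union> convex hull {x, g \<alpha>, g \<beta>}"
    unfolding cell_curve_def B_def by blast
  ultimately show ?thesis using outside_mono by blast
qed

end

lemma simple_path_eq_interior:
  assumes "simple_path g" "g s = g t" "s \<in> {0..1}" "t \<in> {0<..<1}"
  shows "s = t"
proof -
  have "t \<in> {0..1}" using assms(4) by auto
  then have "s = t \<or> s = 0 \<and> t = 1 \<or> s = 1 \<and> t = 0"
    using assms(1-3) unfolding simple_path_def loop_free_def by blast
  then show ?thesis using assms(4) by auto
qed

section \<open>Feet of other level points avoid the arc of a cell\<close>

context offset_level
begin

text \<open>The foot segments meet \<Gamma> only at the feet and each other only at
  \<open>x\<close>, which makes the boundary of the cell a simple closed curve.\<close>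

lemma cell_return_path:
  assumes cell: "cell g \<alpha> \<beta> x"
  defines "p1 \<equiv> subpath \<alpha> \<beta> g" and "p2 \<equiv> linepath (g \<beta>) x +++ linepath x (g \<alpha>)"
  shows "arc p1" "arc p2" "simple_path (p1 +++ p2)" "pathfinish (p1 +++ p2) = pathstart (p1 +++ p2)"
    "path_image (p1 +++ p2) = cell_curve g \<alpha> \<beta> x"
    "pathstart p1 = g \<alpha>" "pathfinish p1 = g \<beta>" "pathstart p2 = g \<beta>" "pathfinish p2 = g \<alpha>"
    "path_image p1 = g ` {\<alpha>..\<beta>}"
    "path_image p2 = closed_segment (g \<beta>) x \<union> closed_segment x (g \<alpha>)"
    "path_image p2 \<subseteq> insert (g \<alpha>) (insert (g \<beta>) S)"
proof -
  note c = cell[unfolded cell_def]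
  have g: "simple_path g" "pathfinish g = pathstart g" "path_image g = \<Gamma>" using c by blast+
  have p: "0 < \<alpha>" "\<alpha> < \<beta>" "\<beta> < 1" and x: "x \<in> level" "dist x (g \<alpha>) = \<epsilon>" "dist x (g \<beta>) = \<epsilon>"
    using c by blast+
  note ca = cell_arc[OF cell]
  have ab: "g \<alpha> \<in> \<Gamma>" "g \<beta> \<in> \<Gamma>" using ca(2) p by auto
  have ne: "g \<alpha> \<noteq> x" "g \<beta> \<noteq> x" using x eps by auto
  show a1: "arc p1" unfolding p1_def using g(1) p ca(1) by (intro arc_simple_path_subpath) auto
  show im1: "path_image p1 = g ` {\<alpha>..\<beta>}" using p by (simp add: p1_def path_image_subpath)
  show im2: "path_image p2 = closed_segment (g \<beta>) x \<union> closed_segment x (g \<alpha>)"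
    by (simp add: p2_def path_image_join)
  show e: "pathstart p1 = g \<alpha>" "pathfinish p1 = g \<beta>" "pathstart p2 = g \<beta>" "pathfinish p2 = g \<alpha>"
    by (simp_all add: p1_def p2_def)
  have "w = x" if "w \<in> closed_segment (g \<beta>) x" "w \<in> closed_segment x (g \<alpha>)" for w
    using closed_segment_same_length[of w x "g \<alpha>" "g \<beta>" \<epsilon>] that x ca(1) by (auto simp: closed_segment_commute)
  then show a2: "arc p2" unfolding p2_def using ne by (intro arc_join) auto
  have "closed_segment x (g \<alpha>) - {g \<alpha>} \<subseteq> S" "closed_segment x (g \<beta>) - {g \<beta>} \<subseteq> S"
    using segment_foot_side[OF x(1)] ab x by blast+
  then show sub: "path_image p2 \<subseteq> insert (g \<alpha>) (insert (g \<beta>) S)"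
    unfolding im2 closed_segment_commute[of "g \<beta>" x] by blast
  have "path_image p1 \<subseteq> \<Gamma>" using im1 ca(2) by simp
  then have "path_image p1 \<inter> path_image p2 \<subseteq> {g \<alpha>, g \<beta>}" using sub side_props(6) by blast
  then show "simple_path (p1 +++ p2)" using a1 a2 e by (intro simple_path_join_loop) auto
  show "pathfinish (p1 +++ p2) = pathstart (p1 +++ p2)" using e by simp
  show "path_image (p1 +++ p2) = cell_curve g \<alpha> \<beta> x"
    using e by (simp add: path_image_join im1 im2 cell_curve_def)
qed

lemma frontier_inside_cell_curve:
  assumes "cell g \<alpha> \<beta> x"
  shows "frontier (inside (cell_curve g \<alpha> \<beta> x)) = cell_curve g \<alpha> \<beta> x"
  using Jordan_inside_outside[OF cell_return_path(3,4)[OF assms]] cell_return_path(5)[OF assms] by simp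

text \<open>The cell curve misses the connected set \<open>S'\<close>, so \<open>S'\<close> would
  lie inside it altogether. The inside is confined to \<open>cball x (2 * \<eta>)\<close>, but the
  base point, a limit of points of \<open>S'\<close>, is farther away.\<close>

lemma opposite_side_outside_cell:
  assumes cell: "cell g \<alpha> \<beta> x"
  shows "S' \<inter> inside (cell_curve g \<alpha> \<beta> x) = {}"
proof (rule ccontr)
  assume ne: "S' \<inter> inside (cell_curve g \<alpha> \<beta> x) \<noteq> {}"
  let ?L = "cell_curve g \<alpha> \<beta> x"
  note c = cell[unfolded cell_def]
  have g: "pathfinish g = pathstart g" "path_image g = \<Gamma>" using c by blast+
  have x: "x \<in> level" "dist x (g \<alpha>) = \<epsilon>" "dist x (g \<beta>) = \<epsilon>" "3 * \<eta> < dist (g 0) x" using c by blast+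
  note ca = cell_arc[OF cell]
  have ab: "g \<alpha> \<in> \<Gamma>" "g \<beta> \<in> \<Gamma>" using ca(2) c by auto
  have "?L \<subseteq> \<Gamma> \<union> S"
    using cell_return_path(11,12)[OF cell] ca(2) ab unfolding cell_curve_def by blast
  then have "?L \<inter> S' = {}" using side_props(5,6) by blast
  then have "S' \<inter> outside ?L = {}"
    using inside_outside_intersect_connected[OF side_props(4), of ?L] ne by blast
  then have "S' \<subseteq> inside ?L" using \<open>?L \<inter> S' = {}\<close> inside_Un_outside[of ?L] by blast
  moreover have "inside ?L \<subseteq> cball x (2 * \<eta>)"
  proof -
    have "closed_segment (g \<beta>) x \<union> closed_segment x (g \<alpha>) \<subseteq> cball x (2 * \<eta>)"
      using x eps_le eta_pos by (intro Un_least closed_segment_subset convex_cball) auto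
    then have "?L \<subseteq> cball x (2 * \<eta>)" unfolding cell_curve_def using ca(4) by blast
    then have "- cball x (2 * \<eta>) \<subseteq> outside ?L" by (intro outside_subset_convex convex_cball)
    then show ?thesis using inside_Int_outside[of ?L] by blast
  qed
  ultimately have "closure S' \<subseteq> cball x (2 * \<eta>)" by (intro closure_minimal) auto
  moreover have "g 0 \<in> closure S'" using closure_side(2) g(2) by (auto simp: path_image_def)
  ultimately show False using x(4) eta_pos by (auto simp: dist_commute)
qed

text \<open>Up to orientation \<open>\<Gamma>\<close> is the sum of the boundary of the cell and of the closed curve that
  replaces the arc by the two foot segments. Near an interior point of the arc the winding number
  of the latter is constant, so on the side \<open>S\<close> of \<open>\<Gamma>\<close> all points near it lie inside the cell.\<close>

lemma foot_notin_cell_arc: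
  assumes cell: "cell g \<alpha> \<beta> x" and y: "y \<in> level" "y \<noteq> x" "dist y (g \<gamma>) = \<epsilon>"
  shows "\<gamma> \<notin> {\<alpha><..<\<beta>}"
proof
  assume \<gamma>: "\<gamma> \<in> {\<alpha><..<\<beta>}"
  let ?L = "cell_curve g \<alpha> \<beta> x"
  note c = cell[unfolded cell_def]
  have g: "simple_path g" "pathfinish g = pathstart g" "path_image g = \<Gamma>" using c by blast+
  have p: "0 < \<alpha>" "\<alpha> < \<beta>" "\<beta> < 1" and x: "x \<in> level" "dist x (g \<alpha>) = \<epsilon>" "dist x (g \<beta>) = \<epsilon>" "3 * \<eta> < dist (g 0) x"
    using c by blast+
  note ca = cell_arc[OF cell]
  have ab: "g \<alpha> \<in> \<Gamma>" "g \<beta> \<in> \<Gamma>" using ca(2) p by auto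
  define p1 where "p1 = subpath \<alpha> \<beta> g"
  define p2 where "p2 = linepath (g \<beta>) x +++ linepath x (g \<alpha>)"
  note L = cell_return_path[OF cell, folded p1_def p2_def]
  \<comment> \<open>The complementary arc of \<Gamma>, from \<open>g \<beta>\<close> through the
    base point to \<open>g \<alpha>\<close>.\<close>
  define p3 where "p3 = subpath \<beta> 1 g +++ subpath 0 \<alpha> g"
  have "path g" using g(1) by (rule simple_path_imp_path)
  have g01: "g 1 = g 0" using g(2) by (simp add: pathfinish_def pathstart_def)
  have e3: "pathstart p3 = g \<beta>" "pathfinish p3 = g \<alpha>" by (simp_all add: p3_def)
  have path3: "path p3" unfolding p3_def using \<open>path g\<close> p g01 by (intro path_join_imp path_subpath) auto
  have im3: "path_image p3 = g ` {\<beta>..1} \<union> g ` {0..\<alpha>}"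
    unfolding p3_def using p g01 by (simp add: path_image_join path_image_subpath)
  have im13: "path_image p1 \<union> path_image p3 = \<Gamma>"
  proof -
    have "{0..1} = {\<alpha>..\<beta>} \<union> ({\<beta>..1} \<union> {0..\<alpha>})" using p by auto
    then show ?thesis unfolding im3 L(10) using g(3) by (simp add: path_image_def image_Un)
  qed
  define cc where "cc = g \<gamma>"
  have ccG: "cc \<in> g ` {\<alpha>..\<beta>}" "cc \<in> \<Gamma>" using \<gamma> ca(2) by (auto simp: cc_def)
  have inj: "g s \<noteq> g \<gamma>" if "s \<in> {0..1}" "s \<noteq> \<gamma>" for s
    using simple_path_eq_interior[OF g(1) _ that(1), of \<gamma>] that(2) \<gamma> p by auto
  have c3: "cc \<notin> path_image p3"
  proof
    assume "cc \<in> path_image p3"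
    then obtain s where "s \<in> {\<beta>..1} \<union> {0..\<alpha>}" "g s = g \<gamma>" unfolding im3 cc_def by force
    then show False using inj[of s] \<gamma> p by auto
  qed
  have ccab: "cc \<noteq> g \<alpha>" "cc \<noteq> g \<beta>" using inj[of \<alpha>] inj[of \<beta>] \<gamma> p by (auto simp: cc_def)
  then have c2: "cc \<notin> path_image p2" using L(12) ccG side_props(6) by blast
  have "path p2" "path p1" using L(1,2) arc_imp_path by blast+
  have "closed (path_image p2 \<union> path_image p3)"
    using \<open>path p2\<close> path3 by (auto intro: closed_path_image)
  then have "open (- (path_image p2 \<union> path_image p3))" by (rule open_Compl)
  moreover have "cc \<in> - (path_image p2 \<union> path_image p3)" using c2 c3 by simp
  ultimately obtain \<rho> where "\<rho> > 0" "ball cc \<rho> \<subseteq> - (path_image p2 \<union> path_image p3)" by (rule openE)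
  then have \<rho>: "\<rho> > 0" "ball cc \<rho> \<inter> (path_image p2 \<union> path_image p3) = {}" by blast+
  \<comment> \<open>Two test points of \<open>S\<close> near \<open>cc\<close>: \<open>w0\<close>
    inside the cell and \<open>w1\<close> on the foot segment of \<open>y\<close>. Equality of their
    winding numbers will put \<open>w1\<close> inside the cell as well.\<close>
  have "cc \<in> closure (inside ?L)"
    using frontier_inside_cell_curve[OF cell] ccG by (auto simp: frontier_def cell_curve_def)
  then obtain w0 where w0: "w0 \<in> inside ?L" "dist w0 cc < \<rho>"
    using \<rho>(1) unfolding closure_approachable by blast
  have "w0 \<notin> ?L" using w0(1) inside_no_overlap by blast
  then have "w0 \<notin> path_image p1" unfolding cell_curve_def L(10) by blast
  moreover have w0b: "w0 \<in> ball cc \<rho>" using w0(2) by (simp add: dist_commute)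
  ultimately have "w0 \<notin> \<Gamma>" using \<rho>(2) im13 by blast
  then have w0S: "w0 \<in> S" using opposite_side_outside_cell[OF cell] w0(1) side_props(6) by blast
  have "y \<noteq> cc" using y eps by (auto simp: cc_def)
  have "cc \<in> closure (open_segment y cc)" using \<open>y \<noteq> cc\<close> by (simp add: closure_open_segment)
  then obtain w1 where w1: "w1 \<in> open_segment y cc" "dist w1 cc < \<rho>"
    using \<rho>(1) unfolding closure_approachable by blast
  have w1b: "w1 \<in> ball cc \<rho>" using w1(2) by (simp add: dist_commute)
  have seg: "closed_segment y cc - {cc} \<subseteq> S"
    using segment_foot_side[OF y(1) ccG(2)] y(3) by (simp add: cc_def)
  then have w1S: "w1 \<in> S" using w1(1) by (auto simp: open_segment_def)
  \<comment> \<open>The contributions of \<open>p3\<close> cancel. The first term on the right is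
    constant on \<open>S\<close>, the second on the ball around \<open>cc\<close>.\<close>
  have wind: "winding_number (p1 +++ p2) w = winding_number (p1 +++ p3) w - winding_number (p3 +++ reversepath p2) w"
    if "w \<in> S" "w \<in> ball cc \<rho>" for w
  proof -
    have n: "w \<notin> path_image p1" "w \<notin> path_image p2" "w \<notin> path_image p3"
      using that im13 \<rho>(2) side_props(6) by blast+
    then show ?thesis
      using \<open>path p1\<close> \<open>path p2\<close> path3 L e3 by (simp add: winding_number_join winding_number_reversepath)
  qed
  have "winding_number (p1 +++ p3) constant_on S"
    using \<open>path p1\<close> path3 L e3 im13 side_props(2,6)
    by (intro winding_number_constant) (auto simp: path_image_join)
  then have 1: "winding_number (p1 +++ p3) w0 = winding_number (p1 +++ p3) w1"
    using w0S w1S unfolding constant_on_def by metis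
  have "winding_number (p3 +++ reversepath p2) constant_on (ball cc \<rho>)"
    using \<open>path p2\<close> path3 L e3 \<rho>(2)
    by (intro winding_number_constant) (auto simp: path_image_join)
  then have 2: "winding_number (p3 +++ reversepath p2) w0 = winding_number (p3 +++ reversepath p2) w1"
    using w0b w1b unfolding constant_on_def by metis
  have eq: "winding_number (p1 +++ p2) w0 = winding_number (p1 +++ p2) w1"
    using wind[OF w0S w0b] wind[OF w1S w1b] 1 2 by simp
  have "winding_number (p1 +++ p2) w0 \<noteq> 0"
    using simple_closed_path_winding_number_inside[OF L(3)] w0(1) L(5) by (metis L(4) insertE neg_equal_0_iff_equal singletonD zero_neq_one)
  then have "w1 \<notin> outside ?L"
    using winding_number_zero_in_outside[of "p1 +++ p2" w1] L(3,4,5) eq simple_path_imp_path by metis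
  moreover have "w1 \<notin> ?L"
    using w1S w1b \<rho>(2) ca(2) side_props(6) L(11) unfolding cell_curve_def by blast
  ultimately have w1in: "w1 \<in> inside ?L" using inside_Un_outside[of ?L] by blast
  \<comment> \<open>This part of the foot segment misses the cell curve, yet joins \<open>y\<close>,
    which is outside, to \<open>w1\<close>, which is inside.\<close>
  have "closed_segment y w1 \<subseteq> closed_segment y cc - {cc}"
  proof -
    have "closed_segment y w1 \<subseteq> closed_segment y cc"
      using w1(1) by (simp add: open_segment_def subset_closed_segment)
    moreover have "cc \<notin> closed_segment y w1"
    proof
      assume "cc \<in> closed_segment y w1"
      then have "dist y w1 = dist y cc + dist cc w1" by (simp add: dist_add_closed_segment)
      moreover have "dist y cc = dist y w1 + dist w1 cc"
        using w1(1) by (simp add: dist_add_closed_segment open_segment_def)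
      ultimately have "dist w1 cc = 0" using zero_le_dist[of cc w1] zero_le_dist[of w1 cc] by linarith
      then show False using w1(1) by (simp add: open_segment_def)
    qed
    ultimately show ?thesis by blast
  qed
  moreover have "closed_segment y cc \<inter> closed_segment x (g \<alpha>) = {}" "closed_segment y cc \<inter> closed_segment x (g \<beta>) = {}"
    using foot_segments_disjoint[OF y(1) x(1) y(2) ccG(2)] ab x(2,3) y(3) ccab by (auto simp: cc_def)
  ultimately have "closed_segment y w1 \<inter> ?L = {}"
    using seg ca(2) side_props(6) closed_segment_commute[of "g \<beta>" x] unfolding cell_curve_def by blast
  moreover have "y \<in> outside ?L" using level_outside_cell[OF cell y(1,2)] .
  ultimately show False
    using inside_outside_intersect_connected[of "closed_segment y w1" ?L] w1in by auto
qed


text \<open>\<open>\<alpha>\<close> and \<open>\<beta>\<close> are the first and last parameters of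
  a foot of \<open>x\<close>; they coincide if there is only one foot.\<close>

definition extreme_feet :: "(real \<Rightarrow> complex) \<Rightarrow> real \<Rightarrow> real \<Rightarrow> complex \<Rightarrow> bool" where
  "extreme_feet g \<alpha> \<beta> x \<longleftrightarrow> simple_path g \<and> pathfinish g = pathstart g \<and> path_image g = \<Gamma> \<and> 3 * \<eta> < dist (g 0) x \<and>
     0 < \<alpha> \<and> \<alpha> \<le> \<beta> \<and> \<beta> < 1 \<and> dist x (g \<alpha>) = \<epsilon> \<and> dist x (g \<beta>) = \<epsilon> \<and>
     (\<forall>t\<in>{0..1}. dist x (g t) = \<epsilon> \<longrightarrow> t \<in> {\<alpha>..\<beta>})"

lemma ex_extreme_feet:
  assumes x: "x \<in> level"
  obtains g \<alpha> \<beta> where "extreme_feet g \<alpha> \<beta> x"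
proof -
  obtain f where f: "f \<in> \<Gamma>" "3 * \<eta> < dist f x" using wide by blast
  then obtain g where g: "simple_path g" "pathfinish g = pathstart g" "path_image g = \<Gamma>" "g 0 = f"
    using jordan_curve_based_parametrization[OF curve] by metis
  have g1: "g 1 = f" using g by (simp add: pathfinish_def pathstart_def)
  define T where "T = {0..1} \<inter> (\<lambda>t. dist x (g t)) -` {\<epsilon>}"
  have cg: "continuous_on {0..1} g" using g(1) by (simp add: simple_path_def path_def)
  have "closed T" unfolding T_def
    by (intro continuous_closed_preimage continuous_intros cg)
  then have "compact T" unfolding T_def
    by (metis Int_lower1 bounded_closed_interval bounded_subset compact_eq_bounded_closed)
  obtain c where "c \<in> \<Gamma>" "dist x c = \<epsilon>" using level_foot[OF x] .
  then have "T \<noteq> {}" using g(3) by (auto simp: T_def path_image_def)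
  obtain \<alpha> where \<alpha>: "\<alpha> \<in> T" "\<And>t. t \<in> T \<Longrightarrow> \<alpha> \<le> t" using compact_attains_inf[OF \<open>compact T\<close> \<open>T \<noteq> {}\<close>] by blast
  obtain \<beta> where \<beta>: "\<beta> \<in> T" "\<And>t. t \<in> T \<Longrightarrow> t \<le> \<beta>" using compact_attains_sup[OF \<open>compact T\<close> \<open>T \<noteq> {}\<close>] by blast
  have "dist x f \<noteq> \<epsilon>" using f(2) eps_le eta_pos by (simp add: dist_commute)
  then have "0 \<notin> T" "1 \<notin> T" using g(4) g1 by (auto simp: T_def)
  then have "\<alpha> \<noteq> 0" "\<beta> \<noteq> 1" using \<alpha>(1) \<beta>(1) by blast+
  then have "0 < \<alpha>" "\<beta> < 1" using \<alpha>(1) \<beta>(1) by (auto simp: T_def)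
  moreover have "\<alpha> \<le> \<beta>" using \<alpha> \<beta> by blast
  moreover have "dist x (g \<alpha>) = \<epsilon>" "dist x (g \<beta>) = \<epsilon>" using \<alpha>(1) \<beta>(1) by (auto simp: T_def)
  moreover have "t \<in> {\<alpha>..\<beta>}" if "t \<in> {0..1}" "dist x (g t) = \<epsilon>" for t
    using \<alpha>(2)[of t] \<beta>(2)[of t] that by (simp add: T_def)
  ultimately show thesis using that[of g \<alpha> \<beta>] g f unfolding extreme_feet_def by simp
qed

text \<open>The open arc between the extreme feet is excluded by \<open>foot_notin_cell_arc\<close>.
  The rest of \<Gamma>, away from these feet, is the compact set \<open>Q\<close> without feet of
  \<open>x\<close>; its distance from \<open>x\<close> exceeds \<epsilon> by a margin, so it has no
  foot of a point close to \<open>x\<close>.\<close>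

lemma nearby_feet:
  assumes x: "x \<in> level"
    and ext: "extreme_feet g \<alpha> \<beta> x" and "0 < \<rho>"
  obtains \<delta> where "0 < \<delta>"
    "\<And>z c. z \<in> level \<Longrightarrow> z \<noteq> x \<Longrightarrow> dist z x \<le> \<delta> \<Longrightarrow> c \<in> \<Gamma> \<Longrightarrow> dist z c = \<epsilon> \<Longrightarrow> dist c (g \<alpha>) < \<rho> \<or> dist c (g \<beta>) < \<rho>"
proof -
  have g: "simple_path g" "pathfinish g = pathstart g" "path_image g = \<Gamma>" "3 * \<eta> < dist (g 0) x"
    and ab: "0 < \<alpha>" "\<alpha> \<le> \<beta>" "\<beta> < 1" "dist x (g \<alpha>) = \<epsilon>" "dist x (g \<beta>) = \<epsilon>"
      "\<And>t. t \<in> {0..1} \<Longrightarrow> dist x (g t) = \<epsilon> \<Longrightarrow> t \<in> {\<alpha>..\<beta>}"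
    using ext unfolding extreme_feet_def by blast+
  define Q where "Q = (g ` {0..\<alpha>} \<union> g ` {\<beta>..1}) - (ball (g \<alpha>) \<rho> \<union> ball (g \<beta>) \<rho>)"
  have cg: "continuous_on {0..1} g" using g(1) by (simp add: simple_path_def path_def)
  have "compact (g ` {0..\<alpha>})" "compact (g ` {\<beta>..1})"
    using ab by (auto intro!: compact_continuous_image continuous_on_subset[OF cg])
  then have "compact Q" unfolding Q_def by (intro compact_diff compact_Un open_Un open_ball)
  have QG: "\<exists>t\<in>{0..\<alpha>} \<union> {\<beta>..1}. c = g t" "c \<in> \<Gamma>" if "c \<in> Q" for c
  proof -
    show ex: "\<exists>t\<in>{0..\<alpha>} \<union> {\<beta>..1}. c = g t" using that by (auto simp: Q_def)
    have "{0..\<alpha>} \<union> {\<beta>..1} \<subseteq> {0..1}" using ab by auto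
    then show "c \<in> \<Gamma>" using ex g(3) unfolding path_image_def by blast
  qed
  have gt: "\<epsilon> < dist x c" if "c \<in> Q" for c
  proof -
    obtain t where t: "t \<in> {0..\<alpha>} \<union> {\<beta>..1}" "c = g t" using QG(1)[OF \<open>c \<in> Q\<close>] by blast
    have "dist x c \<noteq> \<epsilon>"
    proof
      assume "dist x c = \<epsilon>"
      then have "t \<in> {\<alpha>..\<beta>}" using ab(6)[of t] t ab(1-3) by auto
      then have "t = \<alpha> \<or> t = \<beta>" using t(1) by auto
      then show False using that t(2) \<open>0 < \<rho>\<close> by (auto simp: Q_def)
    qed
    then show ?thesis using level_le_dist[OF x QG(2)[OF that]] by simp
  qed
  obtain \<delta> where \<delta>: "0 < \<delta>" "\<And>c. c \<in> Q \<Longrightarrow> \<epsilon> + \<delta> < dist x c"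
  proof (cases "Q = {}")
    case True then show ?thesis using that[of 1] by auto
  next
    case False
    have "continuous_on Q (\<lambda>c. dist x c)" by (intro continuous_intros)
    then obtain c0 where c0: "c0 \<in> Q" "\<And>c. c \<in> Q \<Longrightarrow> dist x c0 \<le> dist x c"
      using continuous_attains_inf[OF \<open>compact Q\<close> False] by blast
    show ?thesis
    proof (rule that[of "(dist x c0 - \<epsilon>) / 2"])
      show "0 < (dist x c0 - \<epsilon>) / 2" using gt[OF c0(1)] by simp
      show "\<epsilon> + (dist x c0 - \<epsilon>) / 2 < dist x c" if "c \<in> Q" for c
        using gt[OF c0(1)] c0(2)[OF that] by (simp add: field_simps)
    qed
  qed
  show thesis
  proof (rule that[OF \<delta>(1)])
    fix z c assume z: "z \<in> level" "z \<noteq> x" "dist z x \<le> \<delta>" "c \<in> \<Gamma>" "dist z c = \<epsilon>"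
    obtain t where t: "t \<in> {0..1}" "c = g t" using z(4) g(3) by (auto simp: path_image_def)
    have "t \<notin> {\<alpha><..<\<beta>}"
    proof (cases "\<alpha> < \<beta>")
      case True
      then have "cell g \<alpha> \<beta> x" using x g ab(1-5) by (simp add: cell_def)
      then show ?thesis using foot_notin_cell_arc z t(2) by blast
    qed auto
    then have "c \<in> g ` {0..\<alpha>} \<union> g ` {\<beta>..1}" using t by auto
    moreover have "c \<notin> Q"
    proof
      assume "c \<in> Q"
      then have "\<epsilon> + \<delta> < dist x c" using \<delta>(2) by blast
      then show False using dist_triangle[of x c z] z(3,5) by (simp add: dist_commute)
    qed
    ultimately show "dist c (g \<alpha>) < \<rho> \<or> dist c (g \<beta>) < \<rho>"
      by (auto simp: Q_def dist_commute)
  qed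
qed

text \<open>Since \<open>x - a\<close> and \<open>x - b\<close> have equal length, their sum
  \<open>v\<close> has with each of them the inner product half its squared norm, and it is nonzero
  because \<open>x\<close> is not the midpoint. So all feet near \<open>a\<close> or
  \<open>b\<close> lie on one side and the coordinate orthogonal to \<open>v\<close> is
  injective.\<close>

lemma chart_if_not_antipodal:
  assumes x: "x \<in> level" and ab: "dist x a = \<epsilon>" "dist x b = \<epsilon>" "x \<noteq> midpoint a b" "a \<in> \<Gamma>"
    and feet: "\<And>\<rho>. 0 < \<rho> \<Longrightarrow> \<exists>\<delta>>0. \<forall>z c. z \<in> level \<longrightarrow> z \<noteq> x \<longrightarrow> dist z x \<le> \<delta> \<longrightarrow> c \<in> \<Gamma> \<longrightarrow>
       dist z c = \<epsilon> \<longrightarrow> dist c a < \<rho> \<or> dist c b < \<rho>"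
  shows "line_chart_at level x"
proof -
  define v where "v = (x - a) + (x - b)"
  have "v \<noteq> 0"
  proof
    assume "v = 0"
    then have "x + x = a + b" by (simp add: v_def algebra_simps)
    then show False using ab(3) midpoint_eq_iff by metis
  qed
  define n where "n = norm v"
  have "n > 0" using \<open>v \<noteq> 0\<close> by (simp add: n_def)
  have ii: "inner (x - a) (x - a) = inner (x - b) (x - b)"
    using ab(1,2) by (metis dist_norm power2_norm_eq_inner)
  have nn: "n\<^sup>2 = inner v v" by (simp add: n_def power2_norm_eq_inner)
  have va: "inner v (x - a) = n\<^sup>2 / 2" "inner v (x - b) = n\<^sup>2 / 2"
    unfolding nn unfolding v_def inner_add_left inner_add_right using ii inner_commute[of "x - a" "x - b"] by simp_all
  obtain \<delta> where \<delta>: "\<delta> > 0" "\<And>z c. z \<in> level \<Longrightarrow> z \<noteq> x \<Longrightarrow> dist z x \<le> \<delta> \<Longrightarrow> c \<in> \<Gamma> \<Longrightarrow>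
       dist z c = \<epsilon> \<Longrightarrow> dist c a < n / 8 \<or> dist c b < n / 8"
    using feet[of "n / 8"] \<open>n > 0\<close> by auto
  define \<rho> where "\<rho> = min \<delta> (n / 16)"
  have \<rho>: "\<rho> > 0" "\<rho> \<le> \<delta>" "\<rho> \<le> n / 16" using \<delta>(1) \<open>n > 0\<close> by (auto simp: \<rho>_def)
  let ?X = "level \<inter> cball x \<rho>"
  have "inj_on (\<lambda>z. inner (\<i> * v) z) ?X"
  proof (rule near_feet_injective[OF \<open>v \<noteq> 0\<close>, where x = x and \<epsilon> = \<epsilon>])
    fix z assume z: "z \<in> ?X"
    show "dist z x \<le> norm v / 16" using z \<rho>(3) by (simp add: dist_commute n_def)
    have "\<exists>c\<in>\<Gamma>. dist z c = \<epsilon> \<and> (dist c a < n / 8 \<or> dist c b < n / 8)"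
    proof (cases "z = x")
      case True then show ?thesis using ab \<open>n > 0\<close> by (intro bexI[of _ a]) auto
    next
      case False
      obtain c where "c \<in> \<Gamma>" "dist z c = \<epsilon>" using level_foot z by blast
      then show ?thesis using \<delta>(2)[of z c] z False \<rho>(2) by (auto simp: dist_commute)
    qed
    then obtain c p where c: "c \<in> \<Gamma>" "dist z c = \<epsilon>" "dist c p < n / 8" "inner v (x - p) = n\<^sup>2 / 2"
      using va by blast
    then have "\<forall>y\<in>?X. \<epsilon> \<le> dist y c" using level_le_dist by blast
    then show "\<exists>c p. dist z c = \<epsilon> \<and> (\<forall>y\<in>?X. \<epsilon> \<le> dist y c) \<and> dist c p \<le> norm v / 8 \<and>
        inner v (x - p) = (norm v)\<^sup>2 / 2"
      using c less_imp_le[OF c(3)] unfolding n_def by blast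
  qed
  moreover have "continuous_on ?X (\<lambda>z. inner (\<i> * v) z)" by (intro continuous_intros)
  ultimately show ?thesis unfolding line_chart_at_def using \<rho>(1) by blast
qed


lemma half_discs:
  fixes x e :: complex
  defines "H \<equiv> \<lambda>z. inner (\<i> * e) (z - x)"
  assumes "e \<noteq> 0" "norm (w - x) < norm e / 2" "H w = 0"
  shows "w \<in> open_segment (x - e / 2) (x + e / 2)"
proof -
  define u where "u = Re ((w - x) * cnj e) / (norm e)\<^sup>2"
  have "Im ((w - x) * cnj e) = 0"
    using assms(4) by (simp add: H_def inner_complex_def algebra_simps)
  then have "w - x = complex_of_real u * e"
    unfolding u_def by (rule real_multiple_if_Im_zero[OF \<open>e \<noteq> 0\<close>])
  then have w: "w = x + complex_of_real u * e" by (simp add: algebra_simps)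
  have "norm (w - x) = \<bar>u\<bar> * norm e" unfolding w by (simp add: norm_mult)
  then have "\<bar>u\<bar> * norm e < 1 / 2 * norm e" using assms(3) by simp
  then have u: "\<bar>u\<bar> < 1 / 2" by (rule mult_right_less_imp_less) simp
  have "w = (1 - (u + 1 / 2)) *\<^sub>R (x - e / 2) + (u + 1 / 2) *\<^sub>R (x + e / 2)"
    unfolding w by (simp add: scaleR_conv_of_real field_simps)
  moreover have "0 < u + 1 / 2" "u + 1 / 2 < 1" using u by linarith+
  moreover have "x - e / 2 \<noteq> x + e / 2"
    using \<open>e \<noteq> 0\<close> by (simp add: field_simps)
  ultimately show ?thesis unfolding in_segment by blast
qed

text \<open>Within distance \<epsilon> of \<open>x\<close> the cell curve lies on the diameter, and
  the inside accumulates at \<open>x\<close>, so one open half disc is inside the cell. Other level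
  points are outside the cell and, by their distance from the feet, off the diameter.\<close>

lemma antipodal_half_plane:
  assumes cell: "cell g \<alpha> \<beta> x" and mid: "x = midpoint (g \<alpha>) (g \<beta>)"
  defines "H \<equiv> \<lambda>z. inner (\<i> * (g \<beta> - g \<alpha>)) (z - x)"
  obtains \<sigma> :: real where "\<sigma> = 1 \<or> \<sigma> = - 1" "\<And>z. z \<in> level \<Longrightarrow> z \<noteq> x \<Longrightarrow> dist z x < \<epsilon> \<Longrightarrow> 0 < \<sigma> * H z"
proof -
  let ?L = "cell_curve g \<alpha> \<beta> x"
  have x: "x \<in> level" "dist x (g \<alpha>) = \<epsilon>" "dist x (g \<beta>) = \<epsilon>" using cell by (simp_all add: cell_def)
  note ca = cell_arc[OF cell]
  define e where "e = g \<beta> - g \<alpha>"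
  have "e \<noteq> 0" using ca(1) by (simp add: e_def)
  have ab: "g \<alpha> = x - e / 2" "g \<beta> = x + e / 2"
    unfolding mid e_def midpoint_def by (simp_all add: complex_eq_iff field_simps)
  have ne: "norm e / 2 = \<epsilon>" using x(2) unfolding ab by (simp add: dist_norm norm_divide)
  have H: "H z = inner (\<i> * e) (z - x)" for z by (simp add: H_def e_def)
  have seg: "w \<in> closed_segment (g \<alpha>) (g \<beta>)" if "dist w x < \<epsilon>" "H w = 0" for w
    using half_discs[OF \<open>e \<noteq> 0\<close>, of w x] that ne unfolding ab H by (simp add: dist_norm open_segment_def)
  have halves: "closed_segment (g \<alpha>) (g \<beta>) = closed_segment (g \<beta>) x \<union> closed_segment x (g \<alpha>)"
    using Un_closed_segment[of x "g \<alpha>" "g \<beta>"] mid by (simp add: closed_segment_commute Un_commute)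
  have H0: "H w = 0" if "w \<in> closed_segment (g \<alpha>) (g \<beta>)" for w
  proof -
    obtain t where "w = (1 - t) *\<^sub>R g \<alpha> + t *\<^sub>R g \<beta>"
      using \<open>w \<in> closed_segment (g \<alpha>) (g \<beta>)\<close> by (auto simp: in_segment)
    moreover have "(1 - t) *\<^sub>R g \<alpha> + t *\<^sub>R g \<beta> = x + (t - 1 / 2) *\<^sub>R e"
      unfolding ab by (simp add: scaleR_conv_of_real field_simps)
    ultimately have "w - x = (t - 1 / 2) *\<^sub>R e" by simp
    moreover have "inner (\<i> * e) e = 0" by (simp add: inner_complex_def)
    ultimately show ?thesis by (simp add: H)
  qed
  have L0: "H w = 0" if "w \<in> ?L" "dist w x < \<epsilon>" for w
  proof -
    have "w \<notin> g ` {\<alpha>..\<beta>}" using that(2) level_le_dist[OF x(1), of w] ca(2) by (auto simp: dist_commute)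
    then show ?thesis using H0 that(1) halves unfolding cell_curve_def by blast
  qed
  have "x \<in> closure (inside ?L)"
    using frontier_inside_cell_curve[OF cell] by (auto simp: frontier_def cell_curve_def)
  then obtain w where w: "w \<in> inside ?L" "dist w x < \<epsilon>" using eps unfolding closure_approachable by blast
  have "w \<notin> ?L" using w(1) inside_no_overlap by blast
  then have "H w \<noteq> 0" using seg[OF w(2)] halves unfolding cell_curve_def by blast
  \<comment> \<open>The half disc of the inside point \<open>w\<close> gets the negative
    sign.\<close>
  define \<sigma> :: real where "\<sigma> = (if H w < 0 then 1 else - 1)"
  have \<sigma>: "\<sigma> = 1 \<or> \<sigma> = - 1" "\<sigma> * H w < 0" using \<open>H w \<noteq> 0\<close> by (auto simp: \<sigma>_def)
  define D where "D = ball x \<epsilon> \<inter> {z. inner (\<sigma> *\<^sub>R (\<i> * e)) z < inner (\<sigma> *\<^sub>R (\<i> * e)) x}"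
  have D_iff: "z \<in> D \<longleftrightarrow> dist z x < \<epsilon> \<and> \<sigma> * H z < 0" for z
  proof -
    have "\<sigma> * H z = inner (\<sigma> *\<^sub>R (\<i> * e)) z - inner (\<sigma> *\<^sub>R (\<i> * e)) x"
      unfolding H inner_scaleR_left inner_diff_right by (rule right_diff_distrib)
    then show ?thesis unfolding D_def Int_iff mem_ball mem_Collect_eq dist_commute[of x z] by linarith
  qed
  have "connected D" unfolding D_def by (intro convex_connected convex_Int convex_ball convex_halfspace_lt)
  moreover have "D \<inter> ?L = {}"
  proof -
    have "z \<notin> ?L" if "z \<in> D" for z
      using L0[of z] that unfolding D_iff by fastforce
    then show ?thesis by blast
  qed
  moreover have "w \<in> D" using w \<sigma> by (simp add: D_iff)
  ultimately have "outside ?L \<inter> D = {}" using inside_outside_intersect_connected[of D ?L] w(1) by blast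
  show thesis
  proof (rule that[OF \<sigma>(1)])
    fix z assume z: "z \<in> level" "z \<noteq> x" "dist z x < \<epsilon>"
    have "z \<notin> D" using level_outside_cell[OF cell z(1,2)] \<open>outside ?L \<inter> D = {}\<close> by blast
    moreover have "H z \<noteq> 0"
    proof
      assume "H z = 0"
      then have "z \<in> closed_segment x (g \<beta>) \<union> closed_segment x (g \<alpha>)"
        using seg[OF z(3)] halves by (simp add: closed_segment_commute)
      moreover have "g \<alpha> \<in> \<Gamma>" "g \<beta> \<in> \<Gamma>" using ca(2) cell by (auto simp: cell_def)
      ultimately have "infdist z \<Gamma> < \<epsilon>"
        using infdist_segment_foot[of _ x z] x(2,3) z(2) by auto
      then show False using z(1) by (simp add: level_def)
    qed
    then have "\<sigma> * H z \<noteq> 0" using \<sigma>(1) by auto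
    moreover have "\<not> \<sigma> * H z < 0" using \<open>z \<notin> D\<close> z(3) unfolding D_iff by blast
    ultimately show "0 < \<sigma> * H z" by linarith
  qed
qed


text \<open>Near \<open>x\<close> the level set consists of \<open>N a\<close> and
  \<open>N b\<close>, the points with a foot near \<open>a\<close> or near \<open>b\<close>. They
  meet only at \<open>x\<close>, the height over the diameter is injective on each, and both lie on
  the same side of the diameter; reversing the height on one of them makes it injective on the
  union.\<close>

lemma chart_if_antipodal:
  assumes x: "x \<in> level"
    and ext: "extreme_feet g \<alpha> \<beta> x" and mid: "x = midpoint (g \<alpha>) (g \<beta>)"
  shows "line_chart_at level x"
proof -
  have g: "simple_path g" "pathfinish g = pathstart g" "path_image g = \<Gamma>" "3 * \<eta> < dist (g 0) x"
    and "\<alpha> \<le> \<beta>" and ab': "0 < \<alpha>" "\<beta> < 1" "dist x (g \<alpha>) = \<epsilon>" "dist x (g \<beta>) = \<epsilon>"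
    using ext unfolding extreme_feet_def by blast+
  have "\<alpha> \<noteq> \<beta>" using ab'(3) eps(1) mid by (metis dist_self midpoint_idem less_irrefl)
  then have ab: "0 < \<alpha>" "\<alpha> < \<beta>" "\<beta> < 1" "dist x (g \<alpha>) = \<epsilon>" "dist x (g \<beta>) = \<epsilon>"
    using ab' \<open>\<alpha> \<le> \<beta>\<close> by auto
  define a b where "a = g \<alpha>" and "b = g \<beta>"
  have cell: "cell g \<alpha> \<beta> x" using x g ab by (simp add: cell_def)
  note ca = cell_arc[OF cell]
  have abG: "a \<in> \<Gamma>" "b \<in> \<Gamma>" using ca(2) ab by (auto simp: a_def b_def)
  define e where "e = b - a"
  define n where "n = norm e"
  have "e \<noteq> 0" using ca(1) by (simp add: e_def a_def b_def)
  then have "n > 0" by (simp add: n_def)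
  define H where "H z = inner (\<i> * e) (z - x)" for z
  obtain \<sigma> :: real where "\<sigma> = 1 \<or> \<sigma> = - 1"
    and "\<And>z. z \<in> level \<Longrightarrow> z \<noteq> x \<Longrightarrow> dist z x < \<epsilon> \<Longrightarrow> 0 < \<sigma> * inner (\<i> * (g \<beta> - g \<alpha>)) (z - x)"
    using antipodal_half_plane[OF cell mid] by blast
  then have \<sigma>: "\<sigma> = 1 \<or> \<sigma> = - 1" "\<And>z. z \<in> level \<Longrightarrow> z \<noteq> x \<Longrightarrow> dist z x < \<epsilon> \<Longrightarrow> 0 < \<sigma> * H z"
    unfolding H_def e_def a_def b_def by blast+
  have xa: "x - a = (1 / 2) *\<^sub>R e" "x - b = (1 / 2) *\<^sub>R (- e)"
    unfolding mid e_def a_def b_def midpoint_def by (simp_all add: complex_eq_iff field_simps)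
  have ie: "inner e (x - a) = n\<^sup>2 / 2" "inner (- e) (x - b) = n\<^sup>2 / 2"
    unfolding xa by (simp_all add: n_def power2_norm_eq_inner)
  have cg: "continuous_on {0..1} g" using g(1) by (simp add: simple_path_def path_def)
  have gap: "\<exists>\<rho>>0. ball (g t) \<rho> \<inter> g ` {u..v} = {}" if "0 \<le> u" "v \<le> 1" "t \<in> {0<..<1}" "t \<notin> {u..v}" for u v t
  proof -
    have "compact (g ` {u..v})" using that by (auto intro!: compact_continuous_image continuous_on_subset[OF cg])
    then have "open (- (g ` {u..v}))" by (intro open_Compl compact_imp_closed)
    moreover have "g t \<noteq> g s" if "s \<in> {u..v}" for s
      using simple_path_eq_interior[OF g(1), of s t] that \<open>0 \<le> u\<close> \<open>v \<le> 1\<close> \<open>t \<in> {0<..<1}\<close> \<open>t \<notin> {u..v}\<close> by force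
    then have "g t \<in> - (g ` {u..v})" by blast
    ultimately obtain \<rho> where "\<rho> > 0" "ball (g t) \<rho> \<subseteq> - (g ` {u..v})" by (rule openE)
    then show ?thesis by blast
  qed
  obtain \<rho>1 where \<rho>1: "\<rho>1 > 0" "ball a \<rho>1 \<inter> g ` {\<beta>..1} = {}"
    using gap[of \<beta> 1 \<alpha>] ab(1-3) by (auto simp: a_def)
  obtain \<rho>2 where \<rho>2: "\<rho>2 > 0" "ball b \<rho>2 \<inter> g ` {0..\<alpha>} = {}"
    using gap[of 0 \<alpha> \<beta>] ab(1-3) by (auto simp: b_def)
  \<comment> \<open>\<open>n / 8\<close> is the tolerance of \<open>near_feet_injective\<close>. The
    other bounds keep feet near \<open>a\<close> off the parameters from \<open>\<beta>\<close> on,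
    and feet near \<open>b\<close> off those up to \<open>\<alpha>\<close>.\<close>
  define \<rho> where "\<rho> = min (n / 8) (min \<rho>1 \<rho>2 / 2)"
  have \<rho>: "0 < \<rho>" "\<rho> \<le> n / 8" "\<rho> < \<rho>1" "\<rho> < \<rho>2" using \<rho>1(1) \<rho>2(1) \<open>n > 0\<close> unfolding \<rho>_def by linarith+
  obtain \<delta> where \<delta>: "0 < \<delta>"
    "\<And>z c. z \<in> level \<Longrightarrow> z \<noteq> x \<Longrightarrow> dist z x \<le> \<delta> \<Longrightarrow> c \<in> \<Gamma> \<Longrightarrow> dist z c = \<epsilon> \<Longrightarrow> dist c a < \<rho> \<or> dist c b < \<rho>"
    using nearby_feet[OF x ext \<rho>(1)] unfolding a_def b_def by metis
  \<comment> \<open>The upper bounds serve, in order: \<open>nearby_feet\<close>,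
    \<open>near_feet_injective\<close>, the half plane, and the distance of the base point from the
    points of \<open>X\<close>.\<close>
  obtain s where s: "0 < s" "s \<le> \<delta>" "s \<le> n / 16" "s < \<epsilon>" "s < dist (g 0) x - 3 * \<eta>"
  proof -
    obtain s where "0 < s" "s < min (min \<delta> (n / 16)) (min \<epsilon> (dist (g 0) x - 3 * \<eta>))"
      using dense[of 0 "min (min \<delta> (n / 16)) (min \<epsilon> (dist (g 0) x - 3 * \<eta>))"] \<delta>(1) \<open>n > 0\<close> eps(1) g(4)
      by auto
    then show thesis by (intro that[of s]) auto
  qed
  define X where "X = level \<inter> cball x s"
  have X: "z \<in> level" "dist z x \<le> s" if "z \<in> X" for z using that by (auto simp: X_def dist_commute)
  have "x \<in> X" using x s by (simp add: X_def)
  \<comment> \<open>For \<open>p\<close> on \<Gamma> this says that some foot lies within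
    \<open>\<rho>\<close> of \<open>p\<close>; phrased with \<open>infdist\<close>, the condition is
    visibly closed, as gluing requires.\<close>
  define N where "N p = X \<inter> {z. infdist z (\<Gamma> \<inter> cball p \<rho>) \<le> \<epsilon>}" for p
  have "closed X" unfolding X_def using compact_level by (intro closed_Int compact_imp_closed closed_cball)
  then have cN: "closed (N p)" for p
    unfolding N_def by (intro closed_Int closed_Collect_le continuous_intros)
  have N_foot: "\<exists>c\<in>\<Gamma>. dist c p \<le> \<rho> \<and> dist z c = \<epsilon>" if "z \<in> N p" "p \<in> \<Gamma>" for z p
  proof -
    have "closed (\<Gamma> \<inter> cball p \<rho>)" "\<Gamma> \<inter> cball p \<rho> \<noteq> {}" using closed_curve that(2) \<rho>(1) by auto
    then obtain c where c: "c \<in> \<Gamma> \<inter> cball p \<rho>" "infdist z (\<Gamma> \<inter> cball p \<rho>) = dist z c"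
      using infdist_attains_inf by metis
    have "dist z c \<le> \<epsilon>" using that(1) c(2) by (simp add: N_def)
    moreover have "\<epsilon> \<le> dist z c" using level_le_dist X(1) that(1) c(1) by (simp add: N_def)
    ultimately show ?thesis using c(1) by (intro bexI[of _ c]) (auto simp: dist_commute)
  qed
  have in_N: "z \<in> N p" if "z \<in> X" "c \<in> \<Gamma>" "dist c p \<le> \<rho>" "dist z c = \<epsilon>" for z p c
    using infdist_le[of c "\<Gamma> \<inter> cball p \<rho>" z] that by (simp add: N_def dist_commute)
  have "x \<in> N a" "x \<in> N b"
    using in_N[OF \<open>x \<in> X\<close> abG(1)] in_N[OF \<open>x \<in> X\<close> abG(2)] ab \<rho>(1) by (auto simp: a_def b_def)
  have XN: "X = N a \<union> N b"
  proof
    show "X \<subseteq> N a \<union> N b"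
    proof
      fix z assume z: "z \<in> X"
      show "z \<in> N a \<union> N b"
      proof (cases "z = x")
        case False
        obtain c where c: "c \<in> \<Gamma>" "dist z c = \<epsilon>" using level_foot X(1)[OF z] by blast
        then have "dist c a < \<rho> \<or> dist c b < \<rho>" using \<delta>(2)[of z c] X[OF z] False s(2) by linarith
        then show ?thesis using in_N[OF z c(1) _ c(2)] by auto
      qed (use \<open>x \<in> N a\<close> in simp)
    qed
  qed (auto simp: N_def)
  \<comment> \<open>A point with feet near both ends would have a cell whose arc contains the given
    one. Applying \<open>foot_notin_cell_arc\<close> to both cells makes the feet equal to
    \<open>a\<close> and \<open>b\<close>, and only the midpoint has distance \<epsilon> from
    both.\<close>
  have Nab: "z = x" if za: "z \<in> N a" and zb: "z \<in> N b" for z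
  proof (rule ccontr)
    assume "z \<noteq> x"
    obtain a' where a': "a' \<in> \<Gamma>" "dist a' a \<le> \<rho>" "dist z a' = \<epsilon>" using N_foot[OF za abG(1)] by blast
    obtain b' where b': "b' \<in> \<Gamma>" "dist b' b \<le> \<rho>" "dist z b' = \<epsilon>" using N_foot[OF zb abG(2)] by blast
    obtain \<alpha>' where \<alpha>': "\<alpha>' \<in> {0..1}" "a' = g \<alpha>'" using a'(1) g(3) by (auto simp: path_image_def)
    obtain \<beta>' where \<beta>': "\<beta>' \<in> {0..1}" "b' = g \<beta>'" using b'(1) g(3) by (auto simp: path_image_def)
    have z: "z \<in> level" "dist z x \<le> s" using za X by (auto simp: N_def)
    have far: "3 * \<eta> < dist (g 0) z" using dist_triangle[of "g 0" x z] z(2) s(5) by linarith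
    have "a' \<in> ball a \<rho>1" "b' \<in> ball b \<rho>2" using a'(2) b'(2) \<rho>(3,4) by (simp_all add: dist_commute)
    then have "a' \<notin> g ` {\<beta>..1}" "b' \<notin> g ` {0..\<alpha>}" using \<rho>1(2) \<rho>2(2) by blast+
    then have "\<alpha>' \<notin> {\<beta>..1}" "\<beta>' \<notin> {0..\<alpha>}" using \<alpha>'(2) \<beta>'(2) by blast+
    then have "\<alpha>' < \<beta>" "\<alpha> < \<beta>'" using \<alpha>'(1) \<beta>'(1) by auto
    have "\<alpha>' \<notin> {\<alpha><..<\<beta>}" "\<beta>' \<notin> {\<alpha><..<\<beta>}"
      using foot_notin_cell_arc[OF cell z(1) \<open>z \<noteq> x\<close>] a'(3) b'(3) \<alpha>'(2) \<beta>'(2) by blast+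
    then have le: "\<alpha>' \<le> \<alpha>" "\<beta> \<le> \<beta>'" using \<open>\<alpha>' < \<beta>\<close> \<open>\<alpha> < \<beta>'\<close> by auto
    have g1: "g 1 = g 0" using g(2) by (simp add: pathfinish_def pathstart_def)
    have "dist z (g 0) \<noteq> \<epsilon>" using far eps_le eta_pos by (simp add: dist_commute)
    then have "\<alpha>' \<noteq> 0" "\<beta>' \<noteq> 1" using a'(3) b'(3) \<alpha>'(2) \<beta>'(2) g1 by auto
    then have "cell g \<alpha>' \<beta>' z"
      using g z(1) far le ab(2) \<alpha>' \<beta>' a'(3) b'(3) by (simp add: cell_def)
    then have "\<alpha> \<notin> {\<alpha>'<..<\<beta>'}" "\<beta> \<notin> {\<alpha>'<..<\<beta>'}"
      using foot_notin_cell_arc[of g \<alpha>' \<beta>' z x] x ab(4,5) \<open>z \<noteq> x\<close> by blast+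
    then have "\<alpha>' = \<alpha>" "\<beta>' = \<beta>" using le ab(2) by auto
    then have d: "dist z a = \<epsilon>" "dist z b = \<epsilon>" using a'(3) b'(3) \<alpha>'(2) \<beta>'(2) by (simp_all add: a_def b_def)
    have "dist a b = 2 * \<epsilon>"
      using ab(4) mid dist_midpoint(1)[of a b] by (simp add: a_def b_def dist_commute dist_midpoint)
    then show False using equidistant_antipodal_midpoint[OF d] mid \<open>z \<noteq> x\<close> by (simp add: a_def b_def)
  qed
  have inj_side: "z = z'" if zz: "z \<in> N p" "z' \<in> N p" "H z = H z'" and p: "p \<in> \<Gamma>" "inner v (x - p) = n\<^sup>2 / 2" "v = e \<or> v = - e" for z z' p v
  proof -
    have nv: "norm v = n" using p(3) by (auto simp: n_def)
    have "inj_on (\<lambda>z. inner (\<i> * v) z) (N p)"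
    proof (rule near_feet_injective[where x = x and \<epsilon> = \<epsilon>])
      show "v \<noteq> 0" using nv \<open>n > 0\<close> by auto
      fix y assume y: "y \<in> N p"
      then show "dist y x \<le> norm v / 16" using X(2)[of y] s(3) unfolding nv by (auto simp: N_def)
      obtain c where c: "c \<in> \<Gamma>" "dist c p \<le> \<rho>" "dist y c = \<epsilon>" using N_foot y p(1) by blast
      have "\<forall>w\<in>N p. \<epsilon> \<le> dist w c" using level_le_dist[OF X(1) c(1)] by (auto simp: N_def)
      then show "\<exists>c q. dist y c = \<epsilon> \<and> (\<forall>w\<in>N p. \<epsilon> \<le> dist w c) \<and> dist c q \<le> norm v / 8 \<and>
          inner v (x - q) = (norm v)\<^sup>2 / 2"
        using c(2,3) \<rho>(2) p(2) unfolding nv by (metis order.trans)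
    qed
    moreover have "inner (\<i> * v) z = inner (\<i> * v) z'" using zz(3) p(3) by (auto simp: H_def inner_diff_right)
    ultimately show ?thesis using zz(1,2) by (auto dest: inj_onD)
  qed
  have Hx: "H x = 0" by (simp add: H_def)
  have pos: "0 < \<sigma> * H z" if "z \<in> X" "z \<noteq> x" for z
  proof -
    have "dist z x < \<epsilon>" using X(2)[OF that(1)] s(4) by linarith
    then show ?thesis using \<sigma>(2) X(1)[OF that(1)] that(2) by blast
  qed
  \<comment> \<open>The sign tells the branches apart; at their only common point \<open>x\<close>
    both formulas give 0.\<close>
  define h where "h z = (if z \<in> N a then - (\<sigma> * H z) else \<sigma> * H z)" for z
  have "continuous_on X h"
    unfolding XN unfolding h_def H_def
    by (intro continuous_on_cases cN continuous_intros) (use Nab in auto)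
  moreover have "inj_on h X"
  proof (rule inj_onI)
    have neg: "h z \<le> 0" if "z \<in> N a" for z
    proof (cases "z = x")
      case True then show ?thesis using that Hx by (simp add: h_def)
    next
      case False
      then have "0 < \<sigma> * H z" using pos that by (simp add: N_def)
      then show ?thesis using that by (simp add: h_def)
    qed
    have pos': "0 < h z" if "z \<in> X" "z \<notin> N a" for z
      using pos[of z] that \<open>x \<in> N a\<close> by (auto simp: h_def)
    fix z z' assume z: "z \<in> X" "z' \<in> X" "h z = h z'"
    consider "z \<in> N a" "z' \<in> N a" | "z \<notin> N a" "z' \<notin> N a" | "z \<in> N a" "z' \<notin> N a" | "z \<notin> N a" "z' \<in> N a" by blast
    then show "z = z'"
    proof cases
      case 1
      then have "H z = H z'" using z(3) \<sigma>(1) by (auto simp: h_def)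
      then show ?thesis using inj_side[OF 1 _ abG(1) ie(1)] by simp
    next
      case 2
      then have "H z = H z'" "z \<in> N b" "z' \<in> N b" using z \<sigma>(1) XN by (auto simp: h_def)
      then show ?thesis using inj_side[of z b z' "- e"] abG(2) ie(2) by simp
    next
      case 3 then show ?thesis using neg[of z] pos'[of z'] z by simp
    next
      case 4 then show ?thesis using neg[of z'] pos'[of z] z by simp
    qed
  qed
  ultimately show ?thesis using s(1) unfolding X_def line_chart_at_def by blast
qed

theorem level_jordan_curve: "jordan_curve level"
proof (rule level_jordan_curve_from_charts)
  fix x assume x: "x \<in> level"
  obtain g \<alpha> \<beta> where ext: "extreme_feet g \<alpha> \<beta> x" by (rule ex_extreme_feet[OF x])
  then have g: "path_image g = \<Gamma>" and ab: "0 < \<alpha>" "\<alpha> \<le> \<beta>" "\<beta> < 1" "dist x (g \<alpha>) = \<epsilon>" "dist x (g \<beta>) = \<epsilon>"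
    unfolding extreme_feet_def by blast+
  show "line_chart_at level x"
  proof (cases "x = midpoint (g \<alpha>) (g \<beta>)")
    case True
    then show ?thesis by (rule chart_if_antipodal[OF x ext])
  next
    case False
    have "\<alpha> \<in> {0..1}" using ab(1-3) by simp
    then have "g \<alpha> \<in> \<Gamma>" using g unfolding path_image_def by blast
    then show ?thesis
    proof (rule chart_if_not_antipodal[OF x ab(4,5) False])
      fix \<rho> :: real assume "0 < \<rho>"
      then obtain \<delta> where "0 < \<delta>" "\<And>z c. z \<in> level \<Longrightarrow> z \<noteq> x \<Longrightarrow> dist z x \<le> \<delta> \<Longrightarrow> c \<in> \<Gamma> \<Longrightarrow>
          dist z c = \<epsilon> \<Longrightarrow> dist c (g \<alpha>) < \<rho> \<or> dist c (g \<beta>) < \<rho>"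
        using nearby_feet[OF x ext] by blast
      then show "\<exists>\<delta>>0. \<forall>z c. z \<in> level \<longrightarrow> z \<noteq> x \<longrightarrow> dist z x \<le> \<delta> \<longrightarrow> c \<in> \<Gamma> \<longrightarrow>
          dist z c = \<epsilon> \<longrightarrow> dist c (g \<alpha>) < \<rho> \<or> dist c (g \<beta>) < \<rho>"
        by (intro exI[of _ \<delta>]) simp
    qed
  qed
qed

end

subsection \<open>Small arcs and the chordal property\<close>

lemma connected_inv_into_image:
  fixes f :: "real \<Rightarrow> 'a::t2_space"
  assumes "compact K" "continuous_on K f" "inj_on f K" "connected C" "C \<subseteq> f ` K"
  shows "connected (inv_into K f ` C)"
proof -
  have "continuous_on (f ` K) (inv_into K f)"
    using assms(1-3) by (intro continuous_on_inv) auto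
  then show ?thesis using assms(4,5) by (intro connected_continuous_image) (auto intro: continuous_on_subset)
qed

text \<open>Away from the base point \<open>g\<close> is injective, so the parameters of the arc
  form a connected set containing \<open>\<alpha>\<close> and \<open>\<beta>\<close>. Conversely,
  the piece of \<open>g\<close> between them pulls back under \<open>q\<close> to a connected set
  containing 0 and 1.\<close>

lemma arc_in_simple_closed_curve_unique:
  fixes g q :: "real \<Rightarrow> 'a::euclidean_space"
  assumes g: "simple_path g" "pathfinish g = pathstart g"
    and ab: "0 < \<alpha>" "\<alpha> < \<beta>" "\<beta> < 1"
    and q: "arc q" "pathstart q = g \<alpha>" "pathfinish q = g \<beta>" "path_image q \<subseteq> path_image g" "g 0 \<notin> path_image q"
  shows "path_image q = g ` {\<alpha>..\<beta>}"
proof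
  have cg: "continuous_on {0..1} g" using g(1) by (simp add: simple_path_def path_def)
  have cq: "continuous_on {0..1} q" "inj_on q {0..1}" using q(1) by (simp_all add: arc_def path_def)
  have q01: "q 0 = g \<alpha>" "q 1 = g \<beta>" using q(2,3) by (simp_all add: pathstart_def pathfinish_def)
  have g1: "g 1 = g 0" using g(2) by (simp add: pathstart_def pathfinish_def)
  define T where "T = {0..1} \<inter> g -` path_image q"
  have "closed T" unfolding T_def
    using cg q(1) by (intro continuous_closed_preimage) (auto simp: closed_arc_image)
  then have "compact T" by (auto simp: T_def compact_eq_bounded_closed intro: bounded_subset[OF bounded_closed_interval])
  have "0 \<notin> T" "1 \<notin> T" using q(5) g1 by (auto simp: T_def)
  then have T01: "T \<subseteq> {0<..<1}" by (auto simp: T_def less_le)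
  have injT: "inj_on g T" using simple_path_inj_on[OF g(1)] T01 inj_on_subset by blast
  have gT: "g ` T = path_image q"
  proof (intro equalityI subsetI)
    fix y assume y: "y \<in> path_image q"
    then have "y \<in> g ` {0..1}" using q(4) unfolding path_image_def[of g] by blast
    then obtain t where "t \<in> {0..1}" "y = g t" by blast
    then show "y \<in> g ` T" using y by (simp add: T_def)
  qed (auto simp: T_def)
  have "connected (path_image q)" using q(1) by (simp add: connected_arc_image)
  then have "connected (inv_into T g ` (g ` T))"
    using \<open>compact T\<close> injT gT
    by (intro connected_inv_into_image continuous_on_subset[OF cg]) (auto simp: T_def)
  then have "connected T" using injT by simp
  moreover have "\<alpha> \<in> T" "\<beta> \<in> T"
    using ab q(2,3) pathstart_in_path_image[of q] pathfinish_in_path_image[of q] by (auto simp: T_def)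
  ultimately have sub: "{\<alpha>..\<beta>} \<subseteq> T" using connected_contains_Icc by blast
  then show sub': "g ` {\<alpha>..\<beta>} \<subseteq> path_image q" using gT by blast
  have "{\<alpha>..\<beta>} \<subseteq> {0..1}" using sub T_def by blast
  then have "connected (g ` {\<alpha>..\<beta>})"
    by (intro connected_continuous_image continuous_on_subset[OF cg]) auto
  then have con: "connected (inv_into {0..1} q ` g ` {\<alpha>..\<beta>})"
    using cq sub' by (intro connected_inv_into_image) (auto simp: path_image_def)
  have "0 = inv_into {0..1} q (g \<alpha>)" "1 = inv_into {0..1} q (g \<beta>)"
    unfolding q01[symmetric] using cq(2) by simp_all
  then have "0 \<in> inv_into {0..1} q ` g ` {\<alpha>..\<beta>}" "1 \<in> inv_into {0..1} q ` g ` {\<alpha>..\<beta>}"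
    using ab by (auto intro!: imageI)
  then have "{0..1} \<subseteq> inv_into {0..1} q ` g ` {\<alpha>..\<beta>}" using connected_contains_Icc[OF con] by blast
  then have "q ` {0..1} \<subseteq> q ` inv_into {0..1} q ` g ` {\<alpha>..\<beta>}" by (rule image_mono)
  also have "\<dots> = g ` {\<alpha>..\<beta>}"
    using image_inv_into_cancel[of q "{0..1}" "path_image q"] sub' by (simp add: path_image_def)
  finally show "path_image q \<subseteq> g ` {\<alpha>..\<beta>}" by (simp add: path_image_def)
qed

text \<open>\<Gamma> is locally path connected, so it has an open cover such that two points in one
  member are joined by an arc inside a disc of radius \<open>\<eta> / 2\<close>. A Lebesgue number
  of the cover serves as \<open>\<delta>\<close>.\<close>

lemma jordan_curve_small_arcs:
  fixes \<Gamma> :: "complex set"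
  assumes "jordan_curve \<Gamma>" "0 < \<eta>"
  obtains \<delta> where "0 < \<delta>" "\<And>a b. a \<in> \<Gamma> \<Longrightarrow> b \<in> \<Gamma> \<Longrightarrow> a \<noteq> b \<Longrightarrow> dist a b < \<delta> \<Longrightarrow>
     \<exists>A\<in>subarcs \<Gamma> a b. diameter A \<le> \<eta>"
proof -
  obtain g where g: "simple_path g" "pathfinish g = pathstart g" "path_image g = \<Gamma>"
    using assms(1) unfolding jordan_curve_def by blast
  have "compact \<Gamma>" "\<Gamma> \<noteq> {}" using g compact_simple_path_image[OF g(1)] path_image_nonempty[of g] by auto
  have "\<Gamma> homeomorphic sphere (0::complex) 1"
    using homeomorphic_simple_path_image_circle[OF g(1,2), of 1 0] g(3) by simp
  then have "locally path_connected \<Gamma> \<longleftrightarrow> locally path_connected (sphere (0::complex) 1)"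
    by (rule homeomorphic_locally) (rule homeomorphic_path_connectedness)
  then have lpc: "locally path_connected \<Gamma>" by (simp add: locally_path_connected_sphere)
  have "\<exists>U. open U \<and> c \<in> U \<and> (\<exists>v. path_connected v \<and> \<Gamma> \<inter> U \<subseteq> v \<and> v \<subseteq> \<Gamma> \<inter> ball c (\<eta> / 2))" if "c \<in> \<Gamma>" for c
  proof -
    have "openin (top_of_set \<Gamma>) (\<Gamma> \<inter> ball c (\<eta> / 2))" "c \<in> \<Gamma> \<inter> ball c (\<eta> / 2)"
      using that assms(2) by (auto simp: openin_open_Int)
    then obtain u v where "openin (top_of_set \<Gamma>) u" "path_connected v" "c \<in> u" "u \<subseteq> v" "v \<subseteq> \<Gamma> \<inter> ball c (\<eta> / 2)"
      using lpc unfolding locally_def by meson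
    moreover from this(1) obtain W where "open W" "u = \<Gamma> \<inter> W" unfolding openin_open by blast
    ultimately show ?thesis by (intro exI[of _ W] conjI exI[of _ v]) auto
  qed
  then obtain U where U: "\<And>c. c \<in> \<Gamma> \<Longrightarrow> open (U c) \<and> c \<in> U c \<and>
      (\<exists>v. path_connected v \<and> \<Gamma> \<inter> U c \<subseteq> v \<and> v \<subseteq> \<Gamma> \<inter> ball c (\<eta> / 2))" by metis
  have "U ` \<Gamma> \<noteq> {}" "\<Gamma> \<subseteq> \<Union> (U ` \<Gamma>)" "\<And>B. B \<in> U ` \<Gamma> \<Longrightarrow> open B" using U \<open>\<Gamma> \<noteq> {}\<close> by blast+
  then obtain \<delta> where \<delta>: "0 < \<delta>" "\<And>T. T \<subseteq> \<Gamma> \<Longrightarrow> diameter T < \<delta> \<Longrightarrow> \<exists>B\<in>U ` \<Gamma>. T \<subseteq> B"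
    using Lebesgue_number_lemma[OF \<open>compact \<Gamma>\<close>] by metis
  show thesis
  proof (rule that[OF \<delta>(1)])
    fix a b assume ab: "a \<in> \<Gamma>" "b \<in> \<Gamma>" "a \<noteq> b" "dist a b < \<delta>"
    have "diameter {a, b} \<le> dist a b"
      by (rule diameter_le) (auto simp: dist_norm norm_minus_commute)
    then have "diameter {a, b} < \<delta>" "{a, b} \<subseteq> \<Gamma>" using ab by simp_all
    then obtain c where c: "c \<in> \<Gamma>" "{a, b} \<subseteq> U c" using \<delta>(2)[of "{a, b}"] by blast
    then obtain v where v: "path_connected v" "\<Gamma> \<inter> U c \<subseteq> v" "v \<subseteq> \<Gamma> \<inter> ball c (\<eta> / 2)" using U by blast
    then obtain q where q: "arc q" "path_image q \<subseteq> v" "pathstart q = a" "pathfinish q = b"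
    proof -
      have "a \<in> v" "b \<in> v" using v(2) ab c(2) by blast+
      then show ?thesis using that v(1) ab(3) unfolding path_connected_arcwise by blast
    qed
    have "diameter (path_image q) \<le> \<eta>"
    proof (rule diameter_le)
      fix x y assume "x \<in> path_image q" "y \<in> path_image q"
      then have "dist c x < \<eta> / 2" "dist c y < \<eta> / 2" using q(2) v(3) by auto
      then show "norm (x - y) \<le> \<eta>" using dist_triangle[of x y c] by (simp add: dist_norm norm_minus_commute)
    qed (use assms(2) in auto)
    moreover have "path_image q \<in> subarcs \<Gamma> a b" unfolding subarcs_def using q v(3) by blast
    ultimately show "\<exists>A\<in>subarcs \<Gamma> a b. diameter A \<le> \<eta>" by blast
  qed
qed

text \<open>The nearest point \<open>w\<close> of the line has height zero over the chord, so the
  height of \<open>z\<close> is that of \<open>z - w\<close>.\<close>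

lemma Im_chord_le_infdist:
  fixes z a b :: complex
  shows "\<bar>Im ((z - a) * cnj (b - a))\<bar> \<le> infdist z (affine hull {a, b}) * dist a b"
proof -
  have "closed (affine hull {a, b})" "affine hull {a, b} \<noteq> {}" by (auto simp: closed_affine_hull)
  then obtain w where w: "w \<in> affine hull {a, b}" "infdist z (affine hull {a, b}) = dist z w"
    using infdist_attains_inf by metis
  obtain u v where uv: "u + v = 1" "w = u *\<^sub>R a + v *\<^sub>R b" using w(1) unfolding affine_hull_2 by auto
  have "u = 1 - v" using uv by simp
  then have "w - a = complex_of_real v * (b - a)" unfolding uv(2) \<open>u = 1 - v\<close> by (simp add: scaleR_conv_of_real algebra_simps)
  then have "(w - a) * cnj (b - a) = complex_of_real (v * (norm (b - a))\<^sup>2)"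
    using complex_norm_square[of "b - a"] by simp
  then have "Im ((w - a) * cnj (b - a)) = 0" by (simp only: Im_complex_of_real)
  moreover have "(z - a) * cnj (b - a) = (z - w) * cnj (b - a) + (w - a) * cnj (b - a)"
    by (simp add: algebra_simps)
  ultimately have "Im ((z - a) * cnj (b - a)) = Im ((z - w) * cnj (b - a))"
    by (simp only: plus_complex.sel)
  then have "\<bar>Im ((z - a) * cnj (b - a))\<bar> \<le> norm ((z - w) * cnj (b - a))"
    using abs_Im_le_cmod by metis
  also have "\<dots> = dist z w * dist a b" unfolding norm_mult complex_mod_cnj by (simp add: dist_norm norm_minus_commute)
  finally show ?thesis by (simp add: w(2))
qed

lemma chordal_property_strip:
  fixes \<Gamma> :: "'a::euclidean_space set"
  assumes "chordal_property \<zeta> r0 \<Gamma>"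
  obtains A where "smaller_subarc_choice \<Gamma> A"
    "\<And>a b z. a \<in> \<Gamma> \<Longrightarrow> b \<in> \<Gamma> \<Longrightarrow> a \<noteq> b \<Longrightarrow> dist a b \<le> r0 \<Longrightarrow> z \<in> A a b \<Longrightarrow>
       infdist z (affine hull {a, b}) \<le> \<zeta> * dist a b"
proof -
  obtain A where A: "smaller_subarc_choice \<Gamma> A"
    "(SUP (x, y)\<in>{(x, y). x \<in> \<Gamma> \<and> y \<in> \<Gamma> \<and> 0 < dist x y \<and> dist x y \<le> r0}. ereal (chordal_ratio A x y)) \<le> ereal \<zeta>"
    using assms unfolding chordal_property_def by blast
  show thesis
  proof (rule that[OF A(1)])
    fix a b z assume ab: "a \<in> \<Gamma>" "b \<in> \<Gamma>" "a \<noteq> b" "dist a b \<le> r0" and z: "z \<in> A a b"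
    define P where "P = {(x, y). x \<in> \<Gamma> \<and> y \<in> \<Gamma> \<and> 0 < dist x y \<and> dist x y \<le> r0}"
    have "(a, b) \<in> P" using ab by (simp add: P_def)
    then have "(case (a, b) of (x, y) \<Rightarrow> ereal (chordal_ratio A x y)) \<le> ereal \<zeta>"
      using order.trans[OF SUP_upper A(2)[folded P_def]] by blast
    then have le: "chordal_ratio A a b \<le> \<zeta>" by simp
    have "A a b \<in> subarcs \<Gamma> a b" using A(1) ab unfolding smaller_subarc_choice_def by blast
    then obtain q where q: "arc q" "A a b = path_image q" unfolding subarcs_def by blast
    have "compact (A a b)" unfolding q(2) using q(1) by (rule compact_arc_image)
    then have "compact ((\<lambda>z. infdist z (affine hull {a, b})) ` A a b)"
      by (intro compact_continuous_image continuous_intros)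
    \<comment> \<open>Boundedness ensures that the real supremum in \<open>chordal_ratio\<close> is
      an upper bound.\<close>
    then have "bdd_above ((\<lambda>z. infdist z (affine hull {a, b})) ` A a b)"
      by (intro bounded_imp_bdd_above compact_imp_bounded)
    then have "infdist z (affine hull {a, b}) \<le> (SUP z\<in>A a b. infdist z (affine hull {a, b}))"
      using z by (intro cSUP_upper)
    also have "\<dots> = chordal_ratio A a b * dist a b" using ab(3) by (simp add: chordal_ratio_def)
    also have "\<dots> \<le> \<zeta> * dist a b" using le by (intro mult_right_mono) auto
    finally show "infdist z (affine hull {a, b}) \<le> \<zeta> * dist a b" .
  qed
qed

text \<open>For close points the smaller subarc has diameter at most \<eta>, so it misses a base
  point farther than \<eta> from \<open>a\<close>. It is therefore the image of the parameter
  interval, which inherits the chordal bound.\<close>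

lemma chordal_curve_if_chordal_property:
  fixes \<Gamma> :: "complex set"
  assumes "jordan_curve \<Gamma>" "0 < r0" "chordal_property (1 / 2) r0 \<Gamma>"
  obtains r \<eta> where "chordal_curve \<Gamma> r \<eta>"
proof -
  obtain A where A: "smaller_subarc_choice \<Gamma> A"
    "\<And>a b z. a \<in> \<Gamma> \<Longrightarrow> b \<in> \<Gamma> \<Longrightarrow> a \<noteq> b \<Longrightarrow> dist a b \<le> r0 \<Longrightarrow> z \<in> A a b \<Longrightarrow>
       infdist z (affine hull {a, b}) \<le> 1 / 2 * dist a b"
    using chordal_property_strip[OF assms(3)] by metis
  obtain g0 where g0: "simple_path g0" "path_image g0 = \<Gamma>"
    using assms(1) unfolding jordan_curve_def by blast
  define p q where "p = g0 (1 / 3)" and "q = g0 (2 / 3)"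
  have pq: "p \<in> \<Gamma>" "q \<in> \<Gamma>" unfolding g0(2)[symmetric] path_image_def p_def q_def by (intro imageI; simp)+
  have "p \<noteq> q"
    using inj_onD[OF simple_path_inj_on[OF g0(1)], of "1 / 3" "2 / 3"] by (auto simp: p_def q_def)
  \<comment> \<open>With the denominator 7, \<open>p\<close> and \<open>q\<close> cannot both lie
    within \<open>3 * \<eta>\<close> of one point.\<close>
  define \<eta> where "\<eta> = dist p q / 7"
  have "0 < \<eta>" using \<open>p \<noteq> q\<close> by (simp add: \<eta>_def)
  obtain \<delta> where \<delta>: "0 < \<delta>" "\<And>a b. a \<in> \<Gamma> \<Longrightarrow> b \<in> \<Gamma> \<Longrightarrow> a \<noteq> b \<Longrightarrow> dist a b < \<delta> \<Longrightarrow>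
     \<exists>A\<in>subarcs \<Gamma> a b. diameter A \<le> \<eta>"
    using jordan_curve_small_arcs[OF assms(1) \<open>0 < \<eta>\<close>] by metis
  define r where "r = min (min r0 \<eta>) (\<delta> / 2)"
  have r: "0 < r" "r \<le> r0" "r \<le> \<eta>" "r < \<delta>"
    using assms(2) \<open>0 < \<eta>\<close> \<delta>(1) by (simp_all add: r_def min_less_iff_disj)
  have "chordal_curve \<Gamma> r \<eta>"
  proof
    show "\<exists>f\<in>\<Gamma>. 3 * \<eta> < dist f c" for c
    proof (rule ccontr)
      assume "\<not> ?thesis"
      then have "dist p c \<le> 3 * \<eta>" "dist q c \<le> 3 * \<eta>" using pq by force+
      then have "dist p q \<le> 6 * \<eta>" using dist_triangle[of p q c] by (simp add: dist_commute)
      then show False using \<open>0 < \<eta>\<close> by (simp add: \<eta>_def)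
    qed
    fix g :: "real \<Rightarrow> complex" and \<alpha> \<beta> :: real
    assume g: "simple_path g" "pathfinish g = pathstart g" "path_image g = \<Gamma>"
      and ab: "0 < \<alpha>" "\<alpha> < \<beta>" "\<beta> < 1" and d: "dist (g \<alpha>) (g \<beta>) \<le> r" and far: "\<eta> < dist (g 0) (g \<alpha>)"
    define a b where "a = g \<alpha>" and "b = g \<beta>"
    have "{\<alpha>, \<beta>} \<subseteq> {0..1}" using ab by auto
    then have abG: "a \<in> \<Gamma>" "b \<in> \<Gamma>" unfolding g(3)[symmetric] path_image_def a_def b_def by blast+
    have "\<alpha> \<in> {0<..<1}" "\<beta> \<in> {0<..<1}" "\<alpha> \<noteq> \<beta>" using ab by auto
    then have "a \<noteq> b" unfolding a_def b_def using simple_path_inj_on[OF g(1)] inj_onD by metis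
    have choice: "A a b \<in> subarcs \<Gamma> a b" "\<And>B. B \<in> subarcs \<Gamma> a b \<Longrightarrow> diameter (A a b) \<le> diameter B"
      using A(1) abG \<open>a \<noteq> b\<close> unfolding smaller_subarc_choice_def by blast+
    then obtain k where k: "A a b = path_image k" "arc k" "pathstart k = a" "pathfinish k = b" "path_image k \<subseteq> \<Gamma>"
      unfolding subarcs_def by blast
    have "dist a b < \<delta>" using d r(4) by (simp add: a_def b_def)
    then have diam: "diameter (A a b) \<le> \<eta>" using \<delta>(2)[OF abG \<open>a \<noteq> b\<close>] choice(2) by force
    have "bounded (A a b)" unfolding k(1) using k(2) by (simp add: bounded_arc_image)
    moreover have "a \<in> A a b" using k(1,3) pathstart_in_path_image[of k] by simp
    ultimately have sub: "A a b \<subseteq> cball a \<eta>"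
      using diameter_bounded_bound[of "A a b" a] diam by force
    then have "g 0 \<notin> A a b" using far by (auto simp: a_def dist_commute)
    then have eq: "A a b = g ` {\<alpha>..\<beta>}"
      unfolding k(1) using k g ab by (intro arc_in_simple_closed_curve_unique) (simp_all add: a_def b_def)
    have "\<bar>Im ((z - a) * cnj (b - a))\<bar> \<le> (dist a b)\<^sup>2 / 2" if "z \<in> A a b" for z
    proof -
      have "infdist z (affine hull {a, b}) \<le> 1 / 2 * dist a b"
        using A(2)[OF abG \<open>a \<noteq> b\<close> _ that] d r(2) by (simp add: a_def b_def)
      then have "infdist z (affine hull {a, b}) * dist a b \<le> 1 / 2 * dist a b * dist a b"
        by (rule mult_right_mono) simp
      then show ?thesis using Im_chord_le_infdist[of z a b] by (simp add: power2_eq_square)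
    qed
    then show "g ` {\<alpha>..\<beta>} \<subseteq> cball (g \<alpha>) \<eta> \<and>
      (\<forall>z\<in>g ` {\<alpha>..\<beta>}. \<bar>Im ((z - g \<alpha>) * cnj (g \<beta> - g \<alpha>))\<bar> \<le> (dist (g \<alpha>) (g \<beta>))\<^sup>2 / 2)"
      using sub unfolding a_def[symmetric] b_def[symmetric] eq[symmetric] by blast
  qed (use assms r in auto)
  then show thesis by (rule that)
qed

subsection \<open>Transfer from the complex plane\<close>

lemma jordan_domain_eq_inside:
  fixes \<Gamma> :: "complex set"
  assumes "jordan_curve \<Gamma>"
  shows "jordan_domain \<Gamma> = inside \<Gamma>" "\<exists>!\<Omega>. \<Omega> \<in> components (- \<Gamma>) \<and> bounded \<Omega>"
proof -
  obtain g where g: "simple_path g" "pathfinish g = pathstart g" "path_image g = \<Gamma>"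
    using assms unfolding jordan_curve_def by blast
  note J = Jordan_inside_outside[OF g(1,2), unfolded g(3)]
  have io: "inside \<Gamma> \<in> components (- \<Gamma>)" "outside \<Gamma> \<in> components (- \<Gamma>)" "bounded (inside \<Gamma>)" "\<not> bounded (outside \<Gamma>)"
    using J by (simp_all add: inside_in_components outside_in_components)
  have uniq: "\<Omega> = inside \<Gamma>" if "\<Omega> \<in> components (- \<Gamma>)" "bounded \<Omega>" for \<Omega>
  proof -
    have "\<Omega> \<noteq> outside \<Gamma>" using that io by blast
    then have "\<Omega> \<inter> outside \<Gamma> = {}" using components_nonoverlap[OF that(1) io(2)] by blast
    moreover have "\<Omega> \<noteq> {}" "\<Omega> \<subseteq> - \<Gamma>" using that(1) in_components_nonempty in_components_subset by blast+
    moreover have "inside \<Gamma> \<union> outside \<Gamma> = - \<Gamma>" by simp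
    ultimately have "\<Omega> \<inter> inside \<Gamma> \<noteq> {}" by blast
    then show ?thesis using components_nonoverlap[OF that(1) io(1)] by blast
  qed
  show "jordan_domain \<Gamma> = inside \<Gamma>"
    unfolding jordan_domain_def by (rule the_equality) (use io uniq in blast)+
  show "\<exists>!\<Omega>. \<Omega> \<in> components (- \<Gamma>) \<and> bounded \<Omega>"
    by (rule ex1I[of _ "inside \<Gamma>"]) (use io uniq in blast)+
qed

lemma (in chordal_curve) level_jordan_curve_property: "level_jordan_curve_property \<Gamma>"
proof -
  obtain g where g: "simple_path g" "pathfinish g = pathstart g" "path_image g = \<Gamma>"
    using curve unfolding jordan_curve_def by blast
  note J = Jordan_inside_outside[OF g(1,2), unfolded g(3)]
  note dom = jordan_domain_eq_inside(1)[OF curve]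
  obtain p where p: "p \<in> inside \<Gamma>" using J by blast
  then have "p \<notin> \<Gamma>" using inside_no_overlap by blast
  then have "infdist p \<Gamma> > 0"
    using in_closed_iff_infdist_zero[OF closed_curve compact_curve(2), of p] infdist_nonneg[of p \<Gamma>] by linarith
  \<comment> \<open>The second bound makes \<open>p\<close> a point of the superlevel set for every
    positive level considered.\<close>
  define e0 where "e0 = min (r / 2) (infdist p \<Gamma> / 2)"
  have e0: "0 < e0" "2 * e0 \<le> r" "e0 < infdist p \<Gamma>" using \<open>infdist p \<Gamma> > 0\<close> r_pos unfolding e0_def by linarith+
  have "jordan_curve (level_set \<Gamma> \<epsilon>)" if "0 < \<bar>\<epsilon>\<bar>" "\<bar>\<epsilon>\<bar> \<le> e0" for \<epsilon>
  proof (cases "\<epsilon> > 0")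
    case True
    interpret offset_level \<Gamma> r \<eta> "inside \<Gamma>" "outside \<Gamma>" \<epsilon>
    proof unfold_locales
      show "2 * \<epsilon> \<le> r" using that e0 by linarith
      have "\<epsilon> < infdist p \<Gamma>" using that e0 by linarith
      then show "\<exists>q\<in>inside \<Gamma>. \<epsilon> < infdist q \<Gamma>" using p by blast
    qed (use True in auto)
    have "signed_dist x \<Gamma> = \<epsilon> \<longleftrightarrow> x \<in> inside \<Gamma> \<and> infdist x \<Gamma> = \<epsilon>" for x
      using True infdist_nonneg[of x \<Gamma>] unfolding signed_dist_def dom by (cases "x \<in> inside \<Gamma>") simp_all
    then have "level_set \<Gamma> \<epsilon> = level" unfolding level_set_def level_def by blast
    then show ?thesis using level_jordan_curve by simp
  next
    case False
    then have neg: "\<epsilon> < 0" using that by linarith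
    interpret offset_level \<Gamma> r \<eta> "outside \<Gamma>" "inside \<Gamma>" "- \<epsilon>"
    proof unfold_locales
      show "2 * - \<epsilon> \<le> r" using that e0 neg by linarith
      \<comment> \<open>The outside is unbounded and \<Gamma> is bounded, so every distance is
        exceeded in the outside.\<close>
      obtain R where R: "\<And>c. c \<in> \<Gamma> \<Longrightarrow> norm c \<le> R"
        using compact_imp_bounded[OF compact_curve(1)] unfolding bounded_iff by blast
      have "\<not> bounded (outside \<Gamma>)" using J by blast
      then obtain q where q: "q \<in> outside \<Gamma>" "R - \<epsilon> < norm q"
        unfolding bounded_iff using not_le by blast
      obtain c where c: "c \<in> \<Gamma>" "infdist q \<Gamma> = dist q c"
        using infdist_attains_inf[OF closed_curve compact_curve(2)] by metis
      have "- \<epsilon> < infdist q \<Gamma>"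
        using c R[OF c(1)] q(2) norm_triangle_sub[of q c] by (simp add: dist_norm)
      then show "\<exists>q\<in>outside \<Gamma>. - \<epsilon> < infdist q \<Gamma>" using q(1) by blast
    qed (use neg in auto)
    have "signed_dist x \<Gamma> = \<epsilon> \<longleftrightarrow> x \<in> outside \<Gamma> \<and> infdist x \<Gamma> = - \<epsilon>" for x
    proof -
      have "x \<in> outside \<Gamma> \<Longrightarrow> x \<notin> inside \<Gamma>" using inside_Int_outside[of \<Gamma>] by blast
      moreover have "infdist x \<Gamma> = - \<epsilon> \<Longrightarrow> x \<notin> \<Gamma>" using neg by auto
      moreover have "x \<notin> \<Gamma> \<Longrightarrow> x \<notin> inside \<Gamma> \<Longrightarrow> x \<in> outside \<Gamma>" using inside_Un_outside[of \<Gamma>] by blast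
      moreover have "signed_dist x \<Gamma> = \<epsilon> \<longleftrightarrow> x \<notin> inside \<Gamma> \<and> infdist x \<Gamma> = - \<epsilon>"
        using neg infdist_nonneg[of x \<Gamma>] unfolding signed_dist_def dom by (cases "x \<in> inside \<Gamma>") (simp_all, linarith)
      ultimately show ?thesis by blast
    qed
    then have "level_set \<Gamma> \<epsilon> = level" unfolding level_set_def level_def by blast
    then show ?thesis using level_jordan_curve by simp
  qed
  then show ?thesis unfolding level_jordan_curve_property_def using e0(1) by blast
qed

text \<open>The assumptions are symmetric under exchanging the two maps (\<open>flip\<close>), so
  each transport lemma also serves the inverse.\<close>

locale isometric_isomorphism =
  fixes f :: "'a::euclidean_space \<Rightarrow> 'b::euclidean_space" and f' :: "'b \<Rightarrow> 'a"
  assumes linear_f: "linear f" and linear_f': "linear f'"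
    and inverse: "\<And>x. f' (f x) = x" "\<And>y. f (f' y) = y"
    and norm_f: "\<And>x. norm (f x) = norm x"
begin

lemma dist_f: "dist (f x) (f y) = dist x y"
  by (metis dist_norm linear_diff linear_f norm_f)

lemma inj_f: "inj f" using inverse(1) by (rule inj_on_inverseI)

lemma surj_f: "range f = UNIV" using inverse(2) by (metis surjI)

lemma flip: "isometric_isomorphism f' f"
proof (rule isometric_isomorphism.intro)
  show "norm (f' y) = norm y" for y using norm_f[of "f' y"] inverse(2) by simp
qed (fact linear_f linear_f' inverse)+

lemma image_f'_f: "f' ` f ` A = A" by (simp add: image_image inverse(1))

lemma infdist_f: "infdist (f x) (f ` A) = infdist x A"
  by (simp add: infdist_def image_image dist_f)

lemma diameter_f: "diameter (f ` A) = diameter A"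
proof -
  have "(\<lambda>(x, y). dist x y) ` (f ` A \<times> f ` A) = (\<lambda>(x, y). dist x y) ` (A \<times> A)"
    by (force simp: dist_f image_iff)
  then show ?thesis by (simp add: diameter_def)
qed

lemma jordan_curve_f:
  assumes "jordan_curve A"
  shows "jordan_curve (f ` A)"
proof -
  obtain g where g: "simple_path g" "pathfinish g = pathstart g" "path_image g = A"
    using assms unfolding jordan_curve_def by blast
  have "simple_path (f \<circ> g)" using g(1) simple_path_linear_image_eq[OF linear_f inj_f] by blast
  moreover have "pathfinish (f \<circ> g) = pathstart (f \<circ> g)" using g(2) by (simp add: pathfinish_compose pathstart_compose)
  moreover have "path_image (f \<circ> g) = f ` A" using g(3) by (simp add: path_image_compose)
  ultimately show ?thesis unfolding jordan_curve_def by blast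
qed

lemma subarcs_f:
  assumes "A \<in> subarcs \<Gamma> x y"
  shows "f ` A \<in> subarcs (f ` \<Gamma>) (f x) (f y)"
proof -
  obtain g where g: "A = path_image g" "arc g" "pathstart g = x" "pathfinish g = y" "path_image g \<subseteq> \<Gamma>"
    using assms unfolding subarcs_def by blast
  have "arc (f \<circ> g)" using g(2) arc_linear_image_eq[OF linear_f inj_f] by blast
  moreover have "path_image (f \<circ> g) = f ` A" "path_image (f \<circ> g) \<subseteq> f ` \<Gamma>" "pathstart (f \<circ> g) = f x" "pathfinish (f \<circ> g) = f y"
    using g by (auto simp: path_image_compose pathfinish_compose pathstart_compose)
  ultimately show ?thesis unfolding subarcs_def by (metis (mono_tags, lifting) mem_Collect_eq)
qed

lemma chordal_property_f:
  assumes "chordal_property \<zeta> r0 \<Gamma>"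
  shows "chordal_property \<zeta> r0 (f ` \<Gamma>)"
proof -
  interpret g: isometric_isomorphism f' f by (rule flip)
  obtain A where A: "smaller_subarc_choice \<Gamma> A"
    "(SUP (x, y)\<in>{(x, y). x \<in> \<Gamma> \<and> y \<in> \<Gamma> \<and> 0 < dist x y \<and> dist x y \<le> r0}. ereal (chordal_ratio A x y)) \<le> ereal \<zeta>"
    using assms unfolding chordal_property_def by blast
  \<comment> \<open>The choice of subarcs is conjugated by the isometry; competing arcs are pulled
    back to compare diameters.\<close>
  define A' where "A' u v = f ` A (f' u) (f' v)" for u v
  have "smaller_subarc_choice (f ` \<Gamma>) A'"
    unfolding smaller_subarc_choice_def
  proof (intro ballI impI conjI)
    fix u v assume uv: "u \<in> f ` \<Gamma>" "v \<in> f ` \<Gamma>" "u \<noteq> v"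
    then obtain x y where xy: "x \<in> \<Gamma>" "y \<in> \<Gamma>" "u = f x" "v = f y" by blast
    then have "x \<noteq> y" using uv(3) by blast
    then have c: "A x y \<in> subarcs \<Gamma> x y" "\<And>B. B \<in> subarcs \<Gamma> x y \<Longrightarrow> diameter (A x y) \<le> diameter B"
      using A(1) xy unfolding smaller_subarc_choice_def by blast+
    have A': "A' u v = f ` A x y" by (simp add: A'_def xy inverse(1))
    show "A' u v \<in> subarcs (f ` \<Gamma>) u v" using subarcs_f[OF c(1)] A' xy by simp
    fix B assume "B \<in> subarcs (f ` \<Gamma>) u v"
    then have "f' ` B \<in> subarcs \<Gamma> x y" using g.subarcs_f[of B "f ` \<Gamma>" u v] by (simp add: image_f'_f xy inverse(1))
    then show "diameter (A' u v) \<le> diameter B" using c(2)[of "f' ` B"] by (simp add: A' diameter_f g.diameter_f)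
  qed
  moreover have ratio: "chordal_ratio A' (f x) (f y) = chordal_ratio A x y" for x y
  proof -
    have "f ` (affine hull {x, y}) = affine hull {f x, f y}"
      using affine_hull_linear_image[of f "{x, y}"] linear_f by (simp add: linear_conv_bounded_linear)
    then have "infdist (f z) (affine hull {f x, f y}) = infdist z (affine hull {x, y})" for z
      using infdist_f by metis
    then show ?thesis by (simp add: chordal_ratio_def A'_def inverse(1) image_image dist_f)
  qed
  have "(SUP (x, y)\<in>{(x, y). x \<in> f ` \<Gamma> \<and> y \<in> f ` \<Gamma> \<and> 0 < dist x y \<and> dist x y \<le> r0}. ereal (chordal_ratio A' x y)) \<le> ereal \<zeta>"
  proof (intro SUP_least, clarify)
    fix x y assume xy: "x \<in> \<Gamma>" "y \<in> \<Gamma>" "0 < dist (f x) (f y)" "dist (f x) (f y) \<le> r0"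
    define P where "P = {(x, y). x \<in> \<Gamma> \<and> y \<in> \<Gamma> \<and> 0 < dist x y \<and> dist x y \<le> r0}"
    have "(x, y) \<in> P" using xy by (simp add: P_def dist_f)
    then have "(case (x, y) of (x, y) \<Rightarrow> ereal (chordal_ratio A x y)) \<le> ereal \<zeta>"
      using order.trans[OF SUP_upper A(2)[folded P_def]] by blast
    then show "ereal (chordal_ratio A' (f x) (f y)) \<le> ereal \<zeta>" using ratio by simp
  qed
  ultimately show ?thesis unfolding chordal_property_def by blast
qed

lemma components_f:
  assumes "C \<in> components X"
  shows "f ` C \<in> components (f ` X)"
proof -
  have C: "C \<noteq> {}" "C \<subseteq> X" "connected C" "\<And>D. D \<noteq> {} \<Longrightarrow> C \<subseteq> D \<Longrightarrow> D \<subseteq> X \<Longrightarrow> connected D \<Longrightarrow> D = C"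
    using assms unfolding in_components_maximal by blast+
  have "connected (f ` C)" using C(3) linear_f by (simp add: connected_linear_image)
  moreover have "D = f ` C" if D: "D \<noteq> {}" "f ` C \<subseteq> D" "D \<subseteq> f ` X" "connected D" for D
  proof -
    have "connected (f' ` D)" using D(4) linear_f' by (simp add: connected_linear_image)
    moreover have "C \<subseteq> f' ` D" "f' ` D \<subseteq> X"
      using image_mono[OF D(2), of f'] image_mono[OF D(3), of f'] by (simp_all add: image_f'_f)
    moreover have "f' ` D \<noteq> {}" using D(1) by simp
    ultimately have "f' ` D = C" using C(4) by simp
    moreover have "f ` f' ` D = D" by (simp add: image_image inverse(2))
    ultimately show ?thesis by simp
  qed
  ultimately show ?thesis using C(1,2) unfolding in_components_maximal by blast
qed

text \<open>\<open>jordan_domain\<close> is a definite description, so its transport rests on unique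
  existence, assumed here on the image side.\<close>

lemma jordan_domain_f:
  assumes "\<exists>!\<Omega>. \<Omega> \<in> components (- f ` \<Gamma>) \<and> bounded \<Omega>"
  shows "f ` jordan_domain \<Gamma> = jordan_domain (f ` \<Gamma>)"
proof -
  interpret g: isometric_isomorphism f' f by (rule flip)
  have comp: "f ` (- \<Gamma>) = - f ` \<Gamma>" "f' ` (- f ` \<Gamma>) = - \<Gamma>"
    using bij_image_Compl_eq[of f \<Gamma>] bij_image_Compl_eq[of f' "f ` \<Gamma>"] inj_f surj_f g.inj_f g.surj_f
    by (simp_all add: bij_def image_f'_f)
  have bd: "bounded (f ` C)" if "bounded C" for C using that norm_f by (auto simp: bounded_iff)
  have bd': "bounded (f' ` C)" if "bounded C" for C using that g.norm_f by (auto simp: bounded_iff)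
  define \<Omega> where "\<Omega> = jordan_domain (f ` \<Gamma>)"
  have \<Omega>: "\<Omega> \<in> components (- f ` \<Gamma>)" "bounded \<Omega>"
    using theI'[OF assms] unfolding \<Omega>_def jordan_domain_def by blast+
  have "jordan_domain \<Gamma> = f' ` \<Omega>"
    unfolding jordan_domain_def
  proof (rule the_equality)
    show "f' ` \<Omega> \<in> components (- \<Gamma>) \<and> bounded (f' ` \<Omega>)"
      using g.components_f[OF \<Omega>(1)] comp(2) bd' \<Omega>(2) by simp
    fix C assume C: "C \<in> components (- \<Gamma>) \<and> bounded C"
    then have "f ` C \<in> components (- f ` \<Gamma>)" "bounded (f ` C)" using components_f[of C "- \<Gamma>"] comp(1) bd by simp_all
    then have "f ` C = \<Omega>" using assms \<Omega> by blast
    then show "C = f' ` \<Omega>" using image_f'_f by blast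
  qed
  then show ?thesis by (simp add: g.image_f'_f \<Omega>_def)
qed

lemma level_jordan_curve_property_f:
  assumes "\<exists>!\<Omega>. \<Omega> \<in> components (- f ` \<Gamma>) \<and> bounded \<Omega>" "level_jordan_curve_property (f ` \<Gamma>)"
  shows "level_jordan_curve_property \<Gamma>"
proof -
  interpret g: isometric_isomorphism f' f by (rule flip)
  have "f x \<in> jordan_domain (f ` \<Gamma>) \<longleftrightarrow> x \<in> jordan_domain \<Gamma>" for x
    unfolding jordan_domain_f[OF assms(1), symmetric] using inj_f by (simp add: inj_image_mem_iff)
  then have "signed_dist (f x) (f ` \<Gamma>) = signed_dist x \<Gamma>" for x
    by (simp add: signed_dist_def infdist_f)
  then have "x \<in> level_set \<Gamma> \<epsilon> \<longleftrightarrow> f x \<in> level_set (f ` \<Gamma>) \<epsilon>" for x \<epsilon>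
    by (simp add: level_set_def)
  then have "level_set \<Gamma> \<epsilon> = f -` level_set (f ` \<Gamma>) \<epsilon>" for \<epsilon> by auto
  then have "f ` level_set \<Gamma> \<epsilon> = level_set (f ` \<Gamma>) \<epsilon>" for \<epsilon>
    using surj_image_vimage_eq[OF surj_f] by simp
  then have "level_set \<Gamma> \<epsilon> = f' ` level_set (f ` \<Gamma>) \<epsilon>" for \<epsilon>
    using image_f'_f by metis
  then have "jordan_curve (level_set \<Gamma> \<epsilon>)" if "jordan_curve (level_set (f ` \<Gamma>) \<epsilon>)" for \<epsilon>
    using g.jordan_curve_f[OF that] by simp
  then show ?thesis using assms(2) unfolding level_jordan_curve_property_def by blast
qed

end

theorem theorem1p1:
  fixes \<Gamma> :: "(real^2) set"
  assumes "jordan_curve \<Gamma>"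
    and "\<exists>r\<^sub>0>0. chordal_property (1/2) r\<^sub>0 \<Gamma>"
  shows "level_jordan_curve_property \<Gamma>"
proof -
  obtain f :: "real^2 \<Rightarrow> complex" and f' where "linear f" "linear f'"
      "\<And>x. f' (f x) = x" "\<And>y. f (f' y) = y" "\<And>x. norm (f x) = norm x"
    by (rule isometries_subspaces[of "UNIV :: (real^2) set" "UNIV :: complex set"]) (auto simp: dim_UNIV)
  then interpret isometric_isomorphism f f' by (rule isometric_isomorphism.intro)
  obtain r0 where r0: "0 < r0" "chordal_property (1 / 2) r0 \<Gamma>" using assms(2) by blast
  have J: "jordan_curve (f ` \<Gamma>)" using assms(1) by (rule jordan_curve_f)
  obtain r \<eta> where "chordal_curve (f ` \<Gamma>) r \<eta>"
    using chordal_curve_if_chordal_property[OF J r0(1) chordal_property_f[OF r0(2)]] by blast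
  then have "level_jordan_curve_property (f ` \<Gamma>)" by (rule chordal_curve.level_jordan_curve_property)
  then show ?thesis using level_jordan_curve_property_f jordan_domain_eq_inside(2)[OF J] by blast
qed

end
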